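(* Let $\Lambda$ be the algebra of symmetric functions over $\mathbb{Q}(\alpha)$, let $A(u)$ be the formal power series in $u^{-1}$ with coefficients in operators on $\Lambda$ which is diagonal in the basis of Jack symmetric functions $J_\lambda$ with $$A(u)J_\lambda=\prod_{i\ge 1}\frac{u+i-1-\alpha\lambda_i}{u+i-1}\cdot J_\lambda ,$$ and define operators $I^{(1)},I^{(2)},\ldots$ on $\Lambda$ by $$I(u)=I^{(1)}u^{-1}+I^{(2)}u^{-2}+\cdots,\qquad 1-u^{-1}I(u)=A(u)/A(u+1).$$ Let $p=[p_1\ p_2\ \ldots]$ be the infinite row vector of operators of multiplication by power sums, $p^{\ast}$ the infinite column vector with entries $p_1^{\ast},p_2^{\ast},\ldots$ where $p_n^{\ast}=\alpha n\,\partial/\partial p_n$, and $L=[L_{ij}]_{i,j=1}^{\infty}$ the infinite matrix of operators on $\Lambda$ with entries $$L_{ij}=j(\alpha-1)\delta_{ij}+p_{j-i},\qquad\text{where } p_{-n}=p_n^{\ast}\ (n\ge1),\quad p_0=0 .$$ Then $$I(u)=p\,(u-L)^{-1}p^{\ast},$$ where the inverse of the infinite matrix $u-L$ is regarded as the formal power series $(u-L)^{-1}=u^{-1}+Lu^{-2}+L^2u^{-3}+\cdots$ in $u^{-1}$. Equivalently, for every $k\ge1$, $$I^{(k)}=\sum_{i_1,\ldots,i_k=1}^{\infty}p_{i_1}L_{i_1i_2}\cdots L_{i_{k-1}i_k}\,p^{\ast}_{i_k}.$$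
   Context: $\Lambda$ is the algebra of symmetric functions in infinitely many variables $x_1,x_2,\ldots$ over the field $\mathbb{Q}(\alpha)$, where $\alpha$ is an indeterminate. Partitions are written $\lambda=(\lambda_1\ge\lambda_2\ge\cdots)$; $\ell(\lambda)$ is the number of non-zero parts and $|\lambda|=\lambda_1+\lambda_2+\cdots$. $m_\lambda$ is the monomial symmetric function, $p_n=x_1^n+x_2^n+\cdots$ for $n\ge1$ is the power sum (also denoting the operator of multiplication by $p_n$), and $p_\lambda=p_{\lambda_1}p_{\lambda_2}\cdots p_{\lambda_{\ell(\lambda)}}$. Since $p_1,p_2,\ldots$ are free generators of $\Lambda$, $\partial/\partial p_n$ is defined as partial differentiation on $\Lambda=\mathbb{Q}(\alpha)[p_1,p_2,\ldots]$. Define the symmetric bilinear form $\langle\,,\rangle_\alpha$ on $\Lambda$ by $\langle p_\lambda,p_\mu\rangle_\alpha=\alpha^{\ell(\lambda)}z_\lambda\delta_{\lambda\mu}$, where $z_\lambda=1^{k_1}k_1!\,2^{k_2}k_2!\cdots$ and $k_1,k_2,\ldots$ are the multiplicities of the parts $1,2,\ldots$ in $\lambda$. The operator $p_n^{\ast}=\alpha n\,\partial/\partial p_n$ is the conjugate of multiplication by $p_n$ relative to this form. The natural partial order on partitions of the same number: $\mu\le\lambda$ if $\mu_1+\cdots+\mu_i\le\lambda_1+\cdots+\lambda_i$ for all $i$. The Jack symmetric functions $J_\lambda$ are the unique family of elements of $\Lambda$ such that $\langle J_\lambda,J_\mu\rangle_\alpha=0$ for $\lambda\ne\mu$ and $J_\lambda$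 equals $m_\lambda$ plus a linear combination of $m_\mu$ with $\mu<\lambda$. They form a basis of $\Lambda$. All rational functions of $u$ are expanded as formal power series in $u^{-1}$; $A(u)$ has leading coefficient $1$, so $A(u+1)$ is invertible (and commutes with $A(u)$). Infinite sums of operators on $\Lambda$ are understood as follows: only finitely many summands are non-zero on any subspace of $\Lambda$ of fixed degree in $x_1,x_2,\ldots$, when the summation is performed consecutively over $i_k,i_{k-1},\ldots,i_1$. *)

theory Defs
  imports
    "HOL-Library.Poly_Mapping"
    "HOL-Library.Multiset"
    "HOL-Computational_Algebra.Polynomial"
    "HOL-Computational_Algebra.Fraction_Field"
    "HOL-Computational_Algebra.Formal_Power_Series"
begin

section \<open>Symmetric functions in infinitely many variables\<close>

text \<open>
  The exponent vector \<open>a :: nat \<Rightarrow>\<^sub>0 nat\<close> stands for the monomial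
  \<open>x\<^sub>1^a\<^sub>0 x\<^sub>2^a\<^sub>1 \<cdots>\<close> in countably many variables.
\<close>

type_synonym mono = "nat \<Rightarrow>\<^sub>0 nat"

definition mono_deg :: "mono \<Rightarrow> nat" where
  "mono_deg a = (\<Sum>i\<in>Poly_Mapping.keys a. Poly_Mapping.lookup a i)"

text \<open>
  A symmetric function is a formal sum of monomials of bounded degree which is invariant under
  all permutations of the variables; it is given by its coefficient function.
\<close>

definition is_symfun :: "(mono \<Rightarrow> 'a::zero) \<Rightarrow> bool" where
  "is_symfun c \<longleftrightarrow>
     (\<forall>\<pi>. bij \<pi> \<longrightarrow> (\<forall>a. c (Poly_Mapping.map_key \<pi> a) = c a)) \<and>
     (\<exists>d. \<forall>a. c a \<noteq> 0 \<longrightarrow> mono_deg a \<le> d)"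

lemma is_symfunI:
  assumes "\<And>\<pi> a. bij \<pi> \<Longrightarrow> c (Poly_Mapping.map_key \<pi> a) = c a"
    and "\<And>a. c a \<noteq> 0 \<Longrightarrow> mono_deg a \<le> d"
  shows "is_symfun c"
  using assms unfolding is_symfun_def by blast

lemma is_symfun_perm: "is_symfun c \<Longrightarrow> bij \<pi> \<Longrightarrow> c (Poly_Mapping.map_key \<pi> a) = c a"
  unfolding is_symfun_def by blast

lemma is_symfun_deg: "is_symfun c \<Longrightarrow> \<exists>d. \<forall>a. c a \<noteq> 0 \<longrightarrow> mono_deg a \<le> d"
  unfolding is_symfun_def by blast

typedef (overloaded) 'a symfun = "{c :: mono \<Rightarrow> 'a::zero. is_symfun c}"
  morphisms coeff_sf Abs_symfun
  by (rule exI[of _ "\<lambda>_. 0"]) (auto simp: is_symfun_def)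

setup_lifting type_definition_symfun

lemma symfun_eqI: "(\<And>a. coeff_sf f a = coeff_sf g a) \<Longrightarrow> f = g"
  by (metis coeff_sf_inject ext)

lemma mono_deg_superset:
  assumes "finite A" "Poly_Mapping.keys a \<subseteq> A"
  shows "mono_deg a = (\<Sum>i\<in>A. Poly_Mapping.lookup a i)"
  unfolding mono_deg_def
  by (rule sum.mono_neutral_left) (use assms in \<open>auto simp: in_keys_iff\<close>)

lemma mono_deg_add: "mono_deg (a + b) = mono_deg a + mono_deg b"
proof -
  let ?A = "Poly_Mapping.keys a \<union> Poly_Mapping.keys b"
  have "mono_deg (a + b) = (\<Sum>i\<in>?A. Poly_Mapping.lookup (a + b) i)"
    by (rule mono_deg_superset) (auto simp: keys_add in_keys_iff lookup_add)
  also have "\<dots> = (\<Sum>i\<in>?A. Poly_Mapping.lookup a i) + (\<Sum>i\<in>?A. Poly_Mapping.lookup b i)"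
    by (simp add: lookup_add sum.distrib)
  also have "\<dots> = mono_deg a + mono_deg b"
    by (simp add: mono_deg_superset[of ?A])
  finally show ?thesis .
qed

lemma mono_deg_0 [simp]: "mono_deg 0 = 0"
  by (simp add: mono_deg_def)

lemma mono_deg_single [simp]: "mono_deg (Poly_Mapping.single i n) = n"
  by (simp add: mono_deg_def)

lemma finite_mono_splits: "finite {(b, e). b + e = (a :: mono)}"
proof -
  let ?F = "{f. \<forall>i. (i \<in> Poly_Mapping.keys a \<longrightarrow> f i \<in> {..mono_deg a}) \<and>
                    (i \<notin> Poly_Mapping.keys a \<longrightarrow> f i = (0::nat))}"
  have fin: "finite ?F"
    by (rule finite_set_of_finite_funs) auto
  have "(Poly_Mapping.lookup b, Poly_Mapping.lookup e) \<in> ?F \<times> ?F" if "b + e = a" for b e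
  proof -
    have le: "Poly_Mapping.lookup a i \<le> mono_deg a" if "i \<in> Poly_Mapping.keys a" for i
      unfolding mono_deg_def using that by (intro member_le_sum) auto
    have "Poly_Mapping.lookup b i + Poly_Mapping.lookup e i = Poly_Mapping.lookup a i" for i
      using that lookup_add by metis
    then have "Poly_Mapping.lookup b i \<le> Poly_Mapping.lookup a i"
      and "Poly_Mapping.lookup e i \<le> Poly_Mapping.lookup a i" for i
      by (metis le_add1, metis le_add2)
    moreover have "Poly_Mapping.lookup a i = 0" if "i \<notin> Poly_Mapping.keys a" for i
      using that by (simp add: in_keys_iff)
    ultimately show ?thesis
      using le by (simp add: mem_Times_iff) (metis le_trans le_zero_eq)
  qed
  then have "(\<lambda>(b, e). (Poly_Mapping.lookup b, Poly_Mapping.lookup e)) `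
      {(b, e). b + e = a} \<subseteq> ?F \<times> ?F"
    by auto
  then have "finite ((\<lambda>(b, e). (Poly_Mapping.lookup b, Poly_Mapping.lookup e)) `
      {(b, e). b + e = a})"
    using fin by (meson finite_SigmaI finite_subset)
  then show ?thesis
    by (rule finite_imageD) (auto simp: inj_on_def)
qed

definition conv :: "(mono \<Rightarrow> 'a::semiring_0) \<Rightarrow> (mono \<Rightarrow> 'a) \<Rightarrow> mono \<Rightarrow> 'a" where
  "conv c d a = (\<Sum>(b, e)\<in>{(b, e). b + e = a}. c b * d e)"

lemma conv_nonzeroD:
  assumes "conv c d a \<noteq> 0"
  shows "\<exists>b e. b + e = a \<and> c b \<noteq> 0 \<and> d e \<noteq> 0"
proof (rule ccontr)
  assume "\<not> ?thesis"
  then have "c b * d e = 0" if "b + e = a" for b e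
    using that by (metis mult_zero_left mult_zero_right)
  then have "conv c d a = 0"
    unfolding conv_def by (intro sum.neutral) auto
  with assms show False by simp
qed

lemma map_key_bij_inverse:
  assumes "bij \<pi>"
  shows "Poly_Mapping.map_key \<pi> (Poly_Mapping.map_key (inv \<pi>) a) = a"
    and "Poly_Mapping.map_key (inv \<pi>) (Poly_Mapping.map_key \<pi> a) = a"
proof -
  have "inj \<pi>" "inj (inv \<pi>)" "inv \<pi> \<circ> \<pi> = (\<lambda>x. x)" "\<pi> \<circ> inv \<pi> = (\<lambda>x. x)"
    using assms bij_imp_bij_inv[OF assms]
    by (simp_all add: bij_is_inj fun_eq_iff bij_is_surj surj_f_inv_f)
  then show "Poly_Mapping.map_key \<pi> (Poly_Mapping.map_key (inv \<pi>) a) = a"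
    and "Poly_Mapping.map_key (inv \<pi>) (Poly_Mapping.map_key \<pi> a) = a"
    by (simp_all only: map_key_compose map_key_id)
qed

lemma conv_perm:
  assumes c: "is_symfun c" and d: "is_symfun d" and p: "bij \<pi>"
  shows "conv c d (Poly_Mapping.map_key \<pi> a) = conv c d a"
proof -
  let ?m = "Poly_Mapping.map_key \<pi> :: mono \<Rightarrow> mono"
  let ?m' = "Poly_Mapping.map_key (inv \<pi>) :: mono \<Rightarrow> mono"
  have inj: "inj \<pi>" and inj': "inj (inv \<pi>)"
    using p by (simp_all add: bij_is_inj bij_imp_bij_inv)
  note inv = map_key_bij_inverse[OF p]
  have m: "?m b + ?m e = ?m a" if "b + e = a" for a b e
    using map_key_plus[OF inj, of b e] that by simp
  have m': "?m' b + ?m' e = a" if "b + e = ?m a" for a b e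
    using map_key_plus[OF inj', of b e] that by (simp add: inv)
  show ?thesis
    unfolding conv_def
    by (rule sum.reindex_bij_witness
        [where i = "\<lambda>(b, e). (?m b, ?m e)" and j = "\<lambda>(b, e). (?m' b, ?m' e)"])
      (clarsimp simp: inv m m' is_symfun_perm[OF c bij_imp_bij_inv[OF p]]
        is_symfun_perm[OF d bij_imp_bij_inv[OF p]])+
qed

lemma conv_symfun:
  assumes c: "is_symfun c" and d: "is_symfun d"
  shows "is_symfun (conv c d)"
proof -
  obtain m n where "\<And>a. c a \<noteq> 0 \<Longrightarrow> mono_deg a \<le> m" "\<And>a. d a \<noteq> 0 \<Longrightarrow> mono_deg a \<le> n"
    using is_symfun_deg[OF c] is_symfun_deg[OF d] by blast
  then have "mono_deg a \<le> m + n" if "conv c d a \<noteq> 0" for a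
    using conv_nonzeroD[OF that] by (auto simp: mono_deg_add intro!: add_mono)
  then show ?thesis
    by (intro is_symfunI) (auto simp: conv_perm[OF c d])
qed

lemma conv_comm: "conv c d = conv d (c :: mono \<Rightarrow> 'a::comm_semiring_0)"
proof
  fix a
  show "conv c d a = conv d c a"
    unfolding conv_def
    by (rule sum.reindex_bij_witness[where i = "\<lambda>(b, e). (e, b)" and j = "\<lambda>(b, e). (e, b)"])
      (auto simp: add.commute mult.commute)
qed

lemma conv_add_left: "conv (\<lambda>a. c a + c' a) d a = conv c d a + conv c' d a"
  by (simp add: conv_def sum.distrib[symmetric] distrib_right case_prod_beta)

lemma conv_one: "conv (\<lambda>a. if a = 0 then 1 else 0) d a = (d a :: 'a::semiring_1)"
proof -
  have "conv (\<lambda>a. if a = 0 then 1 else 0) d a =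
      (\<Sum>(b, e)\<in>{(0 :: mono, a)}. (if b = 0 then 1 else 0) * d e)"
    unfolding conv_def
    by (rule sum.mono_neutral_right) (auto simp: finite_mono_splits split: if_splits)
  then show ?thesis by simp
qed

lemma conv_assoc: "conv (conv c d) g a = conv c (conv d g) a"
proof -
  have "conv (conv c d) g a =
      (\<Sum>(x, z)\<in>{(x, z). x + z = a}. \<Sum>(b, e)\<in>{(b, e). b + e = x}. c b * d e * g z)"
    by (simp add: conv_def sum_distrib_right case_prod_beta)
  also have "\<dots> = (\<Sum>((x, z), (b, e))\<in>(SIGMA p : {(x, z). x + z = a}. {(b, e). b + e = fst p}).
      c b * d e * g z)"
    by (subst sum.Sigma[symmetric]) (auto simp: finite_mono_splits case_prod_beta)
  also have "\<dots> = (\<Sum>((b, y), (e, z))\<in>(SIGMA p : {(b, y). b + y = a}. {(e, z). e + z = snd p}).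
      c b * (d e * g z))"
    by (rule sum.reindex_bij_witness
        [where i = "\<lambda>((b, y), (e, z)). ((b + e, z), (b, e))"
          and j = "\<lambda>((x, z), (b, e)). ((b, e + z), (e, z))"])
      (auto simp: add.assoc mult.assoc)
  also have "\<dots> = (\<Sum>(b, y)\<in>{(b, y). b + y = a}. \<Sum>(e, z)\<in>{(e, z). e + z = y}.
      c b * (d e * g z))"
    by (subst sum.Sigma[symmetric]) (auto simp: finite_mono_splits case_prod_beta)
  also have "\<dots> = conv c (conv d g) a"
    by (simp add: conv_def sum_distrib_left case_prod_beta)
  finally show ?thesis .
qed

lemma map_key_eq_0_iff:
  fixes \<pi> :: "nat \<Rightarrow> nat"
  assumes "bij \<pi>"
  shows "Poly_Mapping.map_key \<pi> a = 0 \<longleftrightarrow> a = (0 :: mono)"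
proof
  have inj: "inj \<pi>" "inj (inv \<pi>)"
    using assms by (simp_all add: bij_is_inj bij_imp_bij_inv)
  show "Poly_Mapping.map_key \<pi> a = 0" if "a = 0"
    using that by (simp add: map_key_zero[OF inj(1)])
  show "a = 0" if "Poly_Mapping.map_key \<pi> a = 0"
    using map_key_bij_inverse(2)[OF assms, of a] that by (simp add: map_key_zero[OF inj(2)])
qed

instantiation symfun :: (comm_ring_1) comm_ring_1
begin

lift_definition zero_symfun :: "'a symfun" is "\<lambda>_. 0"
  by (auto simp: is_symfun_def)

lift_definition one_symfun :: "'a symfun" is "\<lambda>a. if a = 0 then 1 else 0"
  by (rule is_symfunI[where d = 0]) (auto simp: map_key_eq_0_iff split: if_splits)

lift_definition plus_symfun :: "'a symfun \<Rightarrow> 'a symfun \<Rightarrow> 'a symfun" is "\<lambda>c d a. c a + d a"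
proof -
  fix c d :: "mono \<Rightarrow> 'a"
  assume c: "is_symfun c" and d: "is_symfun d"
  obtain m n where "\<And>a. c a \<noteq> 0 \<Longrightarrow> mono_deg a \<le> m" "\<And>a. d a \<noteq> 0 \<Longrightarrow> mono_deg a \<le> n"
    using is_symfun_deg[OF c] is_symfun_deg[OF d] by blast
  then have "mono_deg a \<le> m + n" if "c a + d a \<noteq> 0" for a
    using that by (metis add.right_neutral le_add1 le_add2 le_trans)
  then show "is_symfun (\<lambda>a. c a + d a)"
    by (intro is_symfunI) (auto simp: is_symfun_perm[OF c] is_symfun_perm[OF d])
qed

lift_definition uminus_symfun :: "'a symfun \<Rightarrow> 'a symfun" is "\<lambda>c a. - c a"
  by (auto simp: is_symfun_def)

definition minus_symfun :: "'a symfun \<Rightarrow> 'a symfun \<Rightarrow> 'a symfun" where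
  "minus_symfun f g = f + - g"

lift_definition times_symfun :: "'a symfun \<Rightarrow> 'a symfun \<Rightarrow> 'a symfun" is conv
  by (rule conv_symfun)

instance
proof
  fix f g h :: "'a symfun"
  show "f + g + h = f + (g + h)" by transfer (simp add: add.assoc)
  show "f + g = g + f" by transfer (simp add: add.commute)
  show "0 + f = f" by transfer simp
  show "- f + f = 0" by transfer simp
  show "f - g = f + - g" by (simp add: minus_symfun_def)
  show "f * g * h = f * (g * h)" by transfer (simp add: conv_assoc fun_eq_iff)
  show "f * g = g * f" by transfer (rule conv_comm)
  show "1 * f = f" by transfer (simp add: conv_one fun_eq_iff)
  show "(f + g) * h = f * h + g * h" by transfer (simp add: conv_add_left fun_eq_iff)
  show "(0 :: 'a symfun) \<noteq> 1" by transfer (simp add: fun_eq_iff)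
qed

end

lift_definition scale_sf :: "'a::comm_ring_1 \<Rightarrow> 'a symfun \<Rightarrow> 'a symfun" is "\<lambda>r c a. r * c a"
proof -
  fix r and c :: "mono \<Rightarrow> 'a"
  assume c: "is_symfun c"
  then obtain m where "\<And>a. c a \<noteq> 0 \<Longrightarrow> mono_deg a \<le> m"
    using is_symfun_deg by blast
  then show "is_symfun (\<lambda>a. r * c a)"
    by (intro is_symfunI[where d = m]) (auto simp: is_symfun_perm[OF c], metis mult_zero_right)
qed

interpretation sf: module scale_sf
  by standard (transfer; simp add: algebra_simps)+

interpretation sf_pair: module_pair scale_sf scale_sf ..

lemma scale_sf_mult_right: "f * scale_sf r g = scale_sf r (f * g)"
  by transfer (simp add: conv_def sum_distrib_left case_prod_beta fun_eq_iff mult.left_commute)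

definition homogeneous :: "nat \<Rightarrow> 'a::zero symfun \<Rightarrow> bool" where
  "homogeneous d f \<longleftrightarrow> (\<forall>a. coeff_sf f a \<noteq> 0 \<longrightarrow> mono_deg a = d)"


section \<open>Partitions, monomial symmetric functions, power sums\<close>

text \<open>A partition is the weakly decreasing list of its non-zero parts.\<close>

definition is_partition :: "nat list \<Rightarrow> bool" where
  "is_partition lam \<longleftrightarrow> sorted_wrt (\<ge>) lam \<and> 0 \<notin> set lam"

text \<open>For \<open>i\<close> beyond the number of parts \<open>take i\<close> returns the full list.\<close>

definition dominated :: "nat list \<Rightarrow> nat list \<Rightarrow> bool" where
  "dominated mu lam \<longleftrightarrow>
     sum_list mu = sum_list lam \<and> (\<forall>i. sum_list (take i mu) \<le> sum_list (take i lam))"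

text \<open>The multiset of the non-zero exponents of a monomial.\<close>

definition exponents :: "mono \<Rightarrow> nat multiset" where
  "exponents a = image_mset (Poly_Mapping.lookup a) (mset_set (Poly_Mapping.keys a))"

lemma exponents_perm:
  assumes "bij \<pi>"
  shows "exponents (Poly_Mapping.map_key \<pi> a) = exponents a"
proof -
  have inj: "inj \<pi>" using assms by (rule bij_is_inj)
  let ?K = "\<pi> -` Poly_Mapping.keys a"
  have "exponents (Poly_Mapping.map_key \<pi> a)
      = image_mset (Poly_Mapping.lookup a \<circ> \<pi>) (mset_set ?K)"
    unfolding exponents_def by (simp add: keys_map_key[OF inj] map_key.rep_eq[OF inj])
  also have "\<dots> = image_mset (Poly_Mapping.lookup a) (mset_set (\<pi> ` ?K))"
    by (simp only: image_mset_mset_set[OF inj_on_subset[OF inj subset_UNIV], symmetric]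
        multiset.map_comp)
  also have "\<pi> ` ?K = Poly_Mapping.keys a"
    using assms by (simp add: bij_is_surj)
  finally show ?thesis by (simp add: exponents_def)
qed

lemma mono_deg_exponents: "mono_deg a = sum_mset (exponents a)"
  by (simp add: mono_deg_def exponents_def sum_unfold_sum_mset)

lift_definition monomial_sf :: "nat list \<Rightarrow> 'a::comm_ring_1 symfun" is
  "\<lambda>lam a. if exponents a = mset lam then 1 else 0"
  by (rule is_symfunI[where d = "sum_list lam" for lam])
    (auto simp: exponents_perm mono_deg_exponents sum_mset_sum_list split: if_splits)

lemma map_key_single_bij:
  fixes \<pi> :: "nat \<Rightarrow> nat"
  assumes "bij \<pi>"
  shows "(\<exists>i. Poly_Mapping.map_key \<pi> a = Poly_Mapping.single i (n::nat)) \<longleftrightarrow>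
    (\<exists>i. a = Poly_Mapping.single i n)"
proof -
  have single: "Poly_Mapping.map_key \<sigma> (Poly_Mapping.single i n) = Poly_Mapping.single (inv \<sigma> i) n"
    if "bij \<sigma>" for \<sigma> i
    using map_key_single[OF bij_is_inj[OF that], of "inv \<sigma> i" n] that
    by (simp add: bij_is_surj surj_f_inv_f)
  show ?thesis
    using single[OF assms] single[OF bij_imp_bij_inv[OF assms]] map_key_bij_inverse(2)[OF assms]
    by metis
qed

lift_definition power_sum :: "nat \<Rightarrow> 'a::comm_ring_1 symfun" is
  "\<lambda>n a. if \<exists>i. a = Poly_Mapping.single i n then 1 else 0"
  by (rule is_symfunI[where d = n for n]) (auto simp: map_key_single_bij split: if_splits)

definition power_sum_prod :: "nat list \<Rightarrow> 'a::comm_ring_1 symfun" where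
  "power_sum_prod lam = prod_list (map power_sum lam)"

definition z_part :: "nat list \<Rightarrow> nat" where
  "z_part lam = (\<Prod>i\<in>set lam. i ^ count_list lam i * fact (count_list lam i))"


section \<open>Linear operators on symmetric functions\<close>

typedef (overloaded) 'a symop =
  "{T :: 'a::comm_ring_1 symfun \<Rightarrow> 'a symfun. module_hom scale_sf scale_sf T}"
  morphisms app Abs_symop
  by (rule exI[of _ "\<lambda>_. 0"]) (simp add: sf_pair.module_hom_zero)

setup_lifting type_definition_symop

text \<open>Multiplication of operators is composition.\<close>

instantiation symop :: (comm_ring_1) ring_1
begin

lift_definition zero_symop :: "'a symop" is "\<lambda>_. 0"
  by (rule sf_pair.module_hom_zero)

lift_definition one_symop :: "'a symop" is "\<lambda>f. f"
  by (rule sf.module_hom_ident)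

lift_definition plus_symop :: "'a symop \<Rightarrow> 'a symop \<Rightarrow> 'a symop" is "\<lambda>S T f. S f + T f"
  by (rule sf_pair.module_hom_add)

lift_definition minus_symop :: "'a symop \<Rightarrow> 'a symop \<Rightarrow> 'a symop" is "\<lambda>S T f. S f - T f"
  by (rule sf_pair.module_hom_sub)

lift_definition uminus_symop :: "'a symop \<Rightarrow> 'a symop" is "\<lambda>T f. - T f"
  by (rule sf_pair.module_hom_neg)

lift_definition times_symop :: "'a symop \<Rightarrow> 'a symop \<Rightarrow> 'a symop" is "\<lambda>S T f. S (T f)"
  by (metis (no_types, lifting) module_hom_compose comp_def ext)

instance
proof
  fix R S T :: "'a symop"
  show "R + S + T = R + (S + T)" by transfer (simp add: add.assoc)
  show "R + S = S + R" by transfer (simp add: add.commute)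
  show "0 + R = R" by transfer simp
  show "- R + R = 0" by transfer simp
  show "R - S = R + - S" by transfer simp
  show "R * S * T = R * (S * T)" by transfer simp
  show "1 * R = R" "R * 1 = R" by (transfer; simp)+
  show "(R + S) * T = R * T + S * T" by transfer simp
  show "R * (S + T) = R * S + R * T"
    by transfer (auto simp: module_hom.add)
  show "(0 :: 'a symop) \<noteq> 1" by transfer (metis zero_neq_one)
qed

end

definition mult_op :: "'a::comm_ring_1 symfun \<Rightarrow> 'a symop" where
  "mult_op g = Abs_symop (\<lambda>f. g * f)"

lemma app_mult_op [simp]: "app (mult_op g) f = g * f"
proof -
  have "module_hom scale_sf scale_sf (\<lambda>f. g * f)"
    by (simp add: module_hom_iff sf.module_axioms distrib_left scale_sf_mult_right)
  then show ?thesis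
    by (simp add: mult_op_def Abs_symop_inverse)
qed

lift_definition scalar_op :: "'a::comm_ring_1 \<Rightarrow> 'a symop" is scale_sf
  by (rule sf.module_hom_scale_self)

text \<open>
  \<open>\<partial>/\<partial>p\<^sub>n\<close>: the linear operator that differentiates every monomial in the free generators
  \<open>p\<^sub>1, p\<^sub>2, \<dots>\<close> partially with respect to \<open>p\<^sub>n\<close>. When \<open>n\<close> is not a part of \<open>lam\<close> the
  coefficient on the right-hand side is 0. There is exactly one such operator because the
  products \<open>power_sum_prod lam\<close> form a basis over a field of characteristic 0.
\<close>

definition partial_p :: "nat \<Rightarrow> 'a::comm_ring_1 symop" where
  "partial_p n = (THE D. \<forall>lam. is_partition lam \<longrightarrow>
     app D (power_sum_prod lam) =
       scale_sf (of_nat (count_list lam n)) (power_sum_prod (remove1 n lam)))"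


section \<open>Infinite sums of operators and infinite matrices\<close>

text \<open>
  All indices run over the positive integers. A family of operators is summable if on every
  homogeneous component only finitely many members are non-zero; since \<open>\<Lambda>\<close> is spanned by its
  homogeneous components, the sum is then unique.
\<close>

definition has_opsum :: "(nat \<Rightarrow> 'a::comm_ring_1 symop) \<Rightarrow> 'a symop \<Rightarrow> bool" where
  "has_opsum F S \<longleftrightarrow>
     (\<forall>d. finite {i. 1 \<le> i \<and> (\<exists>f. homogeneous d f \<and> app (F i) f \<noteq> 0)} \<and>
       (\<forall>f. homogeneous d f \<longrightarrow>
         app S f = (\<Sum>i | 1 \<le> i \<and> (\<exists>g. homogeneous d g \<and> app (F i) g \<noteq> 0). app (F i) f)))"

definition opsum :: "(nat \<Rightarrow> 'a::comm_ring_1 symop) \<Rightarrow> 'a symop" where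
  "opsum F = (THE S. has_opsum F S)"

text \<open>
  The \<open>k\<close>-fold sum of \<open>F [i\<^sub>1, \<dots>, i\<^sub>k]\<close>, performed consecutively over
  \<open>i\<^sub>k\<close>, \<open>i\<^sub>k\<^sub>-\<^sub>1\<close>, \dots, \<open>i\<^sub>1\<close>: the sum over \<open>i\<^sub>1\<close> is the outermost one.
\<close>

fun has_iter_opsum :: "nat \<Rightarrow> (nat list \<Rightarrow> 'a::comm_ring_1 symop) \<Rightarrow> 'a symop \<Rightarrow> bool" where
  "has_iter_opsum 0 F S \<longleftrightarrow> S = F []"
| "has_iter_opsum (Suc k) F S \<longleftrightarrow>
     (\<exists>G. (\<forall>i\<ge>1. has_iter_opsum k (\<lambda>js. F (i # js)) (G i)) \<and> has_opsum G S)"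

type_synonym 'a opmatrix = "nat \<Rightarrow> nat \<Rightarrow> 'a symop"

definition opmatrix_mult :: "'a::comm_ring_1 opmatrix \<Rightarrow> 'a opmatrix \<Rightarrow> 'a opmatrix" where
  "opmatrix_mult M N i j = opsum (\<lambda>k. M i k * N k j)"

primrec opmatrix_power :: "'a::comm_ring_1 opmatrix \<Rightarrow> nat \<Rightarrow> 'a opmatrix" where
  "opmatrix_power M 0 = (\<lambda>i j. if i = j then 1 else 0)"
| "opmatrix_power M (Suc n) = opmatrix_mult M (opmatrix_power M n)"

text \<open>
  From here on power series in \<open>u\<^sup>-\<^sup>1\<close> are formal power series with \<open>fps_X\<close> standing for
  \<open>u\<^sup>-\<^sup>1\<close>. The \<open>(i, j)\<close> entry of \<open>(u - M)\<^sup>-\<^sup>1 = u\<^sup>-\<^sup>1 + M u\<^sup>-\<^sup>2 + M\<^sup>2 u\<^sup>-\<^sup>3 + \<cdots>\<close>: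
\<close>

definition resolvent :: "'a::comm_ring_1 opmatrix \<Rightarrow> nat \<Rightarrow> nat \<Rightarrow> 'a symop fps" where
  "resolvent M i j = Abs_fps (\<lambda>n. case n of 0 \<Rightarrow> 0 | Suc m \<Rightarrow> opmatrix_power M m i j)"

text \<open>The product row vector times matrix times column vector, coefficientwise in \<open>u\<^sup>-\<^sup>1\<close>.\<close>

definition row_matrix_col ::
  "(nat \<Rightarrow> 'a::comm_ring_1 symop) \<Rightarrow> (nat \<Rightarrow> nat \<Rightarrow> 'a symop fps) \<Rightarrow> (nat \<Rightarrow> 'a symop) \<Rightarrow>
    'a symop fps" where
  "row_matrix_col r M c =
     Abs_fps (\<lambda>n. opsum (\<lambda>i. opsum (\<lambda>j. r i * fps_nth (M i j) n * c j)))"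

text \<open>The substitution of \<open>u + 1\<close> for \<open>u\<close>, i.e. of \<open>u\<^sup>-\<^sup>1 / (1 + u\<^sup>-\<^sup>1)\<close> for \<open>u\<^sup>-\<^sup>1\<close>.\<close>

definition shift_u :: "'a::ring_1 fps \<Rightarrow> 'a fps" where
  "shift_u A = A oo (fps_X * fps_right_inverse (1 + fps_X) 1)"


section \<open>Jack symmetric functions and the operators of the quantum Benjamin-Ono hierarchy\<close>

text \<open>The field of rational functions in one indeterminate \<open>\<alpha>\<close>.\<close>

type_synonym ratfun = "rat poly fract"

definition alpha :: ratfun where
  "alpha = Fraction_Field.Fract [:0, 1:] 1"

text \<open>The bilinear form is determined by its values on the basis of products of power sums.\<close>

definition jack_form :: "ratfun symfun \<Rightarrow> ratfun symfun \<Rightarrow> ratfun" where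
  "jack_form = (THE B.
     (\<forall>f. module_hom scale_sf (*) (B f)) \<and>
     (\<forall>g. module_hom scale_sf (*) (\<lambda>f. B f g)) \<and>
     (\<forall>lam mu. is_partition lam \<longrightarrow> is_partition mu \<longrightarrow>
        B (power_sum_prod lam) (power_sum_prod mu) =
          (if lam = mu then alpha ^ length lam * of_nat (z_part lam) else 0)))"

text \<open>
  The values of \<open>J\<close> on lists that are not partitions are irrelevant. The span expresses the
  linear combinations of the monomial symmetric functions of strictly smaller partitions.
\<close>

definition jack_family :: "(nat list \<Rightarrow> ratfun symfun) \<Rightarrow> bool" where
  "jack_family J \<longleftrightarrow>
     (\<forall>lam mu. is_partition lam \<longrightarrow> is_partition mu \<longrightarrow> lam \<noteq> mu \<longrightarrow> jack_form (J lam) (J mu) = 0) \<and>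
     (\<forall>lam. is_partition lam \<longrightarrow>
        J lam - monomial_sf lam \<in>
          sf.span {monomial_sf mu | mu. is_partition mu \<and> dominated mu lam \<and> mu \<noteq> lam})"

text \<open>
  The factor \<open>(u + i - 1 - \<alpha> \<lambda>\<^sub>i) / (u + i - 1)\<close> with numerator and denominator multiplied by
  \<open>u\<^sup>-\<^sup>1\<close>. The factors with \<open>i\<close> greater than the number of parts are 1.
\<close>

definition A_eigenvalue :: "nat list \<Rightarrow> ratfun fps" where
  "A_eigenvalue lam =
     (\<Prod>i = 1..length lam.
        (1 + fps_const (of_nat i - 1 - alpha * of_nat (lam ! (i - 1))) * fps_X) /
        (1 + fps_const (of_nat i - 1) * fps_X))"

definition p_op :: "nat \<Rightarrow> ratfun symop" where
  "p_op n = mult_op (power_sum n)"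

definition p_star :: "nat \<Rightarrow> ratfun symop" where
  "p_star n = scalar_op (alpha * of_nat n) * partial_p n"

text \<open>The operators \<open>p\<^sub>n\<close> for all integers \<open>n\<close>, with \<open>p\<^sub>-\<^sub>n = p\<^sub>n\<^sup>*\<close> and \<open>p\<^sub>0 = 0\<close>.\<close>

definition p_int :: "int \<Rightarrow> ratfun symop" where
  "p_int n = (if n > 0 then p_op (nat n) else if n < 0 then p_star (nat (- n)) else 0)"

definition lax :: "ratfun opmatrix" where
  "lax i j = (if i = j then scalar_op (of_nat j * (alpha - 1)) else 0) + p_int (int j - int i)"

text \<open>\<open>p\<^sub>i\<^sub>1 L\<^sub>i\<^sub>1\<^sub>i\<^sub>2 \<cdots> p\<^sup>*\<^sub>i\<^sub>k\<close> for a list of indices \<open>[i\<^sub>1, \<dots>, i\<^sub>k]\<close> with \<open>k \<ge> 1\<close>.\<close>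

definition lax_term :: "nat list \<Rightarrow> ratfun symop" where
  "lax_term js =
     p_op (hd js) *
     prod_list (map (\<lambda>r. lax (js ! r) (js ! Suc r)) [0..<length js - 1]) *
     p_star (last js)"

end

theory Submission
  imports Defs "HOL-Combinatorics.Permutations" "HOL-Library.Multiset_Order"
begin

text \<open>
  Let \<open>H\<^sub>k\<close> be the coefficient of \<open>u\<^sup>-\<^sup>k\<close> in \<open>p (u - L)\<^sup>-\<^sup>1 p\<^sup>*\<close>. It is self-adjoint, since \<open>p\<^sub>n\<^sup>*\<close> is adjoint
  to \<open>p\<^sub>n\<close> and \<open>L\<^sub>i\<^sub>j\<close> to \<open>L\<^sub>j\<^sub>i\<close>. A column \<open>(v\<^sub>j)\<close> of symmetric functions is encoded by the series
  \<open>\<Sum>\<^sub>j x\<^sub>1\<^sup>j v\<^sub>j\<close>, which is symmetric in \<open>x\<^sub>2, x\<^sub>3, \<dots>\<close>. In this encoding \<open>p\<^sup>*\<close> becomes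
  \<open>\<alpha> x\<^sub>1 \<partial>/\<partial>x\<^sub>1\<close>, \<open>L\<close> becomes the operator
  \<open>\<alpha> x\<^sub>1 \<partial>/\<partial>x\<^sub>1 - 1 + \<Sum>\<^sub>i\<^sub>>\<^sub>1 (x\<^sub>i - x\<^sub>1 s\<^sub>1\<^sub>i) / (x\<^sub>1 - x\<^sub>i)\<close> of Dunkl type, and \<open>p\<close> becomes
  symmetrization. Up to smaller monomials the Dunkl operator only exchanges two exponents, so
  \<open>H\<^sub>k\<close> is triangular in the monomial basis, and its diagonal entries satisfy a recursion whose
  generating function telescopes to the eigenvalue of \<open>A(u)/A(u + 1)\<close>. A self-adjoint triangular
  operator is diagonal in the orthogonal triangular basis \<open>J\<^sub>\<lambda>\<close>, so \<open>H\<^sub>k\<close> and \<open>I\<^sup>(\<^sup>k\<^sup>)\<close> have the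
  same eigenvalues on that basis.
\<close>

section \<open>Monomials and their exponents\<close>

text \<open>The recursion for the diagonal entries can be solved because it is triangular itself.
  When the exponents \<open>a\<close> of \<open>x_1\<close> and \<open>b\<close> of
  \<open>x_i\<close> are exchanged, only the outcome with \<open>min a b\<close> on
  \<open>x_1\<close> matters at the largest monomial, so the weight of a part involves only that
  part and smaller ones. Let \<open>T_i\<close> be the sum of the generating functions of all parts
  of a partition after the first \<open>i\<close>. The recursion says that
  \<open>u + i - T_i\<close> is multiplied by \<open>(u + i + 1 - \<alpha> \<lambda>_(i+1)) / (u + i
  - \<alpha> \<lambda>_(i+1))\<close> when \<open>i\<close> grows by 1, and these are numerators of
  \<open>A(u + 1)\<close> and \<open>A(u)\<close>.

  The infinite sums are controlled by degree. \<open>L_ij\<close> shifts the degree by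
  \<open>j - i\<close>, so entry \<open>i\<close> of the column \<open>L^k p^*\<close> lowers it by
  \<open>i\<close>. On symmetric functions of degree at most \<open>d\<close> every sum can
  therefore be cut off at one common index, and all rearrangements are made with finite
  sums.\<close>

abbreviation lk :: "mono \<Rightarrow> nat \<Rightarrow> nat" where
  "lk \<equiv> Poly_Mapping.lookup"

abbreviation upd :: "nat \<Rightarrow> nat \<Rightarrow> mono \<Rightarrow> mono" where
  "upd \<equiv> Poly_Mapping.update"

lemma mono_eqI: "(\<And>i. lk a i = lk b i) \<Longrightarrow> a = b"
  by (rule poly_mapping_eqI)

lemma lookup_map_key_inj: "inj \<pi> \<Longrightarrow> lk (Poly_Mapping.map_key \<pi> a) i = lk a (\<pi> i)"
  by (simp add: map_key.rep_eq)

lemma upd_same [simp]: "upd i (lk c i) c = c"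
  by (rule mono_eqI) (simp add: lookup_update)

lemma upd_upd [simp]: "upd i x (upd i y c) = upd i x c"
  by (rule mono_eqI) (simp add: lookup_update)

lemma upd_commute: "i \<noteq> j \<Longrightarrow> upd i x (upd j y c) = upd j y (upd i x c)"
  by (rule mono_eqI) (simp add: lookup_update)

lemma exponents_superset:
  assumes "finite A" "Poly_Mapping.keys a \<subseteq> A"
  shows "exponents a = filter_mset (\<lambda>x. x \<noteq> 0) (image_mset (lk a) (mset_set A))"
proof -
  have "{x \<in> A. lk a x \<noteq> 0} = Poly_Mapping.keys a"
    using assms(2) by (auto simp: in_keys_iff)
  moreover have "filter_mset (\<lambda>x. x \<noteq> 0) (image_mset (lk a) (mset_set A)) =
      image_mset (lk a) (mset_set {x \<in> A. lk a x \<noteq> 0})"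
    using assms(1) by (simp only: filter_mset_image_mset filter_mset_mset_set)
  ultimately show ?thesis
    by (simp add: exponents_def)
qed

lemma exponents_upd:
  "exponents (upd i x c) = (if x = 0 then {#} else {#x#}) + exponents (upd i 0 c)"
proof -
  let ?A = "insert i (Poly_Mapping.keys c)"
  have k: "Poly_Mapping.keys (upd i y c) \<subseteq> ?A" for y
    by (auto simp: keys_update split: if_splits)
  have e: "image_mset (lk (upd i y c)) (mset_set (?A - {i})) = image_mset (lk c) (mset_set (?A - {i}))" for y
    by (rule image_mset_cong) (auto simp: lookup_update)
  have A: "mset_set ?A = add_mset i (mset_set (?A - {i}))"
    by (subst mset_set.remove[of ?A i]) simp_all
  have "exponents (upd i y c) = (if y = 0 then {#} else {#y#}) +
      filter_mset (\<lambda>x. x \<noteq> 0) (image_mset (lk c) (mset_set (?A - {i})))" for y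
    by (subst exponents_superset[OF _ k], simp, subst A) (simp add: lookup_update e[simplified])
  from this[of x] this[of 0] show ?thesis by simp
qed

lemma exponents_split:
  "exponents c = (if lk c i = 0 then {#} else {#lk c i#}) + exponents (upd i 0 c)"
  using exponents_upd[of i "lk c i" c] by simp

lemma zero_notin_exponents [simp]: "0 \<notin># exponents c"
  by (auto simp: exponents_def in_keys_iff)

lemma exponents_0 [simp]: "exponents 0 = {#}"
  by (simp add: exponents_def)

lemma exponents_surj: "0 \<notin># M \<Longrightarrow> \<exists>c. exponents c = M"
proof (induction M)
  case empty
  show ?case by (rule exI[of _ 0]) simp
next
  case (add x M)
  then obtain c where c: "exponents c = M" by auto
  obtain i where "i \<notin> Poly_Mapping.keys c"
    by (meson ex_new_if_finite finite_keys infinite_UNIV_nat)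
  then have "upd i 0 c = c"
    by (metis in_keys_iff upd_same)
  with add.prems c show ?case
    by (intro exI[of _ "upd i x c"]) (simp add: exponents_upd[of i x])
qed

lemma coeff_sf_perm: "bij \<pi> \<Longrightarrow> coeff_sf f (Poly_Mapping.map_key \<pi> a) = coeff_sf f a"
  using coeff_sf[of f] is_symfun_perm by blast

lemma exponents_eq_imp_perm:
  assumes "exponents a = exponents b"
  obtains \<pi> where "bij \<pi>" "a = Poly_Mapping.map_key \<pi> b"
proof -
  let ?A = "Poly_Mapping.keys a \<union> Poly_Mapping.keys b"
  let ?M = "\<lambda>c. image_mset (lk c) (mset_set ?A)"
  have f: "filter_mset (\<lambda>x. x \<noteq> 0) (?M a) = filter_mset (\<lambda>x. x \<noteq> 0) (?M b)"
    using assms exponents_superset[of ?A a] exponents_superset[of ?A b] by simp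
  \<comment> \<open>The non-zero entries agree by assumption. Equal sizes then force equally many
    zeros, so the variables missing from one of the supports can be matched as well.\<close>
  have sz: "size N = size (filter_mset (\<lambda>x. x \<noteq> 0) N) + count N 0" for N :: "nat multiset"
    by (induction N) auto
  have "count (?M a) x = count (?M b) x" for x
  proof (cases "x = 0")
    case True
    have "size (?M a) = size (?M b)" by simp
    with sz[of "?M a"] sz[of "?M b"] f True show ?thesis by simp
  next
    case False
    then show ?thesis
      using arg_cong[OF f, of "\<lambda>N. count N x"] by simp
  qed
  then have eq: "?M a = ?M b" by (rule multiset_eqI)
  have fin: "finite ?A" by simp
  obtain p where p: "p permutes ?A" "\<forall>x\<in>?A. lk a x = lk b (p x)"
    by (rule image_mset_eq_implies_permutes[OF fin eq])
  have "lk a i = lk b (p i)" for i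
  proof (cases "i \<in> ?A")
    case True
    with p(2) show ?thesis by blast
  next
    case False
    then have "lk a i = 0" "lk b i = 0" by (simp_all add: in_keys_iff)
    with permutes_not_in[OF p(1) False] show ?thesis by simp
  qed
  then have "a = Poly_Mapping.map_key p b"
    by (intro mono_eqI) (simp add: lookup_map_key_inj permutes_inj[OF p(1)])
  with permutes_bij[OF p(1)] that show thesis by blast
qed

lemma coeff_sf_cong:
  assumes "exponents a = exponents b"
  shows "coeff_sf f a = coeff_sf f b"
  by (metis assms exponents_eq_imp_perm coeff_sf_perm)

lemma coeff_sf_upd_swap:
  assumes "i \<noteq> j"
  shows "coeff_sf f (upd i x (upd j y c)) = coeff_sf f (upd i y (upd j x c))"
proof (rule coeff_sf_cong)
  have "exponents (upd i x (upd j y c)) = (if x = 0 then {#} else {#x#}) +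
      ((if y = 0 then {#} else {#y#}) + exponents (upd j 0 (upd i 0 c)))" for x y
    by (simp add: exponents_upd[of i x] upd_commute[OF assms, of 0]
        exponents_upd[of j y "upd i 0 c"])
  then show "exponents (upd i x (upd j y c)) = exponents (upd i y (upd j x c))"
    by (simp only: add.left_commute)
qed

lemma coeff_power_sum: "coeff_sf (power_sum n) a = (if \<exists>i. a = Poly_Mapping.single i n then 1 else 0)"
  by (simp add: power_sum.rep_eq)

lemma coeff_sf_simps [simp]:
  "coeff_sf 0 a = 0"
  "coeff_sf 1 a = (if a = 0 then 1 else 0)"
  "coeff_sf (f + g) a = coeff_sf f a + coeff_sf g a"
  "coeff_sf (- f) a = - coeff_sf f a"
  "coeff_sf (f - g) a = coeff_sf f a - coeff_sf g a"
  "coeff_sf (scale_sf r f) a = r * coeff_sf f a"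
proof -
  show "coeff_sf (f - g) a = coeff_sf f a - coeff_sf g a"
    by (simp only: minus_symfun_def plus_symfun.rep_eq uminus_symfun.rep_eq) simp
qed (simp_all add: zero_symfun.rep_eq one_symfun.rep_eq plus_symfun.rep_eq
      uminus_symfun.rep_eq scale_sf.rep_eq)

lemma coeff_sf_sum [simp]: "coeff_sf (sum F A) a = (\<Sum>x\<in>A. coeff_sf (F x) a)"
  by (induction A rule: infinite_finite_induct) simp_all

lemma coeff_power_sum_mult:
  fixes f :: "'a::comm_ring_1 symfun"
  assumes "n \<ge> 1"
  shows "coeff_sf (power_sum n * f) c =
    (\<Sum>i | i \<in> Poly_Mapping.keys c \<and> n \<le> lk c i. coeff_sf f (upd i (lk c i - n) c))"
proof -
  let ?I = "{i. i \<in> Poly_Mapping.keys c \<and> n \<le> lk c i}"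
  let ?s = "\<lambda>i. Poly_Mapping.single i n :: mono"
  let ?S = "{(b, e). b + e = c}"
  let ?T = "(\<lambda>i. (?s i, upd i (lk c i - n) c)) ` ?I"
  have add: "?s i + upd i (lk c i - n) c = c" if "n \<le> lk c i" for i
    by (rule mono_eqI) (use that in \<open>auto simp: lookup_add lookup_update lookup_single\<close>)
  \<comment> \<open>For \<open>n = 0\<close> all these monomials would be 1;
    \<open>n \<ge> 1\<close> makes the variable recoverable from its power.\<close>
  have single_inj: "i = j" if "?s i = ?s j" for i j
    using arg_cong[OF that, of "\<lambda>a. lk a i"] assms by (auto simp: lookup_single when_def split: if_splits)
  have inj: "inj_on (\<lambda>i. (?s i, upd i (lk c i - n) c)) ?I"
    using assms by (auto simp: inj_on_def dest: single_inj)
  have sub: "?T \<subseteq> ?S"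
    using add by auto
  have out: "(if \<exists>i. b = ?s i then 1 else 0) * coeff_sf f e = 0" if "(b, e) \<in> ?S - ?T" for b e
  proof (cases "\<exists>i. b = ?s i")
    case True
    then obtain i where b: "b = ?s i" by blast
    have c: "c = ?s i + e" using that b by auto
    have "n \<le> lk c i" by (simp add: c lookup_add)
    moreover have "e = upd i (lk c i - n) c"
      by (rule mono_eqI) (auto simp: c lookup_add lookup_update lookup_single)
    ultimately have "(b, e) \<in> ?T"
      using assms b by (auto simp: in_keys_iff)
    with that show ?thesis by simp
  qed simp
  have "coeff_sf (power_sum n * f) c =
      (\<Sum>(b, e)\<in>?S. (if \<exists>i. b = ?s i then 1 else 0) * coeff_sf f e)"
    by (simp add: times_symfun.rep_eq conv_def coeff_power_sum)
  also have "\<dots> = (\<Sum>(b, e)\<in>?T. (if \<exists>i. b = ?s i then 1 else 0) * coeff_sf f e)"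
    by (rule sum.mono_neutral_right) (use finite_mono_splits sub out in auto)
  also have "\<dots> = (\<Sum>i\<in>?I. coeff_sf f (upd i (lk c i - n) c))"
    by (subst sum.reindex[OF inj]) (auto intro!: sum.cong)
  finally show ?thesis .
qed

lemma coeff_monomial_sf: "coeff_sf (monomial_sf lam) a = (if exponents a = mset lam then 1 else 0)"
  by (simp add: monomial_sf.rep_eq)

section \<open>Partitions\<close>

lemma partition_unique:
  assumes "is_partition lam" "is_partition mu" "mset lam = mset mu"
  shows "lam = mu"
proof -
  have s: "sorted (rev l)" if "is_partition l" for l
    using that by (simp add: is_partition_def sorted_wrt_rev)
  have "rev lam = rev mu"
    using assms s by (metis mset_rev properties_for_sort)
  then show ?thesis by simp
qed

definition partition_of :: "nat multiset \<Rightarrow> nat list" where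
  "partition_of M = rev (sorted_list_of_multiset M)"

lemma mset_partition_of [simp]: "mset (partition_of M) = M"
  by (simp add: partition_of_def)

lemma partition_of_is_partition [simp]: "is_partition (partition_of M) \<longleftrightarrow> 0 \<notin># M"
  by (simp add: is_partition_def partition_of_def sorted_wrt_rev)

lemma partition_of_mset: "is_partition lam \<Longrightarrow> partition_of (mset lam) = lam"
  by (rule partition_unique) (simp_all, simp add: is_partition_def)

lemma finite_partitions: "finite {lam. is_partition lam \<and> int (sum_list lam) \<le> d}"
proof (rule finite_subset)
  show "{lam. is_partition lam \<and> int (sum_list lam) \<le> d} \<subseteq>
      {xs. set xs \<subseteq> {..nat d} \<and> length xs \<le> nat d}"
  proof clarsimp
    fix lam assume lam: "is_partition lam" "int (sum_list lam) \<le> d"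
    have "length l \<le> sum_list l" if "0 \<notin> set l" for l :: "nat list"
      using that by (induction l) auto
    moreover have "x \<le> sum_list lam" if "x \<in> set lam" for x
      using that by (intro member_le_sum_list) auto
    ultimately show "set lam \<subseteq> {..nat d} \<and> length lam \<le> nat d"
      using lam by (fastforce simp: is_partition_def)
  qed
qed (simp add: finite_lists_length_le)

definition monomial_of :: "nat list \<Rightarrow> mono" where
  "monomial_of lam = (SOME c. exponents c = mset lam)"

lemma exponents_monomial_of: "is_partition lam \<Longrightarrow> exponents (monomial_of lam) = mset lam"
  unfolding monomial_of_def by (rule someI_ex) (simp add: exponents_surj is_partition_def)

lemma mono_deg_exponents_eq: "exponents c = mset lam \<Longrightarrow> mono_deg c = sum_list lam"
  by (simp add: mono_deg_exponents sum_mset_sum_list)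

section \<open>Degree\<close>

text \<open>Only an upper bound, so that every symmetric function has one without being split into
  homogeneous components. The bound is an integer because operators such as \<open>p_star n\<close>
  lower it, and a negative bound forces the function to be 0.\<close>

definition degle :: "int \<Rightarrow> 'a::zero symfun \<Rightarrow> bool" where
  "degle d f \<longleftrightarrow> (\<forall>a. coeff_sf f a \<noteq> 0 \<longrightarrow> int (mono_deg a) \<le> d)"

lemma degle_ex: "\<exists>d. degle d f"
  using is_symfun_deg[of "coeff_sf f"] coeff_sf[of f] unfolding degle_def
  by (metis (mono_tags, lifting) mem_Collect_eq of_nat_le_iff)

lemma degle_mono: "degle d f \<Longrightarrow> d \<le> e \<Longrightarrow> degle e f"
  unfolding degle_def by fastforce

lemma degle_neg: "degle d f \<Longrightarrow> d < 0 \<Longrightarrow> f = (0 :: 'a::comm_ring_1 symfun)"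
  unfolding degle_def by (intro symfun_eqI) fastforce

lemma degle_0 [simp]: "degle d (0 :: 'a::comm_ring_1 symfun)"
  by (simp add: degle_def)

lemma degle_add: "degle d f \<Longrightarrow> degle d g \<Longrightarrow> degle d (f + g :: 'a::comm_ring_1 symfun)"
  unfolding degle_def by (metis add.right_neutral coeff_sf_simps(3))

lemma degle_scale: "degle d f \<Longrightarrow> degle d (scale_sf r f)"
  unfolding degle_def by (metis coeff_sf_simps(6) mult_zero_right)

lemma degle_diff: "degle d f \<Longrightarrow> degle d g \<Longrightarrow> degle d (f - g :: 'a::comm_ring_1 symfun)"
  unfolding degle_def by (metis coeff_sf_simps(5) diff_0_right)

lemma degle_sum: "(\<And>x. x \<in> A \<Longrightarrow> degle d (F x)) \<Longrightarrow> degle d (sum F A :: 'a::comm_ring_1 symfun)"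
  by (induction A rule: infinite_finite_induct) (auto intro: degle_add)

lemma degle_mult: "degle d f \<Longrightarrow> degle e g \<Longrightarrow> degle (d + e) (f * g :: 'a::comm_ring_1 symfun)"
  unfolding degle_def times_symfun.rep_eq
  by (fastforce dest: conv_nonzeroD simp: mono_deg_add)

lemma degle_power_sum: "degle (int n) (power_sum n)"
  by (auto simp: degle_def coeff_power_sum split: if_splits)

lemma homogeneous_degle: "homogeneous d f \<Longrightarrow> degle (int d) f"
  by (simp add: homogeneous_def degle_def)

lemma homogeneous_mult:
  "homogeneous d f \<Longrightarrow> homogeneous e g \<Longrightarrow> homogeneous (d + e) (f * g :: 'a::comm_ring_1 symfun)"
  unfolding homogeneous_def times_symfun.rep_eq
  by (fastforce dest: conv_nonzeroD simp: mono_deg_add)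

lemma homogeneous_power_sum: "homogeneous n (power_sum n)"
  by (auto simp: homogeneous_def coeff_power_sum split: if_splits)

lemma power_sum_prod_simps [simp]:
  "power_sum_prod [] = 1"
  "power_sum_prod (n # lam) = power_sum n * power_sum_prod lam"
  by (simp_all add: power_sum_prod_def)

lemma homogeneous_power_sum_prod: "homogeneous (sum_list lam) (power_sum_prod lam)"
proof (induction lam)
  case Nil
  show ?case by (simp add: homogeneous_def)
next
  case (Cons n lam)
  then show ?case by (simp add: homogeneous_mult homogeneous_power_sum)
qed

lemma power_sum_prod_mset: "mset lam = mset mu \<Longrightarrow> power_sum_prod lam = power_sum_prod mu"
  unfolding power_sum_prod_def by (metis mset_map prod_mset_prod_list)

section \<open>The basis of products of power sums\<close>

lemma of_nat_ratfun_eq_0_iff [simp]: "(of_nat k :: ratfun) = 0 \<longleftrightarrow> k = 0"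
proof -
  have "(of_nat k :: ratfun) = Fraction_Field.Fract (of_nat k) 1"
    by (induction k) (simp_all add: Zero_fract_def One_fract_def add.commute)
  then show ?thesis
    by (simp add: Zero_fract_def eq_fract)
qed

lemma alpha_nonzero [simp]: "alpha \<noteq> 0"
  by (simp add: alpha_def Zero_fract_def eq_fract)

text \<open>Multiplying out a product of power sums either keeps two parts on different variables or
  merges them on one variable. The number of variables is therefore at most the number of parts,
  with equality only if nothing is merged. The coefficients are counted in natural numbers, where no
  cancellation can destroy the leading one.\<close>

lemma power_sum_prod_coeff:
  assumes "0 \<notin> set lam"
  shows "\<exists>K :: mono \<Rightarrow> nat. \<forall>c. coeff_sf (power_sum_prod lam :: 'a::comm_ring_1 symfun) c = of_nat (K c) \<and>
    (K c \<noteq> 0 \<longrightarrow> size (exponents c) \<le> length lam \<and>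
      (size (exponents c) = length lam \<longrightarrow> exponents c = mset lam)) \<and>
    (exponents c = mset lam \<longrightarrow> K c \<noteq> 0)"
  using assms
proof (induction lam)
  case Nil
  have "c = 0" if "exponents c = {#}" for c
    using that by (auto simp: exponents_def mset_set_empty_iff)
  then show ?case
    by (intro exI[of _ "\<lambda>c. if c = 0 then 1 else 0"]) auto
next
  case (Cons n lam)
  then have "0 \<notin> set lam" by simp
  from Cons.IH[OF this] obtain K where KK: "\<forall>c. coeff_sf (power_sum_prod lam :: 'a symfun) c = of_nat (K c) \<and>
    (K c \<noteq> 0 \<longrightarrow> size (exponents c) \<le> length lam \<and>
      (size (exponents c) = length lam \<longrightarrow> exponents c = mset lam)) \<and>
    (exponents c = mset lam \<longrightarrow> K c \<noteq> 0)" ..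
  then have K: "\<And>c. coeff_sf (power_sum_prod lam :: 'a symfun) c = of_nat (K c)"
    "\<And>c. K c \<noteq> 0 \<Longrightarrow> size (exponents c) \<le> length lam"
    "\<And>c. K c \<noteq> 0 \<Longrightarrow> size (exponents c) = length lam \<Longrightarrow> exponents c = mset lam"
    "\<And>c. exponents c = mset lam \<Longrightarrow> K c \<noteq> 0"
    by blast+
  have n: "n \<ge> 1" using Cons.prems by (cases n) auto
  define I where "I c = {i. i \<in> Poly_Mapping.keys c \<and> n \<le> lk c i}" for c
  define K' where "K' c = (\<Sum>i\<in>I c. K (upd i (lk c i - n) c))" for c
  have I: "finite (I c)" for c by (simp add: I_def)
  have ex: "exponents c = {#lk c i#} + exponents (upd i 0 c)"
    "exponents (upd i (lk c i - n) c) = (if lk c i = n then {#} else {#lk c i - n#}) + exponents (upd i 0 c)"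
    if "i \<in> I c" for i c
    using that n exponents_split[of c i] exponents_upd[of i "lk c i - n" c] by (auto simp: I_def)
  show ?case
  proof (intro exI[of _ K'] allI conjI impI)
    fix c
    show "coeff_sf (power_sum_prod (n # lam) :: 'a symfun) c = of_nat (K' c)"
      using coeff_power_sum_mult[OF n, of "power_sum_prod lam :: 'a symfun" c] by (simp add: K'_def I_def K(1))
    assume "K' c \<noteq> 0"
    then obtain i where i: "i \<in> I c" "K (upd i (lk c i - n) c) \<noteq> 0"
      unfolding K'_def by (meson sum.neutral)
    note e = ex[OF i(1)]
    show "size (exponents c) \<le> length (n # lam)"
      using K(2)[OF i(2)] e by (auto split: if_splits)
    assume sz: "size (exponents c) = length (n # lam)"
    show "exponents c = mset (n # lam)"
    \<comment> \<open>Either the new part occupies a variable of its own, or it is merged into an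
      older part; in the second case \<open>c\<close> has too few variables.\<close>
    proof (cases "lk c i = n")
      case True
      then show ?thesis using sz e K(3)[OF i(2)] by simp
    next
      case False
      then show ?thesis using sz e K(2)[OF i(2)] by simp
    qed
  next
    fix c assume "exponents c = mset (n # lam)"
    then have "n \<in># exponents c" by simp
    then obtain i where i: "i \<in> Poly_Mapping.keys c" "lk c i = n"
      by (auto simp: exponents_def)
    then have "i \<in> I c" by (simp add: I_def)
    moreover have "K (upd i (lk c i - n) c) \<noteq> 0"
      using ex[OF \<open>i \<in> I c\<close>] i \<open>exponents c = mset (n # lam)\<close> by (intro K(4)) simp
    ultimately show "K' c \<noteq> 0"
      unfolding K'_def using I by simp blast
  qed
qed

lemma is_partition_zero: "is_partition lam \<Longrightarrow> 0 \<notin> set lam"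
  by (simp add: is_partition_def)

lemma power_sum_prod_coeff_size:
  assumes "0 \<notin> set lam" "coeff_sf (power_sum_prod lam :: 'a::comm_ring_1 symfun) c \<noteq> 0"
  shows "size (exponents c) \<le> length lam"
  using power_sum_prod_coeff[OF assms(1), where 'a='a] assms(2) by (metis of_nat_0)

lemma power_sum_prod_coeff_top:
  assumes "0 \<notin> set lam" "coeff_sf (power_sum_prod lam :: 'a::comm_ring_1 symfun) c \<noteq> 0"
    "size (exponents c) = length lam"
  shows "exponents c = mset lam"
  using power_sum_prod_coeff[OF assms(1), where 'a='a] assms(2,3) by (metis of_nat_0)

lemma power_sum_prod_coeff_diag:
  assumes "0 \<notin> set lam" "exponents c = mset lam"
  shows "coeff_sf (power_sum_prod lam :: ratfun symfun) c \<noteq> 0"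
  using power_sum_prod_coeff[OF assms(1), where 'a=ratfun] assms(2) by (metis of_nat_ratfun_eq_0_iff)

text \<open>Elimination by the number of variables: a combination of products with exactly
  \<open>s\<close> parts removes all monomials in exactly \<open>s\<close> variables and creates
  none with more.\<close>

lemma power_sum_prod_span_aux:
  fixes f :: "ratfun symfun"
  assumes "degle d f" "\<And>c. coeff_sf f c \<noteq> 0 \<Longrightarrow> size (exponents c) < s"
  shows "f \<in> sf.span {power_sum_prod lam | lam. is_partition lam \<and> int (sum_list lam) \<le> d}"
  using assms
proof (induction s arbitrary: f)
  case 0
  then have "f = 0" by (intro symfun_eqI) auto
  then show ?case by (simp add: sf.span_zero)
next
  case (Suc s)
  let ?S = "{power_sum_prod lam | lam. is_partition lam \<and> int (sum_list lam) \<le> d} :: ratfun symfun set"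
  let ?p = "power_sum_prod :: nat list \<Rightarrow> ratfun symfun"
  define P where "P = {lam. is_partition lam \<and> int (sum_list lam) \<le> d \<and> length lam = s}"
  \<comment> \<open>The quotient makes \<open>g\<close> agree with \<open>f\<close> on the monomials
    of shape \<open>lam\<close>; the denominator is the leading coefficient of the product, which is
    not 0.\<close>
  define t where "t lam = coeff_sf f (monomial_of lam) / coeff_sf (?p lam) (monomial_of lam)" for lam
  define g where "g = (\<Sum>lam\<in>P. scale_sf (t lam) (?p lam))"
  have fin: "finite P"
    by (rule finite_subset[OF _ finite_partitions[of d]]) (auto simp: P_def)
  have g: "g \<in> sf.span ?S"
    unfolding g_def by (intro sf.span_sum sf.span_scale sf.span_base) (auto simp: P_def)
  have deg: "degle d (f - g)"
    unfolding g_def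
    by (intro degle_diff degle_sum degle_scale Suc.prems(1)
        degle_mono[OF homogeneous_degle[OF homogeneous_power_sum_prod]]) (auto simp: P_def)
  have "size (exponents c) < s" if nz: "coeff_sf (f - g) c \<noteq> 0" for c
  proof (rule ccontr)
    assume ge: "\<not> size (exponents c) < s"
    have g0: "coeff_sf (?p lam) c = 0" if "lam \<in> P" "exponents c \<noteq> mset lam" for lam
      using power_sum_prod_coeff_size[of lam c, where 'a=ratfun] power_sum_prod_coeff_top[of lam c, where 'a=ratfun]
        that ge is_partition_zero by (fastforce simp: P_def)
    show False
    proof (cases "size (exponents c) = s")
      case True
      let ?lam = "partition_of (exponents c)"
      have part: "is_partition ?lam" by simp
      have "int (mono_deg c) \<le> d" using deg nz by (simp add: degle_def)
      then have lam: "?lam \<in> P"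
        using True mono_deg_exponents_eq[of c ?lam] size_mset[of ?lam] by (simp add: P_def del: size_mset)
      have uniq: "exponents c \<noteq> mset mu" if "mu \<in> P - {?lam}" for mu
        using that partition_of_mset[of mu] by (auto simp: P_def)
      have "coeff_sf g c = (\<Sum>mu\<in>P. t mu * coeff_sf (?p mu) c)"
        by (simp add: g_def)
      also have "\<dots> = t ?lam * coeff_sf (?p ?lam) c"
        by (subst sum.remove[OF fin lam]) (use uniq g0 in \<open>simp add: sum.neutral\<close>)
      also have "\<dots> = coeff_sf f c"
      proof -
        have e: "exponents (monomial_of ?lam) = exponents c"
          using exponents_monomial_of[OF part] by simp
        have "coeff_sf (?p ?lam) c \<noteq> 0"
          using is_partition_zero[OF part] by (rule power_sum_prod_coeff_diag) simp
        then show ?thesis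
          by (simp add: t_def coeff_sf_cong[OF e])
      qed
      finally show False using nz by simp
    next
      case False
      with ge have s: "size (exponents c) > s" by simp
      then have "exponents c \<noteq> mset lam" if "lam \<in> P" for lam
        using that by (auto simp: P_def)
      with g0 have "coeff_sf g c = 0"
        by (simp add: g_def)
      moreover have "coeff_sf f c = 0"
        using Suc.prems(2)[of c] s by linarith
      ultimately show False using nz by simp
    qed
  qed
  then have "f - g \<in> sf.span ?S"
    using Suc.IH[OF deg] by blast
  with g show ?case
    using sf.span_add[of "f - g" ?S g] by simp
qed

lemma size_exponents_le: "size (exponents c) \<le> mono_deg c"
proof -
  have "size M \<le> sum_mset M" if "0 \<notin># M" for M :: "nat multiset"
    using that by (induction M) auto
  then show ?thesis by (simp add: mono_deg_exponents)
qed

lemma power_sum_prod_span: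
  fixes f :: "ratfun symfun"
  assumes "degle d f"
  shows "f \<in> sf.span {power_sum_prod lam | lam. is_partition lam \<and> int (sum_list lam) \<le> d}"
proof (rule power_sum_prod_span_aux[OF assms, of "nat d + 1"])
  fix c assume "coeff_sf f c \<noteq> 0"
  then have "int (mono_deg c) \<le> d" using assms by (simp add: degle_def)
  with size_exponents_le[of c] show "size (exponents c) < nat d + 1" by linarith
qed

text \<open>The degree bound reaches the base case, as the degree estimate for \<open>p_star\<close>
  requires.\<close>

lemma degle_power_sum_induct [consumes 1, case_names zero add scale base]:
  fixes f :: "ratfun symfun"
  assumes "degle d f"
    and "P 0" "\<And>f g. P f \<Longrightarrow> P g \<Longrightarrow> P (f + g)" "\<And>r f. P f \<Longrightarrow> P (scale_sf r f)"
    and "\<And>lam. is_partition lam \<Longrightarrow> int (sum_list lam) \<le> d \<Longrightarrow> P (power_sum_prod lam)"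
  shows "P f"
  using power_sum_prod_span[OF assms(1)]
  by (induction rule: sf.span_induct_alt) (use assms(2-) in auto)

lemma power_sum_induct [case_names zero add scale base]:
  fixes f :: "ratfun symfun"
  assumes "P 0" "\<And>f g. P f \<Longrightarrow> P g \<Longrightarrow> P (f + g)" "\<And>r f. P f \<Longrightarrow> P (scale_sf r f)"
    and "\<And>lam. is_partition lam \<Longrightarrow> P (power_sum_prod lam)"
  shows "P f"
proof -
  obtain d where "degle d f" using degle_ex by blast
  then show ?thesis by (induction rule: degle_power_sum_induct) (use assms in auto)
qed

lemma power_sum_prod_inj:
  assumes "is_partition lam" "is_partition mu"
    and "(power_sum_prod lam :: ratfun symfun) = power_sum_prod mu"
  shows "lam = mu"
proof -
  have *: "lam = mu" if "is_partition lam" "is_partition mu" "length mu \<le> length lam"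
    "(power_sum_prod lam :: ratfun symfun) = power_sum_prod mu" for lam mu
  proof -
    note e = exponents_monomial_of[OF that(1)]
    have nz: "coeff_sf (power_sum_prod mu :: ratfun symfun) (monomial_of lam) \<noteq> 0"
      using power_sum_prod_coeff_diag[OF is_partition_zero[OF that(1)] e] that(4) by simp
    have "length lam \<le> length mu"
      using power_sum_prod_coeff_size[OF is_partition_zero[OF that(2)] nz] e by simp
    then have "mset lam = mset mu"
      using power_sum_prod_coeff_top[OF is_partition_zero[OF that(2)] nz] e that(3) by simp
    then show ?thesis by (rule partition_unique[OF that(1,2)])
  qed
  show ?thesis
    using *[of lam mu] *[of mu lam] assms by (metis nat_le_linear)
qed

interpretation sfv: vector_space "scale_sf :: ratfun \<Rightarrow> _"
  by standard (auto simp: sf.scale_right_distrib sf.scale_left_distrib)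

interpretation sfv_op: vector_space_pair "scale_sf :: ratfun \<Rightarrow> _" "scale_sf :: ratfun \<Rightarrow> _" ..

interpretation ratfunv: vector_space "(*) :: ratfun \<Rightarrow> _"
  by standard (auto simp: algebra_simps)

interpretation sfv_fun: vector_space_pair "scale_sf :: ratfun \<Rightarrow> _" "(*) :: ratfun \<Rightarrow> _" ..

text \<open>Among the partitions with non-zero coefficient choose one with the most parts. A
  monomial of its shape occurs in no other product of the relation: those products have at most as
  many variables, and with equally many the shape is their own.\<close>

lemma power_sum_prod_independent:
  "sf.independent {power_sum_prod lam :: ratfun symfun | lam. is_partition lam}"
  unfolding sfv.independent_explicit_finite_subsets
proof (intro allI impI ballI, rule ccontr)
  let ?p = "power_sum_prod :: nat list \<Rightarrow> ratfun symfun"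
  fix S u v
  assume S: "S \<subseteq> {?p lam | lam. is_partition lam}" "finite S"
    and sum: "(\<Sum>v\<in>S. scale_sf (u v) v) = 0" and v: "v \<in> S" "u v \<noteq> 0"
  define L where "L = {lam. is_partition lam \<and> ?p lam \<in> S \<and> u (?p lam) \<noteq> 0}"
  have fin: "finite L"
  proof (rule finite_imageD)
    show "finite (?p ` L)"
      by (rule finite_subset[OF _ S(2)]) (auto simp: L_def)
    show "inj_on ?p L"
      using power_sum_prod_inj by (auto simp: inj_on_def L_def)
  qed
  have "L \<noteq> {}" using v S(1) by (auto simp: L_def)
  then obtain lam where lam: "lam \<in> L" "\<And>mu. mu \<in> L \<Longrightarrow> length mu \<le> length lam"
    using fin obtains_MAX[of L length] by (metis Max_ge finite_imageI imageI)
  let ?m = "monomial_of lam"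
  have part: "is_partition lam" using lam(1) by (simp add: L_def)
  note e = exponents_monomial_of[OF part]
  have zero: "u w * coeff_sf w ?m = 0" if "w \<in> S - {?p lam}" for w
  proof (rule ccontr)
    assume nz: "\<not> ?thesis"
    obtain mu where mu: "w = ?p mu" "is_partition mu" using \<open>w \<in> S - {?p lam}\<close> S(1) by blast
    then have "mu \<in> L" using nz that by (auto simp: L_def)
    then have "length mu \<le> length lam" by (rule lam(2))
    moreover have "size (exponents ?m) \<le> length mu"
      using power_sum_prod_coeff_size[OF is_partition_zero[OF mu(2)]] nz mu(1) by auto
    ultimately have "mset lam = mset mu"
      using power_sum_prod_coeff_top[OF is_partition_zero[OF mu(2)], where c="?m" and 'a=ratfun]
        nz mu(1) e by auto
    then have "lam = mu" using partition_unique[OF part mu(2)] by simp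
    with that mu(1) show False by simp
  qed
  have lamS: "?p lam \<in> S" using lam(1) by (simp add: L_def)
  have "0 = coeff_sf (\<Sum>v\<in>S. scale_sf (u v) v) ?m" by (simp add: sum)
  also have "\<dots> = (\<Sum>v\<in>S. u v * coeff_sf v ?m)" by simp
  also have "\<dots> = u (?p lam) * coeff_sf (?p lam) ?m"
    by (subst sum.remove[OF S(2) lamS]) (simp add: zero sum.neutral)
  finally show False
    using power_sum_prod_coeff_diag[OF is_partition_zero[OF part] e] lam(1) by (simp add: L_def)
qed

text \<open>Linear extension from a basis takes a function of the basis vectors, so the partition
  has to be read off from the product.\<close>

definition partition_index :: "ratfun symfun \<Rightarrow> nat list" where
  "partition_index v = (THE lam. is_partition lam \<and> v = power_sum_prod lam)"

lemma partition_index [simp]: "is_partition lam \<Longrightarrow> partition_index (power_sum_prod lam) = lam"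
  unfolding partition_index_def by (rule the_equality) (auto dest: power_sum_prod_inj)

lemma symop_on_power_sums_ex:
  "\<exists>T. \<forall>lam. is_partition lam \<longrightarrow> app T (power_sum_prod lam) = (F lam :: ratfun symfun)"
proof -
  obtain g where g: "Vector_Spaces.linear scale_sf scale_sf g"
    "\<forall>x\<in>{power_sum_prod lam | lam. is_partition lam}. g x = F (partition_index x)"
    using sfv_op.linear_independent_extend[OF power_sum_prod_independent,
        where f="\<lambda>x. F (partition_index x)"] by blast
  have "module_hom scale_sf scale_sf g"
    using g(1) by (simp add: Vector_Spaces.linear_iff_module_hom)
  then have "app (Abs_symop g) = g" by (simp add: Abs_symop_inverse)
  with g(2) show ?thesis
    by (intro exI[of _ "Abs_symop g"]) fastforce
qed

lemma functional_on_power_sums_ex: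
  "\<exists>g. module_hom scale_sf (*) g \<and> (\<forall>lam. is_partition lam \<longrightarrow> g (power_sum_prod lam) = (F lam :: ratfun))"
proof -
  obtain g where g: "Vector_Spaces.linear scale_sf (*) g"
    "\<forall>x\<in>{power_sum_prod lam | lam. is_partition lam}. g x = F (partition_index x)"
    using sfv_fun.linear_independent_extend[OF power_sum_prod_independent,
        where f="\<lambda>x. F (partition_index x)"] by blast
  then have "module_hom scale_sf (*) g"
    by (simp add: Vector_Spaces.linear_iff_module_hom)
  with g(2) show ?thesis by fastforce
qed

lemma app_add: "app T (f + g) = app T f + app T g"
  and app_scale: "app T (scale_sf r f) = scale_sf r (app T f)"
  and app_0 [simp]: "app T 0 = 0"
proof -
  have m: "module_hom scale_sf scale_sf (app T)" using app[of T] by simp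
  show "app T (f + g) = app T f + app T g" "app T (scale_sf r f) = scale_sf r (app T f)" "app T 0 = 0"
    using module_hom.add[OF m] module_hom.scale[OF m] module_hom.zero[OF m] by simp_all
qed

lemma app_sum: "app T (sum F A) = (\<Sum>x\<in>A. app T (F x))"
  by (induction A rule: infinite_finite_induct) (simp_all add: app_add)

lemma app_op_simps [simp]:
  "app 0 f = 0" "app 1 f = f" "app (S + T) f = app S f + app T f" "app (S * T) f = app S (app T f)"
  "app (S - T) f = app S f - app T f" "app (- T) f = - app T f" "app (scalar_op r) f = scale_sf r f"
  by (simp_all add: zero_symop.rep_eq one_symop.rep_eq plus_symop.rep_eq times_symop.rep_eq
      minus_symop.rep_eq uminus_symop.rep_eq scalar_op.rep_eq)

lemma app_op_sum: "app (sum F A) f = (\<Sum>x\<in>A. app (F x) f)"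
  by (induction A rule: infinite_finite_induct) simp_all

lemma symop_eqI: "(\<And>f. app S f = app T f) \<Longrightarrow> S = T"
  by (metis app_inject ext)

lemma symop_eqI_power_sum:
  fixes S T :: "ratfun symop"
  assumes "\<And>lam. is_partition lam \<Longrightarrow> app S (power_sum_prod lam) = app T (power_sum_prod lam)"
  shows "S = T"
proof (rule symop_eqI)
  fix f :: "ratfun symfun"
  show "app S f = app T f"
    by (induction f rule: power_sum_induct) (simp_all add: app_add app_scale assms)
qed

section \<open>Partial derivatives\<close>

lemma app_partial_p_partition:
  assumes "is_partition lam"
  shows "app (partial_p n) (power_sum_prod lam :: ratfun symfun) =
    scale_sf (of_nat (count_list lam n)) (power_sum_prod (remove1 n lam))"
proof -
  let ?P = "\<lambda>D. \<forall>lam. is_partition lam \<longrightarrow>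
     app D (power_sum_prod lam :: ratfun symfun) =
       scale_sf (of_nat (count_list lam n)) (power_sum_prod (remove1 n lam))"
  have "\<exists>!D. ?P D"
    by (rule ex_ex1I[OF symop_on_power_sums_ex]) (auto intro: symop_eqI_power_sum)
  from theI'[OF this] assms show ?thesis
    unfolding partial_p_def by blast
qed

text \<open>Lists such as \<open>n # lam\<close> are in general not sorted. Sorting changes neither
  the product nor the multiplicities.\<close>

lemma app_partial_p:
  assumes "0 \<notin> set lam"
  shows "app (partial_p n) (power_sum_prod lam :: ratfun symfun) =
    scale_sf (of_nat (count (mset lam) n)) (power_sum_prod (remove1 n lam))"
proof -
  let ?l = "partition_of (mset lam)"
  have "power_sum_prod lam = (power_sum_prod ?l :: ratfun symfun)"
    "power_sum_prod (remove1 n lam) = (power_sum_prod (remove1 n ?l) :: ratfun symfun)"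
    by (rule power_sum_prod_mset; simp)+
  moreover have "count_list ?l n = count (mset lam) n"
    by (metis count_mset mset_partition_of)
  moreover have "is_partition ?l" using assms by simp
  ultimately show ?thesis
    by (simp add: app_partial_p_partition)
qed

text \<open>The Leibniz rule for a generator: the new part \<open>m\<close> raises the multiplicity
  of \<open>n\<close> by one exactly when \<open>m = n\<close>.\<close>

lemma partial_p_mult_power_sum:
  fixes f :: "ratfun symfun"
  assumes "m \<ge> 1"
  shows "app (partial_p n) (power_sum m * f) =
    (if m = n then f else 0) + power_sum m * app (partial_p n) f"
proof (induction f rule: power_sum_induct)
  case (base lam)
  have z: "0 \<notin> set lam" "0 \<notin> set (m # lam)" using base assms by (auto simp: is_partition_def)
  have n: "n \<in># mset lam" if "count (mset lam) n \<noteq> 0"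
    using that by (meson count_eq_zero_iff)
  have *: "power_sum n * power_sum_prod (remove1 n lam) = (power_sum_prod lam :: ratfun symfun)"
    if "count (mset lam) n \<noteq> 0"
    using power_sum_prod_mset[of "n # remove1 n lam" lam, where 'a=ratfun] n[OF that] by simp
  show ?case
    using app_partial_p[OF z(2), of n] app_partial_p[OF z(1), of n] *
    by (cases "count (mset lam) n = 0")
      (auto simp: sf.scale_left_distrib scale_sf_mult_right)
qed (auto simp: distrib_left app_add app_scale scale_sf_mult_right sf.scale_right_distrib algebra_simps)

section \<open>The bilinear form\<close>

lemma z_part_superset:
  assumes "finite A" "set lam \<subseteq> A"
  shows "z_part lam = (\<Prod>i\<in>A. i ^ count (mset lam) i * fact (count (mset lam) i))"
proof -
  have "count (mset lam) i = 0" if "i \<notin> set lam" for i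
    using that by (simp add: count_mset_0_iff)
  then have "i ^ count (mset lam) i * fact (count (mset lam) i) = (1 :: nat)" if "i \<notin> set lam" for i
    using that by (metis fact_0 mult_1 power_0)
  then show ?thesis
    unfolding z_part_def count_mset[symmetric]
    using assms by (intro prod.mono_neutral_left) blast+
qed

lemma z_part_mset: "mset lam = mset mu \<Longrightarrow> z_part lam = z_part mu"
  using z_part_superset[of "set mu" lam] z_part_superset[of "set mu" mu] mset_eq_setD[of lam mu] by simp

lemma z_part_Cons: "z_part (n # lam) = n * Suc (count (mset lam) n) * z_part lam"
proof -
  let ?A = "insert n (set lam)"
  let ?g = "\<lambda>l i. i ^ count (mset l) i * fact (count (mset l) i) :: nat"
  have "z_part (n # lam) = ?g (n # lam) n * (\<Prod>i\<in>?A - {n}. ?g (n # lam) i)"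
    by (subst z_part_superset[of ?A], simp, simp, rule prod.remove) simp_all
  also have "(\<Prod>i\<in>?A - {n}. ?g (n # lam) i) = (\<Prod>i\<in>?A - {n}. ?g lam i)"
    by (rule prod.cong) auto
  also have "?g (n # lam) n = n * Suc (count (mset lam) n) * ?g lam n"
    by (simp add: algebra_simps)
  also have "n * Suc (count (mset lam) n) * ?g lam n * (\<Prod>i\<in>?A - {n}. ?g lam i) =
      n * Suc (count (mset lam) n) * (?g lam n * (\<Prod>i\<in>?A - {n}. ?g lam i))"
    by (simp only: mult.assoc)
  also have "?g lam n * (\<Prod>i\<in>?A - {n}. ?g lam i) = z_part lam"
    by (subst z_part_superset[of ?A lam], simp, blast, rule prod.remove[symmetric]) simp_all
  finally show ?thesis .
qed

text \<open>Existence takes two linear extensions. The functional \<open>phi lam\<close> is the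
  pairing with the product for \<open>lam\<close>. For fixed \<open>g\<close>, the functional
  \<open>b g\<close> sends that product to \<open>phi lam g\<close>. Linearity of
  \<open>b g f\<close> in \<open>g\<close> can be tested with \<open>f\<close> a product of power
  sums, where it is the linearity of \<open>phi lam\<close>.\<close>

lemma jack_form_spec:
  "(\<forall>f. module_hom scale_sf (*) (jack_form f)) \<and>
   (\<forall>g. module_hom scale_sf (*) (\<lambda>f. jack_form f g)) \<and>
   (\<forall>lam mu. is_partition lam \<longrightarrow> is_partition mu \<longrightarrow>
      jack_form (power_sum_prod lam) (power_sum_prod mu) =
        (if lam = mu then alpha ^ length lam * of_nat (z_part lam) else 0))"
proof -
  let ?N = "\<lambda>lam mu. if lam = mu then alpha ^ length lam * of_nat (z_part lam) else 0"
  let ?P = "\<lambda>B. (\<forall>f. module_hom scale_sf (*) (B f)) \<and>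
     (\<forall>g. module_hom scale_sf (*) (\<lambda>f. B f g)) \<and>
     (\<forall>lam mu. is_partition lam \<longrightarrow> is_partition mu \<longrightarrow>
        B (power_sum_prod lam) (power_sum_prod mu) = ?N lam mu)"
  note hom = module_hom.add module_hom.scale module_hom.zero
  have "\<forall>lam. \<exists>g. module_hom scale_sf (*) g \<and> (\<forall>mu. is_partition mu \<longrightarrow> g (power_sum_prod mu) = ?N lam mu)"
    by (intro allI functional_on_power_sums_ex)
  then obtain phi where phi: "\<And>lam. module_hom scale_sf (*) (phi lam)"
    "\<And>lam mu. is_partition mu \<Longrightarrow> phi lam (power_sum_prod mu) = ?N lam mu"
    by metis
  have "\<forall>g. \<exists>b. module_hom scale_sf (*) b \<and> (\<forall>lam. is_partition lam \<longrightarrow> b (power_sum_prod lam) = phi lam g)"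
    by (intro allI functional_on_power_sums_ex)
  then obtain b where b: "\<And>g. module_hom scale_sf (*) (b g)"
    "\<And>g lam. is_partition lam \<Longrightarrow> b g (power_sum_prod lam) = phi lam g"
    by metis
  have bl: "b g (f + f') = b g f + b g f'" "b g (scale_sf r f) = r * b g f" "b g 0 = 0" for g f f' r
    using hom[OF b(1)[of g]] by simp_all
  have pl: "phi l (f + f') = phi l f + phi l f'" "phi l (scale_sf r f) = r * phi l f" "phi l 0 = 0" for l f f' r
    using hom[OF phi(1)[of l]] by simp_all
  have "b (g + h) f = b g f + b h f" for f g h
    by (induction f rule: power_sum_induct)
      (simp_all only: bl pl b(2) distrib_left add.assoc add.left_commute add_0_right)
  moreover have "b (scale_sf r g) f = r * b g f" for f g r
    by (induction f rule: power_sum_induct)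
      (simp_all only: bl pl b(2) distrib_left mult.left_commute mult_zero_right)
  ultimately have ex: "?P (\<lambda>f g. b g f)"
    using b phi(2) by (simp add: module_hom_iff sf.module_axioms ratfunv.module_axioms)
  have uniq: "B = B'" if P: "?P B" "?P B'" for B B'
  proof (intro ext)
    fix f g
    have lin: "C f (g + g') = C f g + C f g'" "C f (scale_sf r g) = r * C f g" "C f 0 = 0"
      "C (f + f') g = C f g + C f' g" "C (scale_sf r f) g = r * C f g" "C 0 g = 0"
      if "?P C" for C f f' g g' r
    proof -
      have l: "module_hom scale_sf (*) (C f)" "module_hom scale_sf (*) (\<lambda>f. C f g)"
        using that by blast+
      show "C f (g + g') = C f g + C f g'" "C f (scale_sf r g) = r * C f g" "C f 0 = 0"
        "C (f + f') g = C f g + C f' g" "C (scale_sf r f) g = r * C f g" "C 0 g = 0"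
        using hom[OF l(1)] hom[OF l(2)] by simp_all
    qed
    note lins = lin[OF P(1)] lin[OF P(2)]
    have base: "B (power_sum_prod lam) (power_sum_prod mu) = B' (power_sum_prod lam) (power_sum_prod mu)"
      if "is_partition lam" "is_partition mu" for lam mu
      using P that by simp
    have "B (power_sum_prod lam) g = B' (power_sum_prod lam) g" if "is_partition lam" for lam
      by (induction g rule: power_sum_induct) (simp_all only: lins base that)
    then show "B f g = B' f g"
      by (induction f rule: power_sum_induct) (simp_all only: lins)
  qed
  have "\<exists>!B. ?P B"
    using exI[of ?P, OF ex] uniq by (rule ex_ex1I)
  from theI'[OF this] show ?thesis
    unfolding jack_form_def .
qed

lemma jack_form_linear [simp]:
  "jack_form (f + f') g = jack_form f g + jack_form f' g"
  "jack_form (scale_sf r f) g = r * jack_form f g"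
  "jack_form 0 g = 0"
  "jack_form f (g + g') = jack_form f g + jack_form f g'"
  "jack_form f (scale_sf r g) = r * jack_form f g"
  "jack_form f 0 = 0"
proof -
  have l: "module_hom scale_sf (*) (jack_form f)" "module_hom scale_sf (*) (\<lambda>f. jack_form f g)"
    using jack_form_spec by auto
  note hom = module_hom.add module_hom.scale module_hom.zero
  show "jack_form (f + f') g = jack_form f g + jack_form f' g"
    "jack_form (scale_sf r f) g = r * jack_form f g"
    "jack_form 0 g = 0"
    "jack_form f (g + g') = jack_form f g + jack_form f g'"
    "jack_form f (scale_sf r g) = r * jack_form f g"
    "jack_form f 0 = 0"
    using hom[OF l(1)] hom[OF l(2)] by simp_all
qed

lemma jack_form_sum_left: "jack_form (sum F A) g = (\<Sum>x\<in>A. jack_form (F x) g)"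
  by (induction A rule: infinite_finite_induct) simp_all

lemma jack_form_sum_right: "jack_form g (sum F A) = (\<Sum>x\<in>A. jack_form g (F x))"
  by (induction A rule: infinite_finite_induct) simp_all

lemma jack_form_diff_left: "jack_form (f - h) g = jack_form f g - jack_form h g"
  using jack_form_linear(1)[of "f - h" h g] by simp

lemma jack_form_power_sum_prod:
  assumes "0 \<notin> set lam" "0 \<notin> set mu"
  shows "jack_form (power_sum_prod lam) (power_sum_prod mu) =
    (if mset lam = mset mu then alpha ^ length lam * of_nat (z_part lam) else 0)"
proof -
  let ?p = "partition_of (mset lam)" and ?q = "partition_of (mset mu)"
  have form: "jack_form (power_sum_prod ?p) (power_sum_prod ?q) =
      (if ?p = ?q then alpha ^ length ?p * of_nat (z_part ?p) else 0)"
    using jack_form_spec assms by simp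
  have eq: "?p = ?q \<longleftrightarrow> mset lam = mset mu"
    by (metis mset_partition_of)
  have p: "power_sum_prod ?p = (power_sum_prod lam :: ratfun symfun)"
    "power_sum_prod ?q = (power_sum_prod mu :: ratfun symfun)" "z_part ?p = z_part lam"
    by (rule power_sum_prod_mset z_part_mset; simp)+
  have len: "length ?p = length lam"
    by (metis mset_partition_of size_mset)
  show ?thesis using form by (simp only: eq p len)
qed

lemma jack_form_commute: "jack_form f g = jack_form g f"
proof (induction f rule: power_sum_induct)
  case (base lam)
  show ?case
  proof (induction g rule: power_sum_induct)
    case (base mu)
    with \<open>is_partition lam\<close> jack_form_spec show ?case by auto
  qed simp_all
qed simp_all

text \<open>The products of power sums are orthogonal with non-zero norms, so pairing with one of
  them isolates its coefficient.\<close>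

lemma jack_form_nondegenerate:
  assumes "\<And>g. jack_form f g = 0"
  shows "f = 0"
proof (rule ccontr)
  assume "f \<noteq> 0"
  have "f \<in> sf.span {power_sum_prod lam | lam. is_partition lam}"
    by (induction f rule: power_sum_induct)
      (auto intro: sf.span_zero sf.span_add sf.span_scale sf.span_base)
  then obtain S u where S: "finite S" "S \<subseteq> {power_sum_prod lam | lam. is_partition lam}"
    and f: "f = (\<Sum>v\<in>S. scale_sf (u v) v)"
    by (auto simp: sf.span_explicit)
  have "u v = 0" if "v \<in> S" for v
  proof -
    obtain lam where lam: "v = power_sum_prod lam" "is_partition lam" using \<open>v \<in> S\<close> S(2) by blast
    have z: "jack_form w v = 0" if "w \<in> S - {v}" for w
      using that S(2) lam jack_form_spec by auto
    have "0 = jack_form f v" using assms by simp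
    also have "\<dots> = (\<Sum>w\<in>S. u w * jack_form w v)"
      by (simp add: f jack_form_sum_left)
    also have "\<dots> = u v * jack_form v v"
      by (subst sum.remove[OF S(1) that]) (simp add: z sum.neutral)
    finally have "u v * jack_form v v = 0" by simp
    moreover have "z_part lam \<noteq> 0"
      using lam(2) by (auto simp: z_part_def is_partition_def)
    then have "jack_form v v \<noteq> 0"
      using jack_form_power_sum_prod[of lam lam] lam is_partition_zero by auto
    ultimately show ?thesis by simp
  qed
  then have "f = 0" by (simp add: f)
  with \<open>f \<noteq> 0\<close> show False ..
qed

text \<open>On products of power sums this is the recursion \<open>z_part_Cons\<close>. If
  \<open>m\<close> is the multiplicity of \<open>n\<close> in \<open>lam\<close>, adding a part
  \<open>n\<close> multiplies the norm by \<alpha> times \<open>n\<close> times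
  \<open>m + 1\<close>; the derivative contributes \<open>m + 1\<close>, and the scalar in
  \<open>p_star\<close> the rest.\<close>

lemma jack_form_power_sum_adjoint:
  assumes "n \<ge> 1"
  shows "jack_form (power_sum n * f) g = jack_form f (app (p_star n) g)"
proof (induction f rule: power_sum_induct)
  case (base lam)
  show ?case
  proof (induction g rule: power_sum_induct)
    case (base mu)
    have z: "0 \<notin> set (n # lam)" "0 \<notin> set lam" "0 \<notin> set mu" "0 \<notin> set (remove1 n mu)"
      using base \<open>is_partition lam\<close> assms by (auto simp: is_partition_def dest: notin_set_remove1)
    have l: "jack_form (power_sum_prod (n # lam)) (power_sum_prod mu) =
        (if mset (n # lam) = mset mu then alpha ^ Suc (length lam) * of_nat (z_part (n # lam)) else 0)"
      using jack_form_power_sum_prod[OF z(1,3)] by simp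
    have r: "jack_form (power_sum_prod lam) (app (p_star n) (power_sum_prod mu)) =
        alpha * of_nat n * of_nat (count (mset mu) n) *
          (if mset lam = mset (remove1 n mu) then alpha ^ length lam * of_nat (z_part lam) else 0)"
      using jack_form_power_sum_prod[OF z(2,4)]
      by (simp add: p_star_def app_partial_p[OF z(3)])
    show ?case
    proof (cases "mset (n # lam) = mset mu")
      case True
      then have mu: "mset mu = add_mset n (mset lam)" by simp
      have c: "count (mset mu) n = Suc (count (mset lam) n)" "(mset lam = mset (remove1 n mu)) = True"
        by (simp_all add: mu)
      show ?thesis
        unfolding r power_sum_prod_simps(2)[symmetric] l c
        by (simp only: True refl if_True z_part_Cons power_Suc of_nat_mult mult_ac)
    next
      case False
      have "count (mset mu) n = 0 \<or> mset lam \<noteq> mset (remove1 n mu)"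
      proof (cases "n \<in># mset mu")
        case True
        then show ?thesis using False by auto
      next
        case False
        then have "count (mset mu) n = 0" by (simp only: not_in_iff)
        then show ?thesis ..
      qed
      then have "jack_form (power_sum_prod lam) (app (p_star n) (power_sum_prod mu)) = 0"
        unfolding r by (elim disjE) (simp_all only: if_False of_nat_0 mult_zero_left mult_zero_right)
      moreover have "jack_form (power_sum_prod (n # lam)) (power_sum_prod mu) = 0"
        using False l by (simp only: if_False)
      ultimately show ?thesis by simp
    qed
  qed (simp_all add: app_add app_scale)
qed (simp_all add: distrib_left scale_sf_mult_right)

section \<open>Graded operators and their sums\<close>

text \<open>Operators of negative degree annihilate everything of sufficiently small degree; this is
  the source of all finiteness below.\<close>

definition opdeg :: "int \<Rightarrow> 'a::comm_ring_1 symop \<Rightarrow> bool" where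
  "opdeg r T \<longleftrightarrow> (\<forall>d f. degle d f \<longrightarrow> degle (d + r) (app T f))"

lemma opdegD: "opdeg r T \<Longrightarrow> degle d f \<Longrightarrow> degle (d + r) (app T f)"
  by (simp add: opdeg_def)

lemma opdeg_vanish: "opdeg r T \<Longrightarrow> degle d f \<Longrightarrow> d + r < 0 \<Longrightarrow> app T f = 0"
  by (meson degle_neg opdegD)

lemma opdeg_zero [simp]: "opdeg r 0"
  by (simp add: opdeg_def)

lemma opdeg_one: "opdeg 0 1"
  by (simp add: opdeg_def)

lemma opdeg_scalar: "opdeg 0 (scalar_op c)"
  by (simp add: opdeg_def degle_scale)

lemma opdeg_add: "opdeg r S \<Longrightarrow> opdeg r T \<Longrightarrow> opdeg r (S + T)"
  by (simp add: opdeg_def degle_add)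

lemma opdeg_mult_op: "opdeg (int n) (mult_op (power_sum n))"
  unfolding opdeg_def
proof (intro allI impI)
  fix d and f :: "'a symfun" assume "degle d f"
  from degle_mult[OF degle_power_sum[of n] this] show "degle (d + int n) (app (mult_op (power_sum n)) f)"
    by (simp add: add.commute)
qed

lemma opdeg_p_op: "opdeg (int n) (p_op n)"
  unfolding p_op_def by (rule opdeg_mult_op)

lemma app_p_op [simp]: "app (p_op n) f = power_sum n * f"
  by (simp add: p_op_def)

lemma app_p_star: "app (p_star n) f = scale_sf (alpha * of_nat n) (app (partial_p n) f)"
  by (simp add: p_star_def)

lemma opdeg_p_star: "opdeg (- int n) (p_star n)"
  unfolding opdeg_def
proof (intro allI impI)
  fix d :: int and f :: "ratfun symfun" assume "degle d f"
  then show "degle (d + - int n) (app (p_star n) f)"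
  proof (induction rule: degle_power_sum_induct)
    case (base lam)
    show ?case
    proof (cases "n \<in> set lam")
      case True
      then have "sum_list lam = n + sum_list (remove1 n lam)"
        by (rule sum_list_map_remove1[of n lam "\<lambda>x. x", simplified])
      then have "degle (d - int n) (power_sum_prod (remove1 n lam) :: ratfun symfun)"
        using base by (intro degle_mono[OF homogeneous_degle[OF homogeneous_power_sum_prod]]) simp
      then show ?thesis
        by (simp add: app_p_star app_partial_p_partition[OF base(1)] degle_scale)
    next
      case False
      then have "count_list lam n = 0" by (simp add: count_list_0_iff)
      then show ?thesis
        by (simp add: app_p_star app_partial_p_partition[OF base(1)])
    qed
  qed (simp_all add: app_add app_scale degle_add degle_scale)
qed

lemma opdeg_p_int: "opdeg n (p_int n)"
  using opdeg_p_op[of "nat n"] opdeg_p_star[of "nat (- n)"] by (auto simp: p_int_def)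

lemma opdeg_lax: "opdeg (int j - int i) (lax i j)"
  unfolding lax_def by (intro opdeg_add opdeg_p_int) (auto simp: opdeg_scalar)

lemma has_opsum_unique:
  fixes S S' :: "ratfun symop"
  assumes "has_opsum F S" "has_opsum F S'"
  shows "S = S'"
proof (rule symop_eqI_power_sum)
  fix lam
  have h: "homogeneous (sum_list lam) (power_sum_prod lam :: ratfun symfun)"
    by (rule homogeneous_power_sum_prod)
  have "app T (power_sum_prod lam) = (\<Sum>i | 1 \<le> i \<and> (\<exists>g. homogeneous (sum_list lam) g \<and>
      app (F i) g \<noteq> 0). app (F i) (power_sum_prod lam))" if "has_opsum F T" for T
    using that h unfolding has_opsum_def by blast
  from this[OF assms(1)] this[OF assms(2)]
  show "app S (power_sum_prod lam) = app S' (power_sum_prod lam)"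
    by (rule trans[OF _ sym])
qed

lemma opsum_eqI:
  assumes "has_opsum F (S :: ratfun symop)"
  shows "opsum F = S"
  unfolding opsum_def using assms has_opsum_unique[OF _ assms] by (rule the_equality)

lemma opsum_cong:
  assumes "\<And>i. i \<ge> 1 \<Longrightarrow> F i = G i"
  shows "opsum F = opsum G"
proof -
  have "has_opsum F = has_opsum G"
    unfolding has_opsum_def using assms by (intro ext) (simp cong: conj_cong)
  then show ?thesis by (simp add: opsum_def)
qed

lemma has_opsumI:
  assumes "\<And>d. \<exists>N. \<forall>f. homogeneous d f \<longrightarrow> (\<forall>i>N. app (F i) f = 0) \<and> app S f = (\<Sum>i=1..N. app (F i) f)"
  shows "has_opsum F S"
  unfolding has_opsum_def
proof (intro allI conjI impI)
  fix d
  let ?I = "{i. 1 \<le> i \<and> (\<exists>f. homogeneous d f \<and> app (F i) f \<noteq> 0)}"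
  obtain N where N: "\<And>f i. homogeneous d f \<Longrightarrow> i > N \<Longrightarrow> app (F i) f = 0"
    "\<And>f. homogeneous d f \<Longrightarrow> app S f = (\<Sum>i=1..N. app (F i) f)"
    using assms by blast
  have sub: "?I \<subseteq> {1..N}"
    using N(1) by (fastforce simp: not_less[symmetric])
  then show "finite ?I" by (rule finite_subset) simp
  fix f :: "'a symfun" assume f: "homogeneous d f"
  show "app S f = (\<Sum>i\<in>?I. app (F i) f)"
    unfolding N(2)[OF f]
    by (rule sum.mono_neutral_right) (use sub f in auto)
qed

lemma has_opsum_mult_left:
  fixes F :: "nat \<Rightarrow> 'a::comm_ring_1 symop"
  assumes "has_opsum F S"
  shows "has_opsum (\<lambda>i. X * F i) (X * S)"
proof (rule has_opsumI)
  fix d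
  let ?I = "{i. 1 \<le> i \<and> (\<exists>f. homogeneous d f \<and> app (F i) f \<noteq> 0)}"
  have fin: "finite ?I" and S: "\<And>f. homogeneous d f \<Longrightarrow> app S f = (\<Sum>i\<in>?I. app (F i) f)"
    using assms unfolding has_opsum_def by blast+
  define M where "M = Max (insert 0 ?I)"
  have N: "i \<le> M" if "i \<in> ?I" for i
    unfolding M_def using fin that by simp
  show "\<exists>N. \<forall>f. homogeneous d f \<longrightarrow> (\<forall>i>N. app (X * F i) f = 0) \<and> app (X * S) f = (\<Sum>i=1..N. app (X * F i) f)"
  proof (intro exI[of _ "M"] allI impI conjI)
    fix f :: "'a symfun" and i assume f: "homogeneous d f" and "i > M"
    then have "i \<notin> ?I" "i \<ge> 1" using N[of i] by linarith+
    with f show "app (X * F i) f = 0" by auto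
  next
    fix f :: "'a symfun" assume f: "homogeneous d f"
    have "app (X * S) f = (\<Sum>i\<in>?I. app (X * F i) f)"
      by (simp add: S[OF f] app_sum)
    also have "\<dots> = (\<Sum>i=1..M. app (X * F i) f)"
    proof (rule sum.mono_neutral_left)
      have "i \<in> {1..M}" if "i \<in> ?I" for i using N[OF that] that by simp
      then show "?I \<subseteq> {1..M}" by blast
    qed (use f in auto)
    finally show "app (X * S) f = (\<Sum>i=1..M. app (X * F i) f)" .
  qed
qed

text \<open>\<open>Y k\<close> sends degree at most \<open>d\<close> to degree at most
  \<open>d + r - k\<close>, so the terms with \<open>k > d + r\<close> vanish.\<close>

lemma graded_sum_ex:
  fixes X Y :: "nat \<Rightarrow> 'a::comm_ring_1 symop"
  assumes Y: "\<And>k. opdeg (r - int k) (Y k)"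
  shows "\<exists>S. \<forall>d f N. degle d f \<longrightarrow> d + r \<le> int N \<longrightarrow> app S f = (\<Sum>k=1..N. app (X k) (app (Y k) f))"
proof -
  \<comment> \<open>The range of summation depends on \<open>f\<close>. Linearity is therefore
    checked after passing to a cut-off valid for all the arguments involved.\<close>
  define s where "s f = (\<Sum>k | 1 \<le> k \<and> app (Y k) f \<noteq> 0. app (X k) (app (Y k) f))" for f
  have s: "s f = (\<Sum>k=1..N. app (X k) (app (Y k) f))" if "degle d f" "d + r \<le> int N" for d f N
  proof -
    have "app (Y k) f = 0" if "k > N" for k
      by (rule opdeg_vanish[OF Y \<open>degle d f\<close>]) (use that \<open>d + r \<le> int N\<close> in simp)
    then have "{k. 1 \<le> k \<and> app (Y k) f \<noteq> 0} \<subseteq> {1..N}"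
      by (fastforce simp: not_less[symmetric])
    then show ?thesis
      unfolding s_def by (intro sum.mono_neutral_left) auto
  qed
  have bound: "\<exists>d. degle d f \<and> degle d g" for f g :: "'a symfun"
  proof -
    obtain d e where "degle d f" "degle e g" using degle_ex by blast
    then show ?thesis by (intro exI[of _ "max d e"]) (auto intro: degle_mono)
  qed
  have "module_hom scale_sf scale_sf s"
    unfolding module_hom_iff
  proof (intro conjI allI sf.module_axioms)
    fix f g :: "'a symfun"
    obtain d where d: "degle d f" "degle d g" using bound by blast
    then have "degle d (f + g)" by (rule degle_add)
    note s' = s[OF this, of "nat (d + r)"] s[OF d(1), of "nat (d + r)"] s[OF d(2), of "nat (d + r)"]
    show "s (f + g) = s f + s g"
      using s' by (simp add: app_add sum.distrib)
  next
    fix c and f :: "'a symfun"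
    obtain d where d: "degle d f" using degle_ex by blast
    then have "degle d (scale_sf c f)" by (rule degle_scale)
    note s' = s[OF this, of "nat (d + r)"] s[OF d(1), of "nat (d + r)"]
    show "s (scale_sf c f) = scale_sf c (s f)"
      using s' by (simp add: app_scale sf.scale_sum_right)
  qed
  then have "app (Abs_symop s) = s" by (simp add: Abs_symop_inverse)
  with s show ?thesis by (intro exI[of _ "Abs_symop s"]) auto
qed

lemma graded_opsum:
  fixes X Y :: "nat \<Rightarrow> ratfun symop"
  assumes Y: "\<And>k. opdeg (r - int k) (Y k)"
  shows has_opsum_graded: "has_opsum (\<lambda>k. X k * Y k) (opsum (\<lambda>k. X k * Y k))"
    and app_opsum_graded: "degle d f \<Longrightarrow> d + r \<le> int N \<Longrightarrow>
      app (opsum (\<lambda>k. X k * Y k)) f = (\<Sum>k=1..N. app (X k) (app (Y k) f))"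
proof -
  obtain S where S: "\<And>d f N. degle d f \<Longrightarrow> d + r \<le> int N \<Longrightarrow>
      app S f = (\<Sum>k=1..N. app (X k) (app (Y k) f))"
    using graded_sum_ex[OF Y, where X=X] by blast
  have h: "has_opsum (\<lambda>k. X k * Y k) S"
  proof (rule has_opsumI)
    fix d
    show "\<exists>N. \<forall>f. homogeneous d f \<longrightarrow> (\<forall>k>N. app (X k * Y k) f = 0) \<and>
        app S f = (\<Sum>k=1..N. app (X k * Y k) f)"
    proof (intro exI[of _ "nat (int d + r)"] allI impI conjI)
      fix f :: "ratfun symfun" and k assume f: "homogeneous d f" and k: "k > nat (int d + r)"
      have "app (Y k) f = 0"
        by (rule opdeg_vanish[OF Y homogeneous_degle[OF f]]) (use k in linarith)
      then show "app (X k * Y k) f = 0" by simp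
    next
      fix f :: "ratfun symfun" assume f: "homogeneous d f"
      show "app S f = (\<Sum>k=1..nat (int d + r). app (X k * Y k) f)"
        using S[OF homogeneous_degle[OF f], of "nat (int d + r)"] by simp
    qed
  qed
  have "opsum (\<lambda>k. X k * Y k) = S" by (rule opsum_eqI[OF h])
  with h S show "has_opsum (\<lambda>k. X k * Y k) (opsum (\<lambda>k. X k * Y k))"
    and "degle d f \<Longrightarrow> d + r \<le> int N \<Longrightarrow>
      app (opsum (\<lambda>k. X k * Y k)) f = (\<Sum>k=1..N. app (X k) (app (Y k) f))"
    by simp_all
qed

lemma opdeg_opsum:
  fixes X Y :: "nat \<Rightarrow> ratfun symop"
  assumes X: "\<And>k. opdeg (int k - q) (X k)" and Y: "\<And>k. opdeg (r - int k) (Y k)"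
  shows "opdeg (r - q) (opsum (\<lambda>k. X k * Y k))"
  unfolding opdeg_def
proof (intro allI impI)
  fix d :: int and f :: "ratfun symfun" assume f: "degle d f"
  have "degle (d + (r - q)) (app (X k) (app (Y k) f))" for k
    using opdegD[OF X opdegD[OF Y f], of k k] by (simp add: algebra_simps)
  then show "degle (d + (r - q)) (app (opsum (\<lambda>k. X k * Y k)) f)"
    using app_opsum_graded[where X=X and Y=Y, OF Y f, of "nat (d + r)"] by (simp add: degle_sum)
qed

section \<open>The Hamiltonians\<close>

text \<open>
  \<open>lax_col k i\<close> is the entry \<open>i\<close> of \<open>L\<^sup>k p\<^sup>*\<close>, and \<open>hamiltonian k\<close> is the coefficient of
  \<open>u\<^sup>-\<^sup>k\<^sup>-\<^sup>1\<close> in \<open>p (u - L)\<^sup>-\<^sup>1 p\<^sup>*\<close>.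
\<close>

primrec lax_col :: "nat \<Rightarrow> nat \<Rightarrow> ratfun symop" where
  "lax_col 0 = p_star"
| "lax_col (Suc k) = (\<lambda>i. opsum (\<lambda>j. lax i j * lax_col k j))"

definition hamiltonian :: "nat \<Rightarrow> ratfun symop" where
  "hamiltonian k = opsum (\<lambda>i. p_op i * lax_col k i)"

lemma opdeg_lax_col: "opdeg (0 - int i) (lax_col k i)"
proof (induction k arbitrary: i)
  case 0
  show ?case using opdeg_p_star by simp
next
  case (Suc k)
  show ?case unfolding lax_col.simps by (rule opdeg_opsum[OF opdeg_lax Suc.IH])
qed

lemma app_lax_col_Suc:
  assumes "degle d f" "d \<le> int N"
  shows "app (lax_col (Suc k) i) f = (\<Sum>j=1..N. app (lax i j) (app (lax_col k j) f))"
  unfolding lax_col.simps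
  by (rule app_opsum_graded[OF opdeg_lax_col assms(1)]) (use assms(2) in simp)

lemma app_hamiltonian:
  assumes "degle d f" "d \<le> int N"
  shows "app (hamiltonian k) f = (\<Sum>i=1..N. power_sum i * app (lax_col k i) f)"
  unfolding hamiltonian_def
  using app_opsum_graded[OF opdeg_lax_col assms(1), where N=N and X=p_op] assms(2) by simp

section \<open>Comparison with matrix powers and with iterated sums\<close>

lemma opdeg_lax_power: "opdeg (int j - int i) (opmatrix_power lax m i j)"
proof (induction m arbitrary: i)
  case 0
  show ?case by (simp add: opdeg_one)
next
  case (Suc m)
  show ?case
    unfolding opmatrix_power.simps opmatrix_mult_def by (rule opdeg_opsum[OF opdeg_lax Suc.IH])
qed

text \<open>Associativity for infinite matrices. Since \<open>p_star j\<close> lowers the degree by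
  \<open>j\<close> and entry \<open>(k, j)\<close> of a power of \<open>L\<close> raises it by
  \<open>j - k\<close>, both sums can be cut off at the degree of \<open>f\<close>, and finite sums
  may be interchanged.\<close>

lemma lax_power_p_star:
  "i \<ge> 1 \<Longrightarrow> opsum (\<lambda>j. opmatrix_power lax m i j * p_star j) = lax_col m i"
proof (induction m arbitrary: i)
  case 0
  show ?case
  proof (rule symop_eqI)
    fix f :: "ratfun symfun"
    obtain d where d: "degle d f" using degle_ex by blast
    \<comment> \<open>The summand \<open>i\<close> keeps the diagonal index in the range even if
      \<open>i\<close> exceeds the degree of \<open>f\<close>.\<close>
    define N where "N = nat d + i"
    have N: "d + 0 \<le> int N" "i \<in> {1..N}" using 0 by (auto simp: N_def)
    have "opdeg (0 - int j) (p_star j)" for j using opdeg_p_star[of j] by simp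
    then have "app (opsum (\<lambda>j. opmatrix_power lax 0 i j * p_star j)) f =
        (\<Sum>j=1..N. app (opmatrix_power lax 0 i j) (app (p_star j) f))"
      using d N(1) by (rule app_opsum_graded)
    also have "\<dots> = (\<Sum>j=1..N. if i = j then app (p_star j) f else 0)"
      by (rule sum.cong) auto
    also have "\<dots> = app (lax_col 0 i) f"
      using N(2) by simp
    finally show "app (opsum (\<lambda>j. opmatrix_power lax 0 i j * p_star j)) f = app (lax_col 0 i) f" .
  qed
next
  case (Suc m)
  let ?M = "opmatrix_power lax m"
  have ps: "opdeg (0 - int j) (p_star j)" for j using opdeg_p_star[of j] by simp
  show ?case
  proof (rule symop_eqI)
    fix f :: "ratfun symfun"
    obtain d where d: "degle d f" using degle_ex by blast
    define N where "N = nat d"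
    have N: "d + 0 \<le> int N" by (auto simp: N_def)
    have 1: "app (opsum (\<lambda>j. opmatrix_power lax m' k j * p_star j)) f =
        (\<Sum>j=1..N. app (opmatrix_power lax m' k j) (app (p_star j) f))" for m' k
      using ps d N by (rule app_opsum_graded)
    have 2: "app (opmatrix_power lax (Suc m) i j) (app (p_star j) f) =
        (\<Sum>k=1..N. app (lax i k) (app (?M k j) (app (p_star j) f)))" for j
      unfolding opmatrix_power.simps opmatrix_mult_def
      by (rule app_opsum_graded[OF opdeg_lax_power opdegD[OF ps d]]) (use N in simp)
    have "app (opsum (\<lambda>j. opmatrix_power lax (Suc m) i j * p_star j)) f =
        (\<Sum>j=1..N. \<Sum>k=1..N. app (lax i k) (app (?M k j) (app (p_star j) f)))"
      unfolding 1 2 ..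
    also have "\<dots> = (\<Sum>k=1..N. app (lax i k) (\<Sum>j=1..N. app (?M k j) (app (p_star j) f)))"
      by (subst sum.swap) (simp add: app_sum)
    also have "\<dots> = (\<Sum>k=1..N. app (lax i k) (app (lax_col m k) f))"
      by (intro sum.cong refl) (simp only: 1[symmetric] Suc.IH atLeastAtMost_iff)
    also have "\<dots> = app (lax_col (Suc m) i) f"
      by (rule app_lax_col_Suc[symmetric, OF d]) (use N in simp)
    finally show "app (opsum (\<lambda>j. opmatrix_power lax (Suc m) i j * p_star j)) f =
        app (lax_col (Suc m) i) f" .
  qed
qed

lemma row_matrix_col_hamiltonian:
  "fps_nth (row_matrix_col p_op (resolvent lax) p_star) n = (case n of 0 \<Rightarrow> 0 | Suc m \<Rightarrow> hamiltonian m)"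
proof (cases n)
  case 0
  have "opsum (\<lambda>_. 0 :: ratfun symop) = 0"
    by (rule opsum_eqI) (simp add: has_opsum_def)
  then show ?thesis
    by (simp add: 0 row_matrix_col_def resolvent_def)
next
  case (Suc m)
  have "opsum (\<lambda>j. p_op i * opmatrix_power lax m i j * p_star j) = p_op i * lax_col m i" if "i \<ge> 1" for i
  proof -
    have ps: "opdeg (0 - int j) (p_star j)" for j using opdeg_p_star[of j] by simp
    have "has_opsum (\<lambda>j. p_op i * (opmatrix_power lax m i j * p_star j)) (p_op i * lax_col m i)"
      using has_opsum_mult_left[OF has_opsum_graded[where X="opmatrix_power lax m i", OF ps]]
      by (simp only: lax_power_p_star[OF that])
    then show ?thesis
      by (intro opsum_eqI) (simp only: mult.assoc)
  qed
  then have "opsum (\<lambda>i. opsum (\<lambda>j. p_op i * opmatrix_power lax m i j * p_star j)) = hamiltonian m"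
    unfolding hamiltonian_def by (rule opsum_cong)
  then show ?thesis
    by (simp add: Suc row_matrix_col_def resolvent_def)
qed

text \<open>The factors of \<open>lax_term\<close> after the first one, arranged so that the
  recursion removes the outermost summation index, as \<open>has_iter_opsum\<close> does.\<close>

primrec lax_path :: "nat \<Rightarrow> nat list \<Rightarrow> ratfun symop" where
  "lax_path i [] = p_star i"
| "lax_path i (j # js) = lax i j * lax_path j js"

lemma lax_term_Cons: "lax_term (i # js) = p_op i * lax_path i js"
proof -
  have "prod_list (map (\<lambda>r. lax ((i # js) ! r) ((i # js) ! Suc r)) [0..<length js]) * p_star (last (i # js)) =
      lax_path i js"
  proof (induction js arbitrary: i)
    case (Cons j js)
    have "map (\<lambda>r. lax ((i # j # js) ! r) ((i # j # js) ! Suc r)) [0..<length (j # js)] =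
        lax i j # map (\<lambda>r. lax ((j # js) ! r) ((j # js) ! Suc r)) [0..<length js]"
      by (simp add: upt_conv_Cons map_Suc_upt[symmetric] del: upt_Suc)
    with Cons.IH[of j] show ?case by (simp add: mult.assoc)
  qed simp
  then show ?thesis by (simp add: lax_term_def mult.assoc)
qed

text \<open>The prefix \<open>X\<close> is arbitrary because fixing the next index \<open>j\<close>
  moves the factor \<open>lax i j\<close> into it.\<close>

lemma has_iter_opsum_lax_path:
  "has_iter_opsum k (\<lambda>js. X * lax_path i js) (X * lax_col k i)"
proof (induction k arbitrary: X i)
  case (Suc k)
  have "has_opsum (\<lambda>j. X * (lax i j * lax_col k j)) (X * lax_col (Suc k) i)"
    unfolding lax_col.simps by (rule has_opsum_mult_left[OF has_opsum_graded[OF opdeg_lax_col]])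
  then have "has_opsum (\<lambda>j. X * lax i j * lax_col k j) (X * lax_col (Suc k) i)"
    by (simp only: mult.assoc)
  moreover have "has_iter_opsum k (\<lambda>js. X * lax_path i (j # js)) (X * lax i j * lax_col k j)" for j
    using Suc.IH[of "X * lax i j" j] by (simp only: lax_path.simps mult.assoc)
  ultimately show ?case
    unfolding has_iter_opsum.simps by (intro exI[of _ "\<lambda>j. X * lax i j * lax_col k j"]) blast
qed simp

lemma has_iter_opsum_hamiltonian: "has_iter_opsum (Suc k) lax_term (hamiltonian k)"
proof -
  have "has_opsum (\<lambda>i. p_op i * lax_col k i) (hamiltonian k)"
    unfolding hamiltonian_def by (rule has_opsum_graded[OF opdeg_lax_col])
  then show ?thesis
    unfolding has_iter_opsum.simps lax_term_Cons
    using has_iter_opsum_lax_path by (intro exI[of _ "\<lambda>i. p_op i * lax_col k i"]) blast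
qed

section \<open>Self-adjointness\<close>

lemma lax_adjoint: "jack_form (app (lax i j) f) g = jack_form f (app (lax j i) g)"
proof -
  consider "i = j" | "i < j" | "j < i" by linarith
  then show ?thesis
  proof cases
    case 1
    then show ?thesis by (simp add: lax_def p_int_def)
  next
    case 2
    then have "nat (int j - int i) = j - i" "j - i \<ge> 1" by auto
    with 2 show ?thesis
      by (simp add: lax_def p_int_def jack_form_power_sum_adjoint)
  next
    case 3
    then have "nat (int i - int j) = i - j" "i - j \<ge> 1" by auto
    with 3 have "jack_form (app (lax i j) f) g = jack_form (app (p_star (i - j)) f) g"
      "jack_form f (app (lax j i) g) = jack_form f (power_sum (i - j) * g)"
      by (simp_all add: lax_def p_int_def)
    moreover have "jack_form (app (p_star (i - j)) f) g = jack_form (power_sum (i - j) * g) f"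
      unfolding jack_form_power_sum_adjoint[OF \<open>i - j \<ge> 1\<close>] by (rule jack_form_commute)
    ultimately show ?thesis
      by (metis jack_form_commute)
  qed
qed

text \<open>\<open>B k l\<close> pairs the columns obtained from \<open>f\<close> and
  \<open>g\<close> by \<open>k\<close> and \<open>l\<close> applications of \<open>L\<close>.
  Factors of \<open>L\<close> can be moved one by one from the left column to the right one, so
  \<open>B k 0 = B 0 k\<close>. The cut-off \<open>N\<close> serves both \<open>f\<close> and
  \<open>g\<close>, which keeps all sums finite.\<close>

lemma hamiltonian_selfadjoint:
  "jack_form (app (hamiltonian k) f) g = jack_form f (app (hamiltonian k) g)"
proof -
  obtain d e where de: "degle d f" "degle e g" using degle_ex by blast
  define N where "N = nat (max d e)"
  have N: "d \<le> int N" "e \<le> int N" by (auto simp: N_def)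
  define B where "B k l = (\<Sum>i=1..N. jack_form (app (lax_col k i) f) (app (lax_col l i) g))" for k l
  have step: "B (Suc k) l = B k (Suc l)" for k l
  proof -
    have "B (Suc k) l = (\<Sum>i=1..N. \<Sum>j=1..N. jack_form (app (lax i j) (app (lax_col k j) f)) (app (lax_col l i) g))"
      by (simp only: B_def app_lax_col_Suc[OF de(1) N(1)] jack_form_sum_left)
    also have "\<dots> = (\<Sum>j=1..N. \<Sum>i=1..N. jack_form (app (lax_col k j) f) (app (lax j i) (app (lax_col l i) g)))"
      by (subst sum.swap) (simp only: lax_adjoint)
    also have "\<dots> = B k (Suc l)"
      by (simp only: B_def app_lax_col_Suc[OF de(2) N(2)] jack_form_sum_right)
    finally show ?thesis .
  qed
  have shift: "B (k + l) m = B l (k + m)" for k l m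
    by (induction k arbitrary: m) (simp_all add: step)
  have ham: "jack_form (app (hamiltonian k) f) g = (\<Sum>i=1..N. jack_form (app (lax_col k i) f) (app (p_star i) g))"
    if "degle d f" "d \<le> int N" for d f g
    unfolding app_hamiltonian[OF that] jack_form_sum_left
    by (intro sum.cong refl) (simp add: jack_form_power_sum_adjoint)
  have "jack_form (app (hamiltonian k) f) g = B k 0"
    unfolding ham[OF de(1) N(1)] B_def lax_col.simps ..
  also have "\<dots> = B 0 k"
    using shift[of k 0 0] by simp
  also have "\<dots> = jack_form (app (hamiltonian k) g) f"
    unfolding ham[OF de(2) N(2)] B_def lax_col.simps
    by (intro sum.cong refl jack_form_commute)
  finally show ?thesis by (simp only: jack_form_commute[of f])
qed

section \<open>A distinguished variable\<close>

text \<open>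
  The coefficients of \<open>\<Sum>\<^sub>j\<^sub>\<ge>\<^sub>1 x\<^sub>1\<^sup>j v\<^sub>j\<close>. The variable \<open>x\<^sub>1\<close> has the index 0.
\<close>

definition attach :: "(nat \<Rightarrow> ratfun symfun) \<Rightarrow> mono \<Rightarrow> ratfun" where
  "attach v c = (\<Sum>j=1..lk c 0. coeff_sf (v j) (upd 0 (lk c 0 - j) c))"

text \<open>Separates the monomials of the power sum in \<open>x_1\<close> from those in the other
  variables. The set \<open>B\<close> may exceed the support, so one index set serves for all
  exponents of \<open>x_1\<close>.\<close>

lemma coeff_power_sum_mult_split:
  fixes f :: "'a::comm_ring_1 symfun"
  assumes n: "n \<ge> 1" and B: "finite B" "0 \<notin> B" "Poly_Mapping.keys c \<subseteq> insert 0 B"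
  shows "coeff_sf (power_sum n * f) c =
    (if n \<le> lk c 0 then coeff_sf f (upd 0 (lk c 0 - n) c) else 0) +
    (\<Sum>i\<in>B. if n \<le> lk c i then coeff_sf f (upd i (lk c i - n) c) else 0)"
proof -
  let ?g = "\<lambda>i. coeff_sf f (upd i (lk c i - n) c)"
  have "coeff_sf (power_sum n * f) c = (\<Sum>i | i \<in> Poly_Mapping.keys c \<and> n \<le> lk c i. ?g i)"
    by (rule coeff_power_sum_mult[OF n])
  also have "{i. i \<in> Poly_Mapping.keys c \<and> n \<le> lk c i} = {i \<in> insert 0 B. n \<le> lk c i}"
  proof -
    have "i \<in> Poly_Mapping.keys c" if "n \<le> lk c i" for i
      using that n by (auto simp: in_keys_iff)
    with B(3) show ?thesis by blast
  qed
  also have "(\<Sum>i | i \<in> insert 0 B \<and> n \<le> lk c i. ?g i) = (\<Sum>i\<in>insert 0 B. if n \<le> lk c i then ?g i else 0)"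
    using B(1) by (intro sum.inter_filter) simp
  finally show ?thesis
    using B(1,2) by simp
qed

lemma keys_upd_0: "Poly_Mapping.keys (upd 0 x c) \<subseteq> insert 0 (Poly_Mapping.keys c - {0})"
  by (auto simp: keys_update split: if_splits)

lemma coeff_power_sum_mult_upd_0:
  fixes f :: "'a::comm_ring_1 symfun"
  assumes n: "n \<ge> 1"
  shows "coeff_sf (power_sum n * f) (upd 0 x c) =
    (if n \<le> x then coeff_sf f (upd 0 (x - n) c) else 0) +
    (\<Sum>i\<in>Poly_Mapping.keys c - {0}.
      if n \<le> lk c i then coeff_sf f (upd 0 x (upd i (lk c i - n) c)) else 0)"
proof -
  let ?B = "Poly_Mapping.keys c - {0}"
  have B: "finite ?B" "0 \<notin> ?B" by simp_all
  have eq: "(if n \<le> lk (upd 0 x c) i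
        then coeff_sf f (upd i (lk (upd 0 x c) i - n) (upd 0 x c)) else 0) =
      (if n \<le> lk c i then coeff_sf f (upd 0 x (upd i (lk c i - n) c)) else 0)" if "i \<in> ?B" for i
    using that by (simp add: lookup_update upd_commute[of 0 i])
  show ?thesis
    unfolding coeff_power_sum_mult_split[OF n B keys_upd_0]
    by (subst sum.cong[OF refl eq], assumption) (simp add: lookup_update)
qed

lemma p_star_mult_power_sum:
  "n \<ge> 1 \<Longrightarrow> app (p_star j) (power_sum n * g) =
    (if j = n then scale_sf (alpha * of_nat n) g else 0) + power_sum n * app (p_star j) g"
  by (simp add: app_p_star partial_p_mult_power_sum sf.scale_right_distrib scale_sf_mult_right)

text \<open>Let \<open>s\<close> be the exponent of \<open>x_1\<close> in \<open>c\<close>. If the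
  factor taken from the power sum is a power of \<open>x_1\<close>, the Leibniz rule contributes
  \<alpha> times \<open>n\<close> and the hypothesis on \<open>g\<close> contributes \<alpha> times
  \<open>s - n\<close>. For any other variable the exponent of \<open>x_1\<close> is unchanged and
  the hypothesis alone gives \<alpha> times \<open>s\<close>.\<close>

lemma attach_p_star_Cons:
  assumes n: "n \<ge> 1" and IH: "\<And>c. attach (\<lambda>j. app (p_star j) g) c = alpha * of_nat (lk c 0) * coeff_sf g c"
  shows "attach (\<lambda>j. app (p_star j) (power_sum n * g)) c =
    alpha * of_nat (lk c 0) * coeff_sf (power_sum n * g) c"
proof -
  let ?s = "lk c 0" and ?B = "Poly_Mapping.keys c - {0}"
  let ?c = "\<lambda>i. upd i (lk c i - n) c"
  let ?v = "\<lambda>j. app (p_star j) g"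
  have B: "finite ?B" "0 \<notin> ?B" by simp_all
  note split = coeff_power_sum_mult_upd_0[OF n]
  have own: "(\<Sum>j=1..?s. if n \<le> ?s - j then coeff_sf (?v j) (upd 0 (?s - j - n) c) else 0) =
      (if n \<le> ?s then alpha * of_nat (?s - n) * coeff_sf g (?c 0) else 0)"
  proof (cases "n \<le> ?s")
    case True
    have "(\<Sum>j=1..?s. if n \<le> ?s - j then coeff_sf (?v j) (upd 0 (?s - j - n) c) else 0) =
        (\<Sum>j=1..?s - n. coeff_sf (?v j) (upd 0 (?s - n - j) c))"
      using True n by (intro sum.mono_neutral_cong_right) (auto simp: add.commute)
    also have "\<dots> = attach ?v (?c 0)"
      by (simp add: attach_def lookup_update)
    finally show ?thesis using True by (simp add: IH lookup_update)
  next
    case False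
    then have "\<not> n \<le> ?s - j" for j by simp
    with False show ?thesis by simp
  qed
  have other: "(\<Sum>j=1..?s. coeff_sf (?v j) (upd 0 (?s - j) (?c i))) = alpha * of_nat ?s * coeff_sf g (?c i)"
    if "i \<in> ?B" for i
    using IH[of "?c i"] that by (simp add: attach_def lookup_update)
  have "attach (\<lambda>j. app (p_star j) (power_sum n * g)) c =
      (\<Sum>j=1..?s. (if j = n then alpha * of_nat n * coeff_sf g (upd 0 (?s - j) c) else 0) +
        coeff_sf (power_sum n * ?v j) (upd 0 (?s - j) c))"
    unfolding attach_def by (intro sum.cong refl) (simp add: p_star_mult_power_sum[OF n])
  also have "\<dots> = (if n \<le> ?s then alpha * of_nat n * coeff_sf g (?c 0) else 0) +
      (\<Sum>j=1..?s. coeff_sf (power_sum n * ?v j) (upd 0 (?s - j) c))"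
    using n by (simp add: sum.distrib)
  also have "(\<Sum>j=1..?s. coeff_sf (power_sum n * ?v j) (upd 0 (?s - j) c)) =
      (\<Sum>j=1..?s. if n \<le> ?s - j then coeff_sf (?v j) (upd 0 (?s - j - n) c) else 0) +
      (\<Sum>j=1..?s. \<Sum>i\<in>?B. if n \<le> lk c i then coeff_sf (?v j) (upd 0 (?s - j) (?c i)) else 0)"
    by (simp only: split sum.distrib)
  also have "(\<Sum>j=1..?s. \<Sum>i\<in>?B. if n \<le> lk c i then coeff_sf (?v j) (upd 0 (?s - j) (?c i)) else 0) =
      (\<Sum>i\<in>?B. if n \<le> lk c i then \<Sum>j=1..?s. coeff_sf (?v j) (upd 0 (?s - j) (?c i)) else 0)"
    by (subst sum.swap) (intro sum.cong refl, simp)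
  also have "\<dots> = (\<Sum>i\<in>?B. if n \<le> lk c i then alpha * of_nat ?s * coeff_sf g (?c i) else 0)"
    using other by (intro sum.cong refl) simp
  also have "\<dots> = alpha * of_nat ?s * (\<Sum>i\<in>?B. if n \<le> lk c i then coeff_sf g (?c i) else 0)"
    by (simp add: sum_distrib_left if_distrib cong: if_cong)
  also note own
  also have "(if n \<le> ?s then alpha * of_nat n * coeff_sf g (?c 0) else 0) +
      ((if n \<le> ?s then alpha * of_nat (?s - n) * coeff_sf g (?c 0) else 0) +
        alpha * of_nat ?s * (\<Sum>i\<in>?B. if n \<le> lk c i then coeff_sf g (?c i) else 0)) =
      alpha * of_nat ?s * coeff_sf (power_sum n * g) c"
  proof -
    have sub: "Poly_Mapping.keys c \<subseteq> insert 0 ?B" by auto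
    have own: "alpha * of_nat n * x + alpha * of_nat (?s - n) * x = alpha * of_nat ?s * x"
      if "n \<le> ?s" for x
    proof -
      have "of_nat ?s = of_nat n + (of_nat (?s - n) :: ratfun)"
        using that by (simp flip: of_nat_add)
      then show ?thesis by (simp only: distrib_left distrib_right)
    qed
    show ?thesis
      unfolding coeff_power_sum_mult_split[OF n B sub] distrib_left
      using own by (cases "n \<le> ?s") (simp_all only: if_True if_False add.assoc[symmetric] add_0 mult_zero_right)
  qed
  finally show ?thesis .
qed

lemma attach_add: "attach (\<lambda>j. v j + w j) c = attach v c + attach w c"
  by (simp add: attach_def sum.distrib)

lemma attach_scale: "attach (\<lambda>j. scale_sf r (v j)) c = r * attach v c"
  by (simp add: attach_def sum_distrib_left)

text \<open>
  On \<open>\<Lambda>\<close> the derivation \<open>\<Sum>\<^sub>j x\<^sub>1\<^sup>j p\<^sub>j\<^sup>*\<close> agrees with \<open>\<alpha> x\<^sub>1 \<partial>/\<partial>x\<^sub>1\<close>, since they agree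
  on the generators \<open>p\<^sub>n\<close>.
\<close>

lemma attach_p_star:
  "attach (\<lambda>j. app (p_star j) f) c = alpha * of_nat (lk c 0) * coeff_sf f c"
proof (induction f arbitrary: c rule: power_sum_induct)
  case (base lam)
  have "\<forall>c. attach (\<lambda>j. app (p_star j) (power_sum_prod l)) c =
      alpha * of_nat (lk c 0) * coeff_sf (power_sum_prod l) c" if "0 \<notin> set l" for l
    using that
  proof (induction l)
    case Nil
    have "app (p_star j) 1 = 0" for j
      using app_partial_p_partition[of "[]" j] by (simp add: app_p_star is_partition_def)
    then show ?case
      by (auto simp: attach_def)
  next
    case (Cons n l)
    have "n \<ge> 1" using Cons.prems by (cases n) auto
    with Cons show ?case
      unfolding power_sum_prod_simps by (intro allI attach_p_star_Cons) simp_all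
  qed
  with is_partition_zero[OF base] show ?case by blast
next
  case zero
  show ?case by (simp add: attach_def)
next
  case (add f g)
  then show ?case by (simp add: app_add attach_add distrib_left)
next
  case (scale r f)
  then show ?case by (simp add: app_scale attach_scale)
qed

text \<open>
  The coefficientwise form of \<open>\<alpha> x\<^sub>1 \<partial>/\<partial>x\<^sub>1 - 1 + \<Sum>\<^sub>i\<^sub>>\<^sub>1 (x\<^sub>i - x\<^sub>1 s\<^sub>1\<^sub>i) / (x\<^sub>1 - x\<^sub>i)\<close>, where \<open>s\<^sub>1\<^sub>i\<close>
  exchanges the variables \<open>x\<^sub>1\<close> and \<open>x\<^sub>i\<close>.
\<close>

definition dunkl :: "(mono \<Rightarrow> ratfun) \<Rightarrow> mono \<Rightarrow> ratfun" where
  "dunkl G c = (alpha * of_nat (lk c 0) - 1) * G c +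
     (\<Sum>i\<in>Poly_Mapping.keys c - {0}.
        (\<Sum>a=Suc (lk c 0)..lk c 0 + lk c i. G (upd i (lk c 0 + lk c i - a) (upd 0 a c))) -
        (\<Sum>a=1..lk c i. G (upd i (lk c 0 + lk c i - a) (upd 0 a c))))"

lemma dunkl_add: "dunkl (\<lambda>c. G c + H c) c = dunkl G c + dunkl H c"
  by (simp only: dunkl_def sum.distrib distrib_left add_diff_add add_ac)

lemma dunkl_zero: "dunkl (\<lambda>c. 0) c = 0"
  by (simp add: dunkl_def)

lemma dunkl_sum: "dunkl (\<lambda>c. \<Sum>x\<in>A. G x c) c = (\<Sum>x\<in>A. dunkl (G x) c)"
  by (induction A rule: infinite_finite_induct) (simp_all add: dunkl_zero dunkl_add)

text \<open>The coefficient form of \<open>(x_r x_1^j - x_1 x_r^j) / (x_1 - x_r) = x_1^(j-1) x_r +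
  ... + x_1 x_r^(j-1)\<close>, multiplied by a function symmetric in \<open>x_1\<close> and
  \<open>x_r\<close>. Here \<open>F x y\<close> is its coefficient at the exponents \<open>x\<close>
  and \<open>y\<close>, while \<open>s\<close> and \<open>t\<close> are the exponents in the result.
  The left-hand side is the part of the upper entries of column \<open>j\<close> of \<open>L\<close>
  in which the power sum contributes a power of \<open>x_r\<close>.\<close>

lemma transfer_sum:
  fixes F :: "nat \<Rightarrow> nat \<Rightarrow> 'a::ab_group_add"
  assumes sym: "\<And>x y. F x y = F y x" and j: "j \<ge> 1"
  shows "(\<Sum>i=1..s. if i < j \<and> j - i \<le> t then F (s - i) (t - (j - i)) else 0) =
    (\<Sum>a=Suc s..s + t. if j \<le> a then F (a - j) (s + t - a) else 0) -
    (\<Sum>a=1..t. if j \<le> a then F (a - j) (s + t - a) else 0)"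
proof -
  let ?h = "\<lambda>a. F (a - j) (s + t - a)"
  have "(\<Sum>i=1..s. if i < j \<and> j - i \<le> t then F (s - i) (t - (j - i)) else 0) =
      (\<Sum>i\<in>{i \<in> {1..s}. i < j \<and> j - i \<le> t}. F (s - i) (t - (j - i)))"
    by (rule sum.inter_filter[symmetric]) simp
  also have "\<dots> = (\<Sum>a\<in>{a \<in> {Suc s..s + t}. j \<le> a \<and> a < s + j}. ?h a)"
    by (rule sum.reindex_bij_witness[where i = "\<lambda>a. s + j - a" and j = "\<lambda>i. s + j - i"])
      (auto intro!: arg_cong2[of _ _ _ _ F])
  finally have 1: "(\<Sum>i=1..s. if i < j \<and> j - i \<le> t then F (s - i) (t - (j - i)) else 0) =
      (\<Sum>a\<in>{a \<in> {Suc s..s + t}. j \<le> a \<and> a < s + j}. ?h a)" .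
  have "(\<Sum>a=1..t. if j \<le> a then ?h a else 0) = (\<Sum>a\<in>{a \<in> {1..t}. j \<le> a}. ?h a)"
    by (rule sum.inter_filter[symmetric]) simp
  \<comment> \<open>The reflection of \<open>a\<close> to \<open>s + t + j - a\<close> exchanges the
    two arguments of \<open>F\<close>. The subtracted sum thus cancels the terms
    \<open>a \<ge> s + j\<close> of the first one.\<close>
  also have "\<dots> = (\<Sum>a\<in>{a \<in> {Suc s..s + t}. j \<le> a \<and> s + j \<le> a}. ?h a)"
    by (rule sum.reindex_bij_witness[where i = "\<lambda>a. s + t + j - a" and j = "\<lambda>a. s + t + j - a"])
      (use j in \<open>auto intro: trans[OF arg_cong2[of _ _ _ _ F] sym]\<close>)
  finally have 2: "(\<Sum>a=1..t. if j \<le> a then ?h a else 0) =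
      (\<Sum>a\<in>{a \<in> {Suc s..s + t}. j \<le> a \<and> s + j \<le> a}. ?h a)" .
  have "(\<Sum>a=Suc s..s + t. if j \<le> a then ?h a else 0) = (\<Sum>a\<in>{a \<in> {Suc s..s + t}. j \<le> a}. ?h a)"
    by (rule sum.inter_filter[symmetric]) simp
  also have "{a \<in> {Suc s..s + t}. j \<le> a} =
      {a \<in> {Suc s..s + t}. j \<le> a \<and> a < s + j} \<union> {a \<in> {Suc s..s + t}. j \<le> a \<and> s + j \<le> a}"
    by auto
  also have "(\<Sum>a\<in>\<dots>. ?h a) = (\<Sum>a\<in>{a \<in> {Suc s..s + t}. j \<le> a \<and> a < s + j}. ?h a) +
      (\<Sum>a\<in>{a \<in> {Suc s..s + t}. j \<le> a \<and> s + j \<le> a}. ?h a)"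
    by (rule sum.union_disjoint) auto
  finally show ?thesis
    unfolding 1 2 by simp
qed

text \<open>The coefficients of \<open>x_1^j f\<close>, which encodes the column whose only non-zero
  entry is \<open>f\<close> in position \<open>j\<close>.\<close>

definition attach_at :: "nat \<Rightarrow> ratfun symfun \<Rightarrow> mono \<Rightarrow> ratfun" where
  "attach_at j f c = (if j \<le> lk c 0 then coeff_sf f (upd 0 (lk c 0 - j) c) else 0)"

text \<open>The origin of the constant -1 in the Dunkl operator. The three terms come from the
  diagonal entry of \<open>L\<close>, from the \<open>j - 1\<close> entries above it with the power
  sum contributing a power of \<open>x_1\<close>, and from the derivatives below it.\<close>

lemma lax_scalar_identity:
  "j * (al - 1) * x + (j - 1) * x + al * (s - j) * x = (al * s - 1) * (x :: 'a::comm_ring_1)"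
  by (simp add: algebra_simps)

text \<open>Column \<open>j\<close> of \<open>L\<close> is split into its diagonal entry, the
  entries above it and those below it. The entries below combine by \<open>attach_p_star\<close>. In
  those above, the power sum contributes a power either of \<open>x_1\<close>, giving a multiple of
  the same coefficient, or of another variable, giving the divided difference of
  \<open>transfer_sum\<close>.\<close>

lemma attach_lax_single:
  assumes j: "j \<ge> 1"
  shows "attach (\<lambda>i. app (lax i j) f) c = dunkl (attach_at j f) c"
proof -
  let ?s = "lk c 0" and ?B = "Poly_Mapping.keys c - {0}"
  let ?f = "coeff_sf f (upd 0 (?s - j) c)"
  have B: "finite ?B" "0 \<notin> ?B" by simp_all
  have lax: "coeff_sf (app (lax i j) f) (upd 0 (?s - i) c) =
      (if i = j then of_nat j * (alpha - 1) * ?f else 0) +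
      (if i < j then coeff_sf (power_sum (j - i) * f) (upd 0 (?s - i) c) else 0) +
      (if j < i then coeff_sf (app (p_star (i - j)) f) (upd 0 (?s - i) c) else 0)" for i
  proof -
    consider "i = j" | "i < j" | "j < i" by linarith
    then show ?thesis
    proof cases
      case 1 then show ?thesis by (simp add: lax_def p_int_def)
    next
      case 2
      then have "nat (int j - int i) = j - i" by auto
      with 2 show ?thesis by (simp add: lax_def p_int_def)
    next
      case 3
      then have "nat (int i - int j) = i - j" by auto
      with 3 show ?thesis by (simp add: lax_def p_int_def)
    qed
  qed
  have diag: "(\<Sum>i=1..?s. if i = j then of_nat j * (alpha - 1) * ?f else 0) =
      (if j \<le> ?s then of_nat j * (alpha - 1) * ?f else 0)"
    using j by simp
  have star: "(\<Sum>i=1..?s. if j < i then coeff_sf (app (p_star (i - j)) f) (upd 0 (?s - i) c) else 0) =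
      (if j \<le> ?s then alpha * of_nat (?s - j) * ?f else 0)"
  proof (cases "j \<le> ?s")
    case True
    have "(\<Sum>i=1..?s. if j < i then coeff_sf (app (p_star (i - j)) f) (upd 0 (?s - i) c) else 0) =
        (\<Sum>i\<in>{i \<in> {1..?s}. j < i}. coeff_sf (app (p_star (i - j)) f) (upd 0 (?s - i) c))"
      by (rule sum.inter_filter[symmetric]) simp
    also have "\<dots> = (\<Sum>m=1..?s - j. coeff_sf (app (p_star m) f) (upd 0 (?s - j - m) c))"
      by (rule sum.reindex_bij_witness[where i = "\<lambda>m. m + j" and j = "\<lambda>i. i - j"]) auto
    also have "\<dots> = attach (\<lambda>m. app (p_star m) f) (upd 0 (?s - j) c)"
      by (simp add: attach_def lookup_update)
    also have "\<dots> = alpha * of_nat (?s - j) * ?f"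
      by (simp add: attach_p_star lookup_update)
    finally show ?thesis using True by simp
  next
    case False
    then show ?thesis by (auto intro: sum.neutral)
  qed
  \<comment> \<open>The share of row \<open>i\<close> in which the power sum contributes a power of
    the variable with index \<open>r\<close>.\<close>
  define g where "g r i = (if i < j \<and> j - i \<le> lk c r
      then coeff_sf f (upd 0 (?s - i) (upd r (lk c r - (j - i)) c)) else 0)" for r i
  have mult: "(if i < j then coeff_sf (power_sum (j - i) * f) (upd 0 (?s - i) c) else 0) =
      (if i < j \<and> j \<le> ?s then ?f else 0) + (\<Sum>r\<in>?B. g r i)" if "i \<in> {1..?s}" for i
  proof (cases "i < j")
    case True
    then have ij: "j - i \<ge> 1" by simp
    have "j - i \<le> ?s - i \<longleftrightarrow> j \<le> ?s" "?s - i - (j - i) = ?s - j"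
      using True that by auto
    then show ?thesis
      using True by (simp add: coeff_power_sum_mult_upd_0[OF ij] g_def)
  next
    case False
    then show ?thesis by (simp add: g_def)
  qed
  have own: "(\<Sum>i=1..?s. if i < j \<and> j \<le> ?s then ?f else 0) = (if j \<le> ?s then of_nat (j - 1) * ?f else 0)"
  proof (cases "j \<le> ?s")
    case True
    have "(\<Sum>i=1..?s. if i < j \<and> j \<le> ?s then ?f else 0) = (\<Sum>i=1..j - 1. ?f)"
      using True by (intro sum.mono_neutral_cong_right) auto
    also have "\<dots> = of_nat (j - 1) * ?f" by simp
    finally show ?thesis using True by simp
  qed simp
  have transfer: "(\<Sum>i=1..?s. g r i) =
      (\<Sum>a=Suc ?s..?s + lk c r. attach_at j f (upd r (?s + lk c r - a) (upd 0 a c))) -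
      (\<Sum>a=1..lk c r. attach_at j f (upd r (?s + lk c r - a) (upd 0 a c)))" if "r \<in> ?B" for r
  proof -
    have r: "r \<noteq> 0" using that by auto
    define F where "F x y = coeff_sf f (upd r y (upd 0 x c))" for x y
    have "F x y = F y x" for x y
      unfolding F_def using coeff_sf_upd_swap[OF r, of f y x c] by (simp add: upd_commute[OF r])
    moreover have "attach_at j f (upd r y (upd 0 a c)) = (if j \<le> a then F (a - j) y else 0)" for a y
      using r by (simp add: attach_at_def F_def lookup_update upd_commute[OF r])
    moreover have "g r i = (if i < j \<and> j - i \<le> lk c r then F (?s - i) (lk c r - (j - i)) else 0)" for i
      by (simp add: g_def F_def upd_commute[OF r])
    ultimately show ?thesis
      using transfer_sum[of F j, where s="?s" and t="lk c r"] j by (simp only:)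
  qed
  have "attach (\<lambda>i. app (lax i j) f) c =
      (if j \<le> ?s then of_nat j * (alpha - 1) * ?f else 0) +
      (\<Sum>i=1..?s. if i < j then coeff_sf (power_sum (j - i) * f) (upd 0 (?s - i) c) else 0) +
      (if j \<le> ?s then alpha * of_nat (?s - j) * ?f else 0)"
    unfolding attach_def lax sum.distrib diag star ..
  also have "(\<Sum>i=1..?s. if i < j then coeff_sf (power_sum (j - i) * f) (upd 0 (?s - i) c) else 0) =
      (\<Sum>i=1..?s. (if i < j \<and> j \<le> ?s then ?f else 0) + (\<Sum>r\<in>?B. g r i))"
    by (rule sum.cong[OF refl mult])
  also have "\<dots> = (if j \<le> ?s then of_nat (j - 1) * ?f else 0) + (\<Sum>r\<in>?B. \<Sum>i=1..?s. g r i)"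
    unfolding sum.distrib own by (subst sum.swap) (rule refl)
  also have "(\<Sum>r\<in>?B. \<Sum>i=1..?s. g r i) = (\<Sum>r\<in>?B.
      (\<Sum>a=Suc ?s..?s + lk c r. attach_at j f (upd r (?s + lk c r - a) (upd 0 a c))) -
      (\<Sum>a=1..lk c r. attach_at j f (upd r (?s + lk c r - a) (upd 0 a c))))"
    by (rule sum.cong[OF refl transfer])
  also have "(if j \<le> ?s then of_nat j * (alpha - 1) * ?f else 0) +
      ((if j \<le> ?s then of_nat (j - 1) * ?f else 0) + (\<Sum>r\<in>?B.
        (\<Sum>a=Suc ?s..?s + lk c r. attach_at j f (upd r (?s + lk c r - a) (upd 0 a c))) -
        (\<Sum>a=1..lk c r. attach_at j f (upd r (?s + lk c r - a) (upd 0 a c))))) +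
      (if j \<le> ?s then alpha * of_nat (?s - j) * ?f else 0) = dunkl (attach_at j f) c"
  proof (cases "j \<le> ?s")
    case True
    have eq: "of_nat j * (alpha - 1) * ?f + of_nat (j - 1) * ?f + alpha * of_nat (?s - j) * ?f =
        (alpha * of_nat ?s - 1) * ?f"
      unfolding of_nat_diff[OF True] of_nat_diff[OF j] of_nat_1 by (rule lax_scalar_identity)
    show ?thesis
      unfolding dunkl_def attach_at_def[of j f c] by (simp only: True if_True eq[symmetric] add_ac)
  next
    case False
    then show ?thesis by (simp add: dunkl_def attach_at_def[of j f c])
  qed
  finally show ?thesis .
qed

lemma attach_at_sum:
  assumes "\<And>j. j > N \<Longrightarrow> v j = 0"
  shows "(\<Sum>j=1..N. attach_at j (v j) c) = attach v c"
proof -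
  have "(\<Sum>j=1..N. attach_at j (v j) c) = (\<Sum>j\<in>{j \<in> {1..N}. j \<le> lk c 0}. coeff_sf (v j) (upd 0 (lk c 0 - j) c))"
    unfolding attach_at_def by (rule sum.inter_filter[symmetric]) simp
  also have "\<dots> = attach v c"
    unfolding attach_def
  proof (rule sum.mono_neutral_left)
    show "\<forall>j\<in>{1..lk c 0} - {j \<in> {1..N}. j \<le> lk c 0}. coeff_sf (v j) (upd 0 (lk c 0 - j) c) = 0"
    proof
      fix j assume "j \<in> {1..lk c 0} - {j \<in> {1..N}. j \<le> lk c 0}"
      then have "j > N" by auto
      then show "coeff_sf (v j) (upd 0 (lk c 0 - j) c) = 0" by (simp add: assms)
    qed
  qed auto
  finally show ?thesis .
qed

lemma attach_lax_col_Suc: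
  "attach (\<lambda>i. app (lax_col (Suc k) i) f) = dunkl (attach (\<lambda>i. app (lax_col k i) f))"
proof
  fix c
  obtain d where d: "degle d f" using degle_ex by blast
  define N where "N = nat d"
  have N: "d \<le> int N" by (simp add: N_def)
  let ?v = "\<lambda>j. app (lax_col k j) f"
  have v: "?v j = 0" if "j > N" for j
    by (rule opdeg_vanish[OF opdeg_lax_col d]) (use that N in simp)
  have "attach (\<lambda>i. app (lax_col (Suc k) i) f) c = (\<Sum>j=1..N. attach (\<lambda>i. app (lax i j) (?v j)) c)"
    unfolding app_lax_col_Suc[OF d N] attach_def coeff_sf_sum by (rule sum.swap)
  also have "\<dots> = (\<Sum>j=1..N. dunkl (attach_at j (?v j)) c)"
    by (intro sum.cong refl attach_lax_single) simp
  also have "\<dots> = dunkl (\<lambda>c. \<Sum>j=1..N. attach_at j (?v j) c) c"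
    by (rule dunkl_sum[symmetric])
  also have "(\<lambda>c. \<Sum>j=1..N. attach_at j (?v j) c) = attach ?v"
    using attach_at_sum[of N ?v] v by blast
  finally show "attach (\<lambda>i. app (lax_col (Suc k) i) f) c = dunkl (attach ?v) c" .
qed

section \<open>The row of power sums as symmetrization\<close>

definition swap_var :: "nat \<Rightarrow> mono \<Rightarrow> mono" where
  "swap_var i c = Poly_Mapping.map_key (Transposition.transpose 0 i) c"

lemma lookup_swap_var: "lk (swap_var i c) x = lk c (Transposition.transpose 0 i x)"
  by (simp add: swap_var_def lookup_map_key_inj)

lemma exponents_swap_var [simp]: "exponents (swap_var i c) = exponents c"
  by (simp add: swap_var_def exponents_perm)

text \<open>Since \<open>p_j\<close> is the sum of all \<open>x_i^j\<close>, multiplying the column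
  by the row of power sums substitutes each variable \<open>x_i\<close> in turn for
  \<open>x_1\<close> and adds up. As \<open>j \<ge> 1\<close>, only variables occurring in
  \<open>c\<close> contribute.\<close>

lemma coeff_hamiltonian:
  "coeff_sf (app (hamiltonian k) f) c =
    (\<Sum>i\<in>Poly_Mapping.keys c. attach (\<lambda>j. app (lax_col k j) f) (swap_var i c))"
proof -
  obtain d where d: "degle d f" using degle_ex by blast
  define N where "N = nat d"
  have N: "d \<le> int N" by (simp add: N_def)
  let ?v = "\<lambda>j. app (lax_col k j) f"
  have v: "?v j = 0" if "j > N" for j
    by (rule opdeg_vanish[OF opdeg_lax_col d]) (use that N in simp)
  have swap: "swap_var i (upd i x c) = upd 0 x (swap_var i c)" for i x
    by (rule mono_eqI) (auto simp: lookup_swap_var lookup_update Transposition.transpose_def)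
  have "coeff_sf (power_sum j * ?v j) c = (\<Sum>i\<in>Poly_Mapping.keys c. attach_at j (?v j) (swap_var i c))"
    if "j \<in> {1..N}" for j
  proof -
    have j: "j \<ge> 1" using that by simp
    have "coeff_sf (?v j) (upd i x c) = coeff_sf (?v j) (upd 0 x (swap_var i c))" for i x
      by (rule coeff_sf_cong) (simp flip: swap)
    then have "coeff_sf (power_sum j * ?v j) c = (\<Sum>i\<in>{i \<in> Poly_Mapping.keys c. j \<le> lk c i}.
        coeff_sf (?v j) (upd 0 (lk c i - j) (swap_var i c)))"
      by (simp add: coeff_power_sum_mult[OF j])
    also have "\<dots> = (\<Sum>i\<in>Poly_Mapping.keys c. attach_at j (?v j) (swap_var i c))"
      by (subst sum.inter_filter) (simp_all add: attach_at_def lookup_swap_var cong: if_cong)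
    finally show ?thesis .
  qed
  then have "coeff_sf (app (hamiltonian k) f) c =
      (\<Sum>j=1..N. \<Sum>i\<in>Poly_Mapping.keys c. attach_at j (?v j) (swap_var i c))"
    unfolding app_hamiltonian[OF d N] coeff_sf_sum by (intro sum.cong refl)
  also have "\<dots> = (\<Sum>i\<in>Poly_Mapping.keys c. attach ?v (swap_var i c))"
    by (subst sum.swap) (intro sum.cong refl attach_at_sum v)
  finally show ?thesis .
qed

section \<open>Triangularity\<close>

text \<open>
  Multisets of exponents carry the multiset order, a linear order in which moving two exponents
  towards each other makes the multiset smaller.
\<close>

definition bounded_by :: "nat multiset \<Rightarrow> (mono \<Rightarrow> 'a::zero) \<Rightarrow> bool" where
  "bounded_by M G \<longleftrightarrow> (\<forall>c. G c \<noteq> 0 \<longrightarrow> exponents c \<le> M)"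

lemma bounded_byD: "bounded_by M G \<Longrightarrow> \<not> exponents c \<le> M \<Longrightarrow> G c = 0"
  unfolding bounded_by_def by blast

lemma exponents_upd_upd:
  assumes "i \<noteq> 0"
  shows "exponents (upd i y (upd 0 x c)) =
    (if y = 0 then {#} else {#y#}) + ((if x = 0 then {#} else {#x#}) + exponents (upd i 0 (upd 0 0 c)))"
  using exponents_upd[of i y "upd 0 x c"] exponents_upd[of 0 x "upd i 0 c"]
    upd_commute[of i 0 0 x c] upd_commute[of i 0 0 0 c] assms by simp

text \<open>In the multiset order the pair with the larger maximum is larger, whatever its other
  entry is. Adding the untouched exponents \<open>?R\<close> preserves the strict
  inequality.\<close>

lemma exponents_less_transfer:
  assumes i: "i \<noteq> 0" and less: "max (lk c 0) (lk c i) < max a y"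
  shows "exponents c < exponents (upd i y (upd 0 a c))"
proof -
  let ?R = "exponents (upd i 0 (upd 0 0 c))"
  let ?nz = "\<lambda>x. if x = 0 then {#} else {#x#} :: nat multiset"
  have "max a y \<noteq> 0" using less by linarith
  then have "max a y \<in># ?nz y + ?nz a"
    by (auto simp: max_def)
  moreover have "\<forall>x. x \<in># ?nz (lk c i) + ?nz (lk c 0) \<longrightarrow> x < max a y"
    using less by auto
  ultimately have "?nz (lk c i) + ?nz (lk c 0) < ?nz y + ?nz a"
    by (intro ex_gt_imp_less_multiset) blast
  then have "?nz (lk c i) + ?nz (lk c 0) + ?R < ?nz y + ?nz a + ?R"
    by (rule add_strict_right_mono)
  moreover have "exponents c = ?nz (lk c i) + ?nz (lk c 0) + ?R"
    using exponents_upd_upd[OF i, of "lk c i" "lk c 0" c] by (simp only: upd_same add.assoc)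
  moreover have "exponents (upd i y (upd 0 a c)) = ?nz y + ?nz a + ?R"
    using exponents_upd_upd[OF i, of y a c] by (simp only: add.assoc)
  ultimately show ?thesis by simp
qed

lemma exponents_min_max:
  assumes i: "i \<noteq> 0"
  shows "exponents (upd i (max (lk c 0) (lk c i)) (upd 0 (min (lk c 0) (lk c i)) c)) = exponents c"
proof (cases "lk c 0 \<le> lk c i")
  case True
  then show ?thesis by (simp add: max_absorb2 min_absorb1)
next
  case False
  then have "exponents (upd i (max (lk c 0) (lk c i)) (upd 0 (min (lk c 0) (lk c i)) c)) =
      exponents (upd i (lk c 0) (upd 0 (lk c i) c))"
    by (simp add: max_absorb1 min_absorb2)
  also have "\<dots> = exponents (upd i (lk c i) (upd 0 (lk c 0) c))"
    unfolding exponents_upd_upd[OF i, of "lk c 0" "lk c i" c] exponents_upd_upd[OF i, of "lk c i" "lk c 0" c]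
    by (rule add.left_commute)
  finally show ?thesis by simp
qed

text \<open>The terms strictly between the two exponents would lead to smaller monomials and spoil
  triangularity. If \<open>s \<le> t\<close>, they occur in both sums and cancel; if
  \<open>s > t\<close>, they do not occur.\<close>

lemma sum_min_max:
  fixes h :: "nat \<Rightarrow> 'a::ab_group_add"
  shows "(\<Sum>a=Suc s..s + t. h a) - (\<Sum>a=1..t. h a) =
    (\<Sum>a=Suc (max s t)..s + t. h a) - (\<Sum>a=1..min s t. h a)"
proof (cases "s \<le> t")
  case True
  have "{Suc s..s + t} = {Suc s..t} \<union> {Suc t..s + t}" "{1..t} = {1..s} \<union> {Suc s..t}"
    using True by auto
  then have "(\<Sum>a=Suc s..s + t. h a) = (\<Sum>a=Suc s..t. h a) + (\<Sum>a=Suc t..s + t. h a)"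
    "(\<Sum>a=1..t. h a) = (\<Sum>a=1..s. h a) + (\<Sum>a=Suc s..t. h a)"
    by (simp_all only:) (rule sum.union_disjoint; auto)+
  with True show ?thesis by (simp add: max_absorb2 min_absorb1)
next
  case False
  then show ?thesis by (simp add: max_absorb1 min_absorb2)
qed

lemma dunkl_min_max:
  "dunkl G c = (alpha * of_nat (lk c 0) - 1) * G c +
     (\<Sum>i\<in>Poly_Mapping.keys c - {0}.
        (\<Sum>a=Suc (max (lk c 0) (lk c i))..lk c 0 + lk c i. G (upd i (lk c 0 + lk c i - a) (upd 0 a c))) -
        (\<Sum>a=1..min (lk c 0) (lk c i). G (upd i (lk c 0 + lk c i - a) (upd 0 a c))))"
  unfolding dunkl_def sum_min_max ..

text \<open>The remaining terms evaluate \<open>G\<close> where the two exponents are exchanged or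
  farther apart. Such monomials are at least as large as \<open>c\<close>, so \<open>G\<close>
  vanishes there whenever \<open>c\<close> is not below the bound.\<close>

lemma bounded_by_dunkl:
  assumes G: "bounded_by M G"
  shows "bounded_by M (dunkl G)"
  unfolding bounded_by_def
proof (intro allI impI, rule ccontr)
  fix c assume nz: "dunkl G c \<noteq> 0" and c: "\<not> exponents c \<le> M"
  have zero: "G (upd i (lk c 0 + lk c i - a) (upd 0 a c)) = 0"
    if i: "i \<noteq> 0" and a: "a > max (lk c 0) (lk c i) \<or> a \<le> min (lk c 0) (lk c i)" for i a
  proof (rule bounded_byD[OF G])
    let ?y = "lk c 0 + lk c i - a"
    have "exponents c \<le> exponents (upd i ?y (upd 0 a c))"
    proof (cases "a = min (lk c 0) (lk c i)")
      case True
      then have "?y = max (lk c 0) (lk c i)" by auto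
      with True exponents_min_max[OF i, of c] show ?thesis by simp
    next
      case False
      with a have "max (lk c 0) (lk c i) < max a ?y" by auto
      with exponents_less_transfer[OF i] show ?thesis by (meson less_imp_le)
    qed
    with c show "\<not> exponents (upd i ?y (upd 0 a c)) \<le> M" by (meson order_trans)
  qed
  have "(\<Sum>a=Suc (max (lk c 0) (lk c i))..lk c 0 + lk c i. G (upd i (lk c 0 + lk c i - a) (upd 0 a c))) = 0"
    "(\<Sum>a=1..min (lk c 0) (lk c i). G (upd i (lk c 0 + lk c i - a) (upd 0 a c))) = 0"
    if "i \<in> Poly_Mapping.keys c - {0}" for i
    using that by (intro sum.neutral ballI zero; simp; linarith)+
  then have "dunkl G c = 0"
    unfolding dunkl_min_max bounded_byD[OF G c] by simp
  with nz show False ..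
qed

lemma dunkl_top:
  assumes G: "bounded_by (exponents c) G" and c0: "lk c 0 \<ge> 1"
  shows "dunkl G c = (alpha * of_nat (lk c 0) - 1) * G c -
    (\<Sum>i\<in>Poly_Mapping.keys c - {0}.
      G (upd i (max (lk c 0) (lk c i)) (upd 0 (min (lk c 0) (lk c i)) c)))"
proof -
  have zero: "G (upd i (lk c 0 + lk c i - a) (upd 0 a c)) = 0"
    if i: "i \<noteq> 0" and a: "a > max (lk c 0) (lk c i) \<or> a < min (lk c 0) (lk c i)" for i a
  proof (rule bounded_byD[OF G])
    from a have "max (lk c 0) (lk c i) < max a (lk c 0 + lk c i - a)" by auto
    from exponents_less_transfer[OF i this]
    show "\<not> exponents (upd i (lk c 0 + lk c i - a) (upd 0 a c)) \<le> exponents c" by simp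
  qed
  have "(\<Sum>a=Suc (max (lk c 0) (lk c i))..lk c 0 + lk c i. G (upd i (lk c 0 + lk c i - a) (upd 0 a c))) -
        (\<Sum>a=1..min (lk c 0) (lk c i). G (upd i (lk c 0 + lk c i - a) (upd 0 a c))) =
      - G (upd i (max (lk c 0) (lk c i)) (upd 0 (min (lk c 0) (lk c i)) c))"
    if "i \<in> Poly_Mapping.keys c - {0}" for i
  proof -
    let ?m = "min (lk c 0) (lk c i)"
    have i: "i \<noteq> 0" and "lk c i \<noteq> 0" using that by (auto simp: in_keys_iff)
    \<comment> \<open>Both exponents are positive, so the exchange term does occur in the sum, which
      starts at 1.\<close>
    then have m: "?m \<in> {1..?m}" using c0 by auto
    have "(\<Sum>a=1..?m. G (upd i (lk c 0 + lk c i - a) (upd 0 a c))) =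
        G (upd i (lk c 0 + lk c i - ?m) (upd 0 ?m c)) +
        (\<Sum>a\<in>{1..?m} - {?m}. G (upd i (lk c 0 + lk c i - a) (upd 0 a c)))"
      by (rule sum.remove[OF _ m]) simp
    also have "(\<Sum>a\<in>{1..?m} - {?m}. G (upd i (lk c 0 + lk c i - a) (upd 0 a c))) = 0"
      by (intro sum.neutral ballI zero[OF i]) auto
    also have "lk c 0 + lk c i - ?m = max (lk c 0) (lk c i)" by auto
    finally have 1: "(\<Sum>a=1..?m. G (upd i (lk c 0 + lk c i - a) (upd 0 a c))) =
        G (upd i (max (lk c 0) (lk c i)) (upd 0 ?m c))" by simp
    have "(\<Sum>a=Suc (max (lk c 0) (lk c i))..lk c 0 + lk c i. G (upd i (lk c 0 + lk c i - a) (upd 0 a c))) = 0"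
      by (intro sum.neutral ballI zero[OF i]) auto
    with 1 show ?thesis by simp
  qed
  then show ?thesis
    unfolding dunkl_min_max by (simp add: sum_negf)
qed

text \<open>The factor picked up by a largest monomial, with exponent \<open>a\<close> on
  \<open>x_1\<close>, after \<open>k\<close> Dunkl steps. \<open>M\<close> holds all its exponents,
  and \<open>min a b\<close> is the exponent left on \<open>x_1\<close> by an exchange with
  \<open>b\<close>.\<close>

primrec lax_weight :: "nat multiset \<Rightarrow> nat \<Rightarrow> nat \<Rightarrow> ratfun" where
  "lax_weight M 0 = (\<lambda>a. alpha * of_nat a)"
| "lax_weight M (Suc k) = (\<lambda>a. alpha * of_nat a * lax_weight M k a - (\<Sum>b\<in>#M. lax_weight M k (min a b)))"

lemma sum_mset_exponents: "(\<Sum>b\<in>#exponents c. g b) = (\<Sum>i\<in>Poly_Mapping.keys c. g (lk c i))"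
  by (simp add: exponents_def sum_unfold_sum_mset multiset.map_comp comp_def)

lemma attach_lax_col_0:
  "attach (\<lambda>i. app (lax_col 0 i) f) = (\<lambda>c. alpha * of_nat (lk c 0) * coeff_sf f c)"
  by (intro ext) (simp add: attach_p_star)

lemma bounded_by_attach:
  assumes "bounded_by M (coeff_sf f)"
  shows "bounded_by M (attach (\<lambda>i. app (lax_col k i) f))"
proof (induction k)
  case 0
  show ?case
    using assms unfolding attach_lax_col_0 bounded_by_def by auto
next
  case (Suc k)
  then show ?case unfolding attach_lax_col_Suc by (rule bounded_by_dunkl)
qed

lemma dunkl_step_identity: "(al - 1) * (x * w) - x * s = x * (al * w - (w + s))" for x :: "'a::comm_ring_1"
  by (simp add: algebra_simps)

lemma attach_top:
  assumes f: "bounded_by M (coeff_sf f)"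
  shows "exponents c = M \<Longrightarrow> lk c 0 \<ge> 1 \<Longrightarrow>
    attach (\<lambda>i. app (lax_col k i) f) c = coeff_sf f c * lax_weight M k (lk c 0)"
proof (induction k arbitrary: c)
  case 0
  show ?case unfolding attach_lax_col_0 by simp
next
  case (Suc k)
  let ?G = "attach (\<lambda>i. app (lax_col k i) f)" and ?B = "Poly_Mapping.keys c - {0}"
  let ?w = "lax_weight M k"
  have G: "bounded_by (exponents c) ?G"
    using bounded_by_attach[OF f] Suc.prems(1) by simp
  have "?G (upd i (max (lk c 0) (lk c i)) (upd 0 (min (lk c 0) (lk c i)) c)) =
      coeff_sf f c * ?w (min (lk c 0) (lk c i))" if "i \<in> ?B" for i
  proof -
    let ?c = "upd i (max (lk c 0) (lk c i)) (upd 0 (min (lk c 0) (lk c i)) c)"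
    have i: "i \<noteq> 0" and "lk c i \<noteq> 0" using that by (auto simp: in_keys_iff)
    then have "lk ?c 0 = min (lk c 0) (lk c i)" "lk ?c 0 \<ge> 1"
      using Suc.prems(2) by (auto simp: lookup_update)
    moreover have e: "exponents ?c = exponents c" by (rule exponents_min_max[OF i])
    ultimately show ?thesis
      using Suc.IH[of ?c] Suc.prems(1) coeff_sf_cong[OF e, of f] by simp
  qed
  then have "attach (\<lambda>i. app (lax_col (Suc k) i) f) c =
      (alpha * of_nat (lk c 0) - 1) * (coeff_sf f c * ?w (lk c 0)) -
      (\<Sum>i\<in>?B. coeff_sf f c * ?w (min (lk c 0) (lk c i)))"
    unfolding attach_lax_col_Suc dunkl_top[OF G Suc.prems(2)] Suc.IH[OF Suc.prems] by simp
  also have "\<dots> = coeff_sf f c * (alpha * of_nat (lk c 0) * ?w (lk c 0) -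
      (?w (lk c 0) + (\<Sum>i\<in>?B. ?w (min (lk c 0) (lk c i)))))"
    unfolding sum_distrib_left[symmetric] by (rule dunkl_step_identity)
  \<comment> \<open>The constant -1 of the Dunkl operator has become the summand of
    \<open>x_1\<close> itself, because \<open>min a a = a\<close>.\<close>
  also have "?w (lk c 0) + (\<Sum>i\<in>?B. ?w (min (lk c 0) (lk c i))) =
      (\<Sum>i\<in>Poly_Mapping.keys c. ?w (min (lk c 0) (lk c i)))"
    using Suc.prems(2) by (subst sum.remove[of "Poly_Mapping.keys c" 0]) (auto simp: in_keys_iff)
  also have "\<dots> = (\<Sum>b\<in>#M. ?w (min (lk c 0) b))"
    using sum_mset_exponents[of "\<lambda>b. ?w (min (lk c 0) b)" c] Suc.prems(1) by simp
  finally show ?case by simp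
qed

lemma bounded_by_hamiltonian:
  assumes f: "bounded_by M (coeff_sf f)"
  shows "bounded_by M (coeff_sf (app (hamiltonian k) f))"
  unfolding bounded_by_def
proof (intro allI impI, rule ccontr)
  fix c assume "coeff_sf (app (hamiltonian k) f) c \<noteq> 0" and c: "\<not> exponents c \<le> M"
  moreover have "attach (\<lambda>j. app (lax_col k j) f) (swap_var i c) = 0" for i
    by (rule bounded_byD[OF bounded_by_attach[OF f]]) (simp add: c)
  ultimately show False by (simp add: coeff_hamiltonian)
qed

lemma hamiltonian_top:
  assumes f: "bounded_by (exponents c) (coeff_sf f)"
  shows "coeff_sf (app (hamiltonian k) f) c =
    (\<Sum>b\<in>#exponents c. lax_weight (exponents c) k b) * coeff_sf f c"
proof -
  have "attach (\<lambda>j. app (lax_col k j) f) (swap_var i c) =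
      coeff_sf f c * lax_weight (exponents c) k (lk c i)" if "i \<in> Poly_Mapping.keys c" for i
    using attach_top[OF f, of "swap_var i c" k] that coeff_sf_cong[of "swap_var i c" c f]
    by (auto simp: lookup_swap_var in_keys_iff)
  then have "coeff_sf (app (hamiltonian k) f) c =
      (\<Sum>i\<in>Poly_Mapping.keys c. coeff_sf f c * lax_weight (exponents c) k (lk c i))"
    unfolding coeff_hamiltonian by (rule sum.cong[OF refl])
  then show ?thesis
    by (simp add: sum_mset_exponents sum_distrib_left mult.commute)
qed

section \<open>Jack symmetric functions are eigenvectors\<close>

text \<open>Common first parts are removed. At the first difference the part of \<open>lam\<close>
  is the larger one and hence exceeds all remaining parts of \<open>mu\<close>.\<close>

lemma dominated_imp_less_mset:
  fixes mu lam :: "nat list"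
  assumes "sorted_wrt (\<ge>) mu" "0 \<notin> set mu" "sum_list mu = sum_list lam"
    "\<And>i. sum_list (take i mu) \<le> sum_list (take i lam)" "mu \<noteq> lam"
  shows "mset mu < mset lam"
  using assms
proof (induction mu arbitrary: lam)
  case Nil
  then show ?case by (simp add: le_multiset_empty_left)
next
  case (Cons x mu)
  obtain y lam' where lam: "lam = y # lam'"
    using Cons.prems(2,3) by (cases lam) auto
  have "x \<le> y" using Cons.prems(4)[of 1] lam by simp
  show ?case
  proof (cases "x = y")
    case True
    have "sum_list (take i mu) \<le> sum_list (take i lam')" for i
      using Cons.prems(4)[of "Suc i"] lam True by simp
    then have "mset mu < mset lam'"
      using Cons.prems lam True by (intro Cons.IH) auto
    then show ?thesis by (simp add: lam True add_mset_lt_right_lt)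
  next
    case False
    with \<open>x \<le> y\<close> have "\<forall>z. z \<in># mset (x # mu) \<longrightarrow> z < y"
      using Cons.prems(1) by auto
    then show ?thesis
      by (intro ex_gt_imp_less_multiset exI[of _ y]) (simp add: lam)
  qed
qed

lemma dominated_less:
  "is_partition mu \<Longrightarrow> dominated mu lam \<Longrightarrow> mu \<noteq> lam \<Longrightarrow> mset mu < mset lam"
  unfolding is_partition_def dominated_def by (intro dominated_imp_less_mset) auto

lemma monomial_expansion:
  fixes f :: "'a::comm_ring_1 symfun"
  assumes "degle d f"
  shows "f = (\<Sum>mu | is_partition mu \<and> int (sum_list mu) \<le> d.
    scale_sf (coeff_sf f (monomial_of mu)) (monomial_sf mu))"
proof (rule symfun_eqI)
  fix c
  let ?P = "{mu. is_partition mu \<and> int (sum_list mu) \<le> d}" and ?lam = "partition_of (exponents c)"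
  have part: "is_partition ?lam" by simp
  have "coeff_sf (\<Sum>mu\<in>?P. scale_sf (coeff_sf f (monomial_of mu)) (monomial_sf mu)) c =
      (\<Sum>mu\<in>?P. if mu = ?lam then coeff_sf f (monomial_of ?lam) else 0)"
    unfolding coeff_sf_sum
  proof (rule sum.cong[OF refl])
    fix mu assume "mu \<in> ?P"
    then have "exponents c = mset mu \<longleftrightarrow> mu = ?lam"
      using partition_of_mset[of mu] by auto
    then show "coeff_sf (scale_sf (coeff_sf f (monomial_of mu)) (monomial_sf mu)) c =
        (if mu = ?lam then coeff_sf f (monomial_of ?lam) else 0)"
      by (simp add: coeff_monomial_sf)
  qed
  also have "\<dots> = (if ?lam \<in> ?P then coeff_sf f (monomial_of ?lam) else 0)"
    by (rule sum.delta[OF finite_partitions])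
  also have "coeff_sf f (monomial_of ?lam) = coeff_sf f c"
    by (rule coeff_sf_cong) (simp add: exponents_monomial_of[OF part])
  also have "(if ?lam \<in> ?P then coeff_sf f c else 0) = coeff_sf f c"
  proof (cases "?lam \<in> ?P")
    case False
    then have "\<not> int (mono_deg c) \<le> d"
      using mono_deg_exponents_eq[of c ?lam] by simp
    then have "coeff_sf f c = 0" using assms by (auto simp: degle_def)
    then show ?thesis by simp
  qed simp
  finally show "coeff_sf f c =
      coeff_sf (\<Sum>mu\<in>?P. scale_sf (coeff_sf f (monomial_of mu)) (monomial_sf mu)) c" by simp
qed

context
  fixes J :: "nat list \<Rightarrow> ratfun symfun"
  assumes J: "jack_family J"
begin

lemma jack_orthogonal:
  "is_partition lam \<Longrightarrow> is_partition mu \<Longrightarrow> lam \<noteq> mu \<Longrightarrow> jack_form (J lam) (J mu) = 0"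
  using J unfolding jack_family_def by blast

lemma jack_triangular:
  "is_partition lam \<Longrightarrow> J lam - monomial_sf lam \<in>
    sf.span {monomial_sf mu | mu. is_partition mu \<and> dominated mu lam \<and> mu \<noteq> lam}"
  using J unfolding jack_family_def by blast

text \<open>Inverts the unitriangular expansion of \<open>J\<close> by well-founded induction along
  the multiset order.\<close>

lemma monomial_in_jack_span:
  "is_partition lam \<Longrightarrow> monomial_sf lam \<in> sf.span {J mu | mu. is_partition mu \<and> mset mu \<le> mset lam}"
proof (induction "mset lam" arbitrary: lam rule: less_induct)
  case less
  let ?S = "\<lambda>lam. {J mu | mu. is_partition mu \<and> mset mu \<le> mset lam}"
  have "{monomial_sf mu | mu. is_partition mu \<and> dominated mu lam \<and> mu \<noteq> lam} \<subseteq> sf.span (?S lam)"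
  proof clarify
    fix mu assume mu: "is_partition mu" "dominated mu lam" "mu \<noteq> lam"
    then have lt: "mset mu < mset lam" by (rule dominated_less)
    then have "?S mu \<subseteq> ?S lam" by fastforce
    with less.hyps[OF lt mu(1)] show "monomial_sf mu \<in> sf.span (?S lam)"
      using sf.span_mono by blast
  qed
  then have diff: "J lam - monomial_sf lam \<in> sf.span (?S lam)"
    using sf.span_minimal[OF _ sf.subspace_span] jack_triangular[OF less.prems] by blast
  have "J lam \<in> sf.span (?S lam)"
    using less.prems by (intro sf.span_base) auto
  from sf.span_diff[OF this diff]
  have "J lam - (J lam - monomial_sf lam) \<in> sf.span (?S lam)" .
  moreover have "J lam - (J lam - monomial_sf lam) = monomial_sf lam"
    by (simp add: diff_diff_eq2)
  ultimately show ?case by (simp only:)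
qed

text \<open>Stated for a general down-closed set because three are used: the shapes up to a given
  one, those strictly below it, and all shapes.\<close>

lemma jack_span:
  assumes down: "\<And>M N. N \<in> D \<Longrightarrow> M \<le> N \<Longrightarrow> M \<in> D"
    and f: "\<And>c. coeff_sf f c \<noteq> 0 \<Longrightarrow> exponents c \<in> D"
  shows "f \<in> sf.span {J mu | mu. is_partition mu \<and> mset mu \<in> D}"
proof -
  let ?S = "{J mu | mu. is_partition mu \<and> mset mu \<in> D}"
  obtain d where d: "degle d f" using degle_ex by blast
  have "scale_sf (coeff_sf f (monomial_of mu)) (monomial_sf mu) \<in> sf.span ?S" if mu: "is_partition mu" for mu
  proof (cases "coeff_sf f (monomial_of mu) = 0")
    case True
    then show ?thesis by (simp add: sf.span_zero)
  next
    case False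
    then have "mset mu \<in> D" using f exponents_monomial_of[OF mu] by metis
    then have "{J nu | nu. is_partition nu \<and> mset nu \<le> mset mu} \<subseteq> ?S" using down by blast
    then show ?thesis
      using monomial_in_jack_span[OF mu] sf.span_mono by (intro sf.span_scale) blast
  qed
  then show ?thesis
    by (subst monomial_expansion[OF d]) (intro sf.span_sum, simp)
qed

lemma jack_bounded:
  assumes lam: "is_partition lam"
  shows "bounded_by (mset lam) (coeff_sf (J lam))"
proof -
  let ?V = "{f :: ratfun symfun. bounded_by (mset lam) (coeff_sf f)}"
  let ?S = "{monomial_sf mu :: ratfun symfun | mu. is_partition mu \<and> dominated mu lam \<and> mu \<noteq> lam}"
  have add: "f + g \<in> ?V" if "f \<in> ?V" "g \<in> ?V" for f g
    using that unfolding bounded_by_def by auto (metis add.right_neutral)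
  have "sf.subspace ?V"
    unfolding sf.subspace_def
  proof (intro conjI ballI allI)
    show "0 \<in> ?V" by (simp add: bounded_by_def)
    show "f + g \<in> ?V" if "f \<in> ?V" "g \<in> ?V" for f g by (rule add[OF that])
    show "scale_sf r f \<in> ?V" if "f \<in> ?V" for r f
      using that unfolding bounded_by_def by auto
  qed
  moreover have "?S \<subseteq> ?V"
    using dominated_less by (auto simp: bounded_by_def coeff_monomial_sf less_imp_le split: if_splits)
  ultimately have "J lam - monomial_sf lam \<in> ?V"
    using sf.span_minimal[of ?S ?V] jack_triangular[OF lam] by blast
  moreover have "monomial_sf lam \<in> ?V"
    by (auto simp: bounded_by_def coeff_monomial_sf split: if_splits)
  ultimately have "J lam - monomial_sf lam + monomial_sf lam \<in> ?V" by (rule add)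
  then show ?thesis by simp
qed

lemma jack_form_span_zero:
  "x \<in> sf.span S \<Longrightarrow> (\<And>s. s \<in> S \<Longrightarrow> jack_form a s = 0) \<Longrightarrow> jack_form a x = 0"
  by (induction rule: sf.span_induct_alt) auto

text \<open>
  A self-adjoint operator that is triangular in the monomial basis is diagonal in any orthogonal
  basis that is triangular with respect to the monomial basis.
\<close>

lemma hamiltonian_jack:
  assumes lam: "is_partition lam"
  shows "app (hamiltonian k) (J lam) =
    scale_sf (\<Sum>b\<in>#mset lam. lax_weight (mset lam) k b) (J lam)"
proof -
  let ?H = "hamiltonian k" and ?e = "\<Sum>b\<in>#mset lam. lax_weight (mset lam) k b"
  define W where "W = app ?H (J lam) - scale_sf ?e (J lam)"
  note bJ = jack_bounded[OF lam]
  have W: "exponents c < mset lam" if "coeff_sf W c \<noteq> 0" for c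
  proof -
    have "exponents c \<le> mset lam"
      using that bounded_byD[OF bJ, of c] bounded_byD[OF bounded_by_hamiltonian[OF bJ], of c k]
      unfolding W_def by fastforce
    moreover have "exponents c \<noteq> mset lam"
    proof
      assume "exponents c = mset lam"
      then have "coeff_sf W c = 0"
        using hamiltonian_top[of c "J lam" k] bJ by (simp add: W_def)
      with that show False ..
    qed
    ultimately show ?thesis by simp
  qed
  \<comment> \<open>For \<open>nu\<close> below \<open>lam\<close>, self-adjointness moves the
    operator to \<open>J nu\<close>, whose image is spanned by functions orthogonal to
    \<open>J lam\<close>. For any other \<open>nu\<close>, the error \<open>W\<close> is itself
    spanned by functions orthogonal to \<open>J nu\<close>.\<close>
  have orth: "jack_form W (J nu) = 0" if nu: "is_partition nu" for nu
  proof (cases "mset nu < mset lam")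
    case True
    then have neq: "lam \<noteq> nu" by auto
    have "app ?H (J nu) \<in> sf.span {J mu | mu. is_partition mu \<and> mset mu \<in> {..mset nu}}"
      using bounded_by_hamiltonian[OF jack_bounded[OF nu], of k]
      by (intro jack_span) (auto simp: bounded_by_def)
    then have "jack_form (J lam) (app ?H (J nu)) = 0"
      by (rule jack_form_span_zero) (use True lam in \<open>auto intro!: jack_orthogonal\<close>)
    then show ?thesis
      by (simp add: W_def jack_form_diff_left hamiltonian_selfadjoint jack_orthogonal[OF lam nu neq])
  next
    case False
    have "W \<in> sf.span {J mu | mu. is_partition mu \<and> mset mu \<in> {..<mset lam}}"
      using W by (intro jack_span) auto
    then have "jack_form (J nu) W = 0"
      by (rule jack_form_span_zero) (use False nu in \<open>auto intro!: jack_orthogonal\<close>)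
    then show ?thesis by (simp add: jack_form_commute[of W])
  qed
  have "jack_form W g = 0" for g
  proof -
    have "g \<in> sf.span {J mu | mu. is_partition mu \<and> mset mu \<in> UNIV}"
      by (rule jack_span) auto
    then show ?thesis by (rule jack_form_span_zero) (use orth in auto)
  qed
  then have "W = 0" by (rule jack_form_nondegenerate)
  then show ?thesis by (simp add: W_def)
qed

lemma symop_eqI_jack:
  assumes "\<And>lam. is_partition lam \<Longrightarrow> app S (J lam) = app T (J lam)"
  shows "S = T"
proof (rule symop_eqI)
  fix f
  have "f \<in> sf.span {J mu | mu. is_partition mu \<and> mset mu \<in> UNIV}"
    by (rule jack_span) auto
  then show "app S f = app T f"
    by (induction rule: sf.span_induct_alt) (auto simp: app_add app_scale assms)
qed

end

section \<open>Simultaneous eigenvectors of power series of operators\<close>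

text \<open>Passing to eigenvalues respects every operation in \<open>A(u) / A(u + 1)\<close>. This
  replaces series over the non-commutative ring of operators by series over a field.\<close>

definition eigen :: "'a::comm_ring_1 symfun \<Rightarrow> 'a symop fps \<Rightarrow> 'a fps \<Rightarrow> bool" where
  "eigen v F e \<longleftrightarrow> (\<forall>n. app (fps_nth F n) v = scale_sf (fps_nth e n) v)"

lemma eigenD: "eigen v F e \<Longrightarrow> app (fps_nth F n) v = scale_sf (fps_nth e n) v"
  by (simp add: eigen_def)

lemma eigen_one: "eigen v 1 1"
  by (simp add: eigen_def zero_symop.rep_eq one_symop.rep_eq)

lemma eigen_X: "eigen v fps_X fps_X"
  by (simp add: eigen_def fps_X_def zero_symop.rep_eq one_symop.rep_eq)

lemma eigen_add: "eigen v F e \<Longrightarrow> eigen v G e' \<Longrightarrow> eigen v (F + G) (e + e')"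
  by (simp add: eigen_def plus_symop.rep_eq sf.scale_left_distrib)

lemma eigen_mult:
  assumes "eigen v F e" "eigen v G e'"
  shows "eigen v (F * G) (e * e')"
  using assms
  by (simp add: eigen_def fps_mult_nth app_op_sum times_symop.rep_eq app_scale sf.scale_sum_left mult.commute)

lemma eigen_power: "eigen v F e \<Longrightarrow> eigen v (F ^ n) (e ^ n)"
  by (induction n) (simp_all add: eigen_one eigen_mult)

lemma eigen_compose:
  assumes "eigen v F e" "eigen v G e'"
  shows "eigen v (F oo G) (e oo e')"
  using assms(1) eigen_power[OF assms(2)]
  by (simp add: eigen_def fps_compose_def app_op_sum times_symop.rep_eq app_scale sf.scale_sum_left mult.commute)

text \<open>Both inverses come from the same recursion on coefficients, started with the value
  1.\<close>

lemma eigen_right_inverse: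
  assumes "eigen v F e"
  shows "eigen v (fps_right_inverse F 1) (fps_right_inverse e 1)"
proof -
  have "app (fps_right_inverse_constructor F 1 n) v = scale_sf (fps_right_inverse_constructor e 1 n) v" for n
  proof (induction n rule: less_induct)
    case (less n)
    show ?case
    proof (cases n)
      case 0
      then show ?thesis by (simp add: one_symop.rep_eq)
    next
      case (Suc m)
      have "app (fps_nth F i * fps_right_inverse_constructor F 1 (n - i)) v =
          scale_sf (fps_nth e i * fps_right_inverse_constructor e 1 (n - i)) v" if "i \<in> {1..n}" for i
        using less.IH[of "n - i"] eigenD[OF assms, of i] that
        by (simp add: times_symop.rep_eq app_scale mult.commute)
      then have "(\<Sum>i=1..n. app (fps_nth F i * fps_right_inverse_constructor F 1 (n - i)) v) =
          (\<Sum>i=1..n. scale_sf (fps_nth e i * fps_right_inverse_constructor e 1 (n - i)) v)"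
        by (rule sum.cong[OF refl])
      then show ?thesis
        unfolding Suc fps_right_inverse_constructor.simps
        by (simp only: mult_minus1 uminus_symop.rep_eq app_op_sum sf.scale_sum_left[symmetric] sf.scale_minus_left)
    qed
  qed
  then show ?thesis by (simp add: eigen_def)
qed

lemma eigen_shift_u: "eigen v A a \<Longrightarrow> eigen v (shift_u A) (shift_u a)"
  unfolding shift_u_def
  by (intro eigen_compose eigen_mult eigen_X eigen_right_inverse eigen_add eigen_one)

section \<open>The eigenvalues\<close>

text \<open>The factor \<open>fps_X\<close> matches the leading term \<open>u^-1\<close> of the
  resolvent, so that the sum over all parts is the eigenvalue of \<open>I(u)\<close>.\<close>

definition weight_series :: "nat multiset \<Rightarrow> nat \<Rightarrow> ratfun fps" where
  "weight_series M a = fps_X * Abs_fps (\<lambda>k. lax_weight M k a)"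

lemma fps_nth_sum_mset: "fps_nth (\<Sum>b\<in>#M. f b) n = (\<Sum>b\<in>#M. fps_nth (f b) n)"
  by (induction M) simp_all

lemma weight_series_eq:
  "weight_series M a = fps_X * fps_const (alpha * of_nat a) +
     fps_X * (fps_const (alpha * of_nat a) * weight_series M a - (\<Sum>b\<in>#M. weight_series M (min a b)))"
proof -
  have "Abs_fps (\<lambda>k. lax_weight M k a) = fps_const (alpha * of_nat a) +
      (fps_const (alpha * of_nat a) * weight_series M a - (\<Sum>b\<in>#M. weight_series M (min a b)))"
  proof (rule fps_ext)
    fix n
    show "fps_nth (Abs_fps (\<lambda>k. lax_weight M k a)) n = fps_nth (fps_const (alpha * of_nat a) +
        (fps_const (alpha * of_nat a) * weight_series M a - (\<Sum>b\<in>#M. weight_series M (min a b)))) n"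
      by (cases n) (simp_all add: weight_series_def fps_nth_sum_mset)
  qed
  then show ?thesis
    by (subst weight_series_def) (simp only: distrib_left)
qed

text \<open>Here \<open>g\<close> is the series of the \<open>n\<close>-th part, \<open>T\<close>
  the sum of the series of all later parts, \<open>a\<close> is \<alpha> times the part, and
  \<open>X\<close> is \<open>u^-1\<close>. The hypothesis determines \<open>g\<close> from
  \<open>T\<close>; substituting it turns the left bracket into the same expression for the next
  part.\<close>

lemma telescope_step:
  fixes g T n a X :: "'a::comm_ring_1"
  assumes "g = X * a + X * (a * g - (n * g + T))"
  shows "(1 + (n - a) * X) * (1 - X * (g + T) + (n - 1) * X) = (1 + (n - 1 - a) * X) * (1 - X * T + n * X)"
proof -
  have "g - (X * a + X * (a * g - (n * g + T))) = 0" using assms by simp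
  moreover have "(1 + (n - a) * X) * (1 - X * (g + T) + (n - 1) * X) - (1 + (n - 1 - a) * X) * (1 - X * T + n * X) =
      - X * (g - (X * a + X * (a * g - (n * g + T))))"
    by (simp add: algebra_simps)
  ultimately show ?thesis by simp
qed

lemma sum_mset_mset: "(\<Sum>b\<in>#mset xs. g b) = (\<Sum>j<length xs. g (xs ! j))"
proof -
  have "(\<Sum>b\<in>#mset xs. g b) = sum_list (map g xs)"
    by (metis mset_map sum_mset_sum_list)
  then show ?thesis
    by (simp add: sum_list_sum_nth atLeast0LessThan)
qed

text \<open>In a decreasing list the minimum of the parts at positions \<open>i\<close> and
  \<open>j\<close> is the one at \<open>i\<close> for \<open>j \<le> i\<close> and the one at
  \<open>j\<close> otherwise. So the recursion at position \<open>i\<close> contains its own series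
  \<open>Suc i\<close> times and each later series once. The quantities \<open>V i\<close> then
  telescope from \<open>1 - fps_X * E\<close> to the elementary end value
  \<open>V ?l\<close>.\<close>

lemma eigenvalue_product:
  assumes lam: "is_partition lam"
  defines "E \<equiv> \<Sum>b\<in>#mset lam. weight_series (mset lam) b"
  shows "(\<Prod>j<length lam. 1 + fps_const (of_nat (Suc j) - alpha * of_nat (lam ! j)) * fps_X) * (1 - fps_X * E) =
    (\<Prod>j<length lam. 1 + fps_const (of_nat j - alpha * of_nat (lam ! j)) * fps_X) *
      (1 + of_nat (length lam) * fps_X)"
proof -
  let ?l = "length lam" and ?G = "\<lambda>j. weight_series (mset lam) (lam ! j)"
  let ?a = "\<lambda>j. fps_const (alpha * of_nat (lam ! j))"
  define T where "T i = (\<Sum>j=i..<?l. ?G j)" for i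
  define V where "V i = 1 - fps_X * T i + of_nat i * fps_X" for i
  have mono: "lam ! j \<le> lam ! i" if "i \<le> j" "j < ?l" for i j
    using lam that by (cases "i = j") (auto simp: is_partition_def sorted_wrt_iff_nth_less)
  have step: "(1 + (of_nat (Suc i) - ?a i) * fps_X) * V i = (1 + (of_nat i - ?a i) * fps_X) * V (Suc i)"
    if i: "i < ?l" for i
  proof -
    have T: "T i = ?G i + T (Suc i)"
      unfolding T_def using i by (simp add: sum.atLeast_Suc_lessThan)
    have "(\<Sum>b\<in>#mset lam. weight_series (mset lam) (min (lam ! i) b)) =
        (\<Sum>j<?l. weight_series (mset lam) (min (lam ! i) (lam ! j)))"
      by (rule sum_mset_mset)
    also have "{..<?l} = {..<Suc i} \<union> {Suc i..<?l}" using i by auto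
    also have "(\<Sum>j\<in>\<dots>. weight_series (mset lam) (min (lam ! i) (lam ! j))) =
        (\<Sum>j<Suc i. weight_series (mset lam) (min (lam ! i) (lam ! j))) +
        (\<Sum>j=Suc i..<?l. weight_series (mset lam) (min (lam ! i) (lam ! j)))"
      by (rule sum.union_disjoint) auto
    also have "(\<Sum>j<Suc i. weight_series (mset lam) (min (lam ! i) (lam ! j))) = (\<Sum>j<Suc i. ?G i)"
    proof (rule sum.cong[OF refl])
      fix j assume "j \<in> {..<Suc i}"
      then have "lam ! i \<le> lam ! j" using i by (intro mono) auto
      then show "weight_series (mset lam) (min (lam ! i) (lam ! j)) = ?G i" by (simp add: min_absorb1)
    qed
    also have "\<dots> = of_nat (Suc i) * ?G i" by (simp only: sum_constant card_lessThan)
    also have "(\<Sum>j=Suc i..<?l. weight_series (mset lam) (min (lam ! i) (lam ! j))) = T (Suc i)"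
      unfolding T_def
    proof (rule sum.cong[OF refl])
      fix j assume "j \<in> {Suc i..<?l}"
      then have "lam ! j \<le> lam ! i" by (intro mono) auto
      then show "weight_series (mset lam) (min (lam ! i) (lam ! j)) = ?G j" by (simp add: min_absorb2)
    qed
    finally have "?G i = fps_X * ?a i + fps_X * (?a i * ?G i - (of_nat (Suc i) * ?G i + T (Suc i)))"
      using weight_series_eq[of "mset lam" "lam ! i"] by (simp only:)
    from telescope_step[OF this] show ?thesis
      unfolding V_def T by simp
  qed
  have "(\<Prod>j<n. 1 + (of_nat (Suc j) - ?a j) * fps_X) * V 0 =
      (\<Prod>j<n. 1 + (of_nat j - ?a j) * fps_X) * V n" if "n \<le> ?l" for n
    using that
  proof (induction n)
    case (Suc n)
    have "(\<Prod>j<Suc n. 1 + (of_nat (Suc j) - ?a j) * fps_X) * V 0 =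
        (1 + (of_nat (Suc n) - ?a n) * fps_X) * ((\<Prod>j<n. 1 + (of_nat (Suc j) - ?a j) * fps_X) * V 0)"
      by (simp only: prod.lessThan_Suc mult_ac)
    also have "\<dots> = (\<Prod>j<n. 1 + (of_nat j - ?a j) * fps_X) * ((1 + (of_nat (Suc n) - ?a n) * fps_X) * V n)"
      using Suc by (simp only: Suc_le_eq less_imp_le mult_ac)
    also have "(1 + (of_nat (Suc n) - ?a n) * fps_X) * V n = (1 + (of_nat n - ?a n) * fps_X) * V (Suc n)"
      using Suc.prems by (intro step) simp
    finally show ?case by (simp only: prod.lessThan_Suc mult_ac)
  qed simp
  from this[of ?l] have "(\<Prod>j<?l. 1 + (of_nat (Suc j) - ?a j) * fps_X) * V 0 =
      (\<Prod>j<?l. 1 + (of_nat j - ?a j) * fps_X) * V ?l" by simp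
  moreover have "V 0 = 1 - fps_X * E"
    using sum_mset_mset[of "weight_series (mset lam)" lam] by (simp add: V_def T_def E_def atLeast0LessThan)
  moreover have "V ?l = 1 + of_nat ?l * fps_X"
    by (simp add: V_def T_def)
  moreover have "fps_const (of_nat m - c) = of_nat m - (fps_const c :: ratfun fps)" for m c
    by (simp only: fps_of_nat[symmetric] fps_const_sub)
  ultimately show ?thesis by (simp only:)
qed

text \<open>The factor \<open>(u + k) / u\<close> becomes \<open>(u + 1 + k) / (u + 1)\<close>, and
  \<open>R\<close> is \<open>u / (u + 1)\<close>.\<close>

lemma shift_u_linear:
  fixes k :: "'a::field"
  defines "R \<equiv> fps_right_inverse (1 + fps_X) 1"
  shows "(1 + fps_const k * fps_X) oo (fps_X * R) = R * (1 + fps_const (k + 1) * fps_X)"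
proof -
  have R: "(1 + fps_X) * R = 1"
    unfolding R_def by (rule fps_right_inverse) simp
  have c0: "fps_nth (fps_X * R) 0 = 0" by simp
  have "(1 + fps_const k * fps_X) oo (fps_X * R) = 1 + fps_const k * (fps_X * R)"
    by (simp only: fps_compose_add_distrib fps_compose_mult_distrib[OF c0] fps_compose_1 fps_const_compose
        fps_X_fps_compose_startby0[OF c0])
  also have "\<dots> = (1 + fps_X) * R + fps_const k * (fps_X * R)" by (simp only: R)
  also have "\<dots> = R * (1 + (fps_const k + 1) * fps_X)"
    by (simp only: distrib_left distrib_right mult_ac mult_1_left mult_1_right add_ac)
  also have "fps_const k + 1 = fps_const (k + 1)"
    by (simp only: fps_const_1_eq_1[symmetric] fps_const_add)
  finally show ?thesis .
qed

lemma shift_u_prod: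
  fixes k :: "nat \<Rightarrow> 'a::field"
  shows "(\<Prod>j<n. 1 + fps_const (k j) * fps_X) oo (fps_X * fps_right_inverse (1 + fps_X) 1) =
    fps_right_inverse (1 + fps_X) 1 ^ n * (\<Prod>j<n. 1 + fps_const (k j + 1) * fps_X)"
proof -
  have c0: "fps_nth (fps_X * fps_right_inverse (1 + fps_X) 1 :: 'a fps) 0 = 0" by simp
  show ?thesis
    by (simp only: fps_compose_prod_distrib[OF c0] shift_u_linear prod.distrib prod_constant card_lessThan)
qed

lemma eigenvalue_identity:
  assumes lam: "is_partition lam"
  shows "A_eigenvalue lam * fps_right_inverse (shift_u (A_eigenvalue lam)) 1 =
    1 - fps_X * (\<Sum>b\<in>#mset lam. weight_series (mset lam) b)"
proof -
  let ?l = "length lam" and ?E = "\<Sum>b\<in>#mset lam. weight_series (mset lam) b"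
  let ?R = "fps_right_inverse (1 + fps_X) 1 :: ratfun fps"
  define a where "a = A_eigenvalue lam"
  define num where "num = (\<Prod>j<?l. 1 + fps_const (of_nat j - alpha * of_nat (lam ! j)) * fps_X)"
  define den where "den = (\<Prod>j<?l. 1 + fps_const (of_nat j :: ratfun) * fps_X)"
  define num' where "num' = (\<Prod>j<?l. 1 + fps_const (of_nat (Suc j) - alpha * of_nat (lam ! j)) * fps_X)"
  define den' where "den' = (\<Prod>j<?l. 1 + fps_const (of_nat (Suc j) :: ratfun) * fps_X)"
  have a_prod: "a = (\<Prod>j<?l. (1 + fps_const (of_nat j - alpha * of_nat (lam ! j)) * fps_X) /
      (1 + fps_const (of_nat j) * fps_X))"
    unfolding a_def A_eigenvalue_def One_nat_def prod.atLeast1_atMost_eq by simp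
  have a_den: "a * den = num"
    unfolding a_prod den_def num_def prod.distrib[symmetric]
  proof (rule prod.cong[OF refl])
    fix j
    show "(1 + fps_const (of_nat j - alpha * of_nat (lam ! j)) * fps_X) / (1 + fps_const (of_nat j) * fps_X) *
        (1 + fps_const (of_nat j) * fps_X) = 1 + fps_const (of_nat j - alpha * of_nat (lam ! j)) * fps_X"
      by (simp add: fps_divide_unit mult.assoc inverse_mult_eq_1)
  qed
  have nth_prod: "fps_nth (\<Prod>j<n. 1 + fps_const (k j) * fps_X) 0 = 1" for k :: "nat \<Rightarrow> ratfun" and n
    by (induction n) simp_all
  have "fps_nth (a * den) 0 = fps_nth num 0" by (simp only: a_den)
  then have a0: "fps_nth a 0 = 1"
    by (simp add: num_def den_def nth_prod)
  have shift: "shift_u a * den' = num'"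
  proof -
    have c0: "fps_nth (fps_X * ?R) 0 = 0" by simp
    have den_c: "den oo (fps_X * ?R) = ?R ^ ?l * den'"
      unfolding den_def den'_def shift_u_prod by (simp add: add.commute)
    have num_c: "num oo (fps_X * ?R) = ?R ^ ?l * num'"
      unfolding num_def num'_def shift_u_prod by (simp add: algebra_simps)
    have "(1 + fps_X) * ?R = 1" by (rule fps_right_inverse) simp
    \<comment> \<open>Numerator and denominator have equally many factors, so they carry the same
      power of \<open>?R\<close>, which cancels.\<close>
    then have R: "?R ^ ?l \<noteq> 0" by auto
    have "shift_u a * (?R ^ ?l * den') = ?R ^ ?l * num'"
      unfolding shift_u_def den_c[symmetric] num_c[symmetric] a_den[symmetric]
      by (rule fps_compose_mult_distrib[OF c0, symmetric])
    then have "?R ^ ?l * (shift_u a * den') = ?R ^ ?l * num'"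
      by (simp only: mult.left_commute)
    with R show ?thesis by (simp only: mult_cancel_left simp_thms)
  qed
  \<comment> \<open>The denominators of \<open>A(u)\<close> and \<open>A(u + 1)\<close> share all
    factors but the two at the ends, and the one at \<open>j = 0\<close> is 1. What remains is the
    end value of the telescoping product.\<close>
  have den': "den * (1 + of_nat ?l * fps_X) = den'"
  proof -
    have "den * (1 + of_nat ?l * fps_X) = (\<Prod>j<Suc ?l. 1 + fps_const (of_nat j :: ratfun) * fps_X)"
      by (simp add: den_def fps_of_nat)
    also have "\<dots> = den'"
      unfolding den'_def by (subst prod.lessThan_Suc_shift) simp
    finally show ?thesis .
  qed
  have "(1 - fps_X * ?E) * (shift_u a * den') = num' * (1 - fps_X * ?E)"
    unfolding shift by (rule mult.commute)
  also have "\<dots> = num * (1 + of_nat ?l * fps_X)"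
    unfolding num_def num'_def by (rule eigenvalue_product[OF lam])
  also have "\<dots> = a * den'"
    unfolding a_den[symmetric] den'[symmetric] by (simp only: mult.assoc)
  finally have eq: "((1 - fps_X * ?E) * shift_u a) * den' = a * den'"
    by (simp only: mult.assoc)
  moreover have "fps_nth den' 0 = 1" by (simp add: den'_def nth_prod)
  then have "den' \<noteq> 0" by auto
  ultimately have a: "a = (1 - fps_X * ?E) * shift_u a"
    by (simp only: mult_cancel_right simp_thms)
  \<comment> \<open>The constant coefficient is 1, so \<open>fps_right_inverse\<close> with start
    value 1 is a true inverse.\<close>
  have "fps_nth (shift_u a) 0 * 1 = 1"
    by (simp add: shift_u_def a0)
  then have inv: "shift_u a * fps_right_inverse (shift_u a) 1 = 1"
    by (rule fps_right_inverse)
  have "a * fps_right_inverse (shift_u a) 1 =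
      ((1 - fps_X * ?E) * shift_u a) * fps_right_inverse (shift_u a) 1"
    using a by (rule arg_cong)
  also have "\<dots> = 1 - fps_X * ?E"
    by (simp only: mult.assoc inv mult_1_right)
  finally show ?thesis by (simp only: a_def)
qed

section \<open>Comparison of eigenvalues on the Jack functions\<close>

theorem theorem2:
  fixes J :: "nat list \<Rightarrow> ratfun symfun"
    and A I :: "ratfun symop fps"
  assumes "jack_family J"
    and "\<And>lam n. is_partition lam \<Longrightarrow>
           app (fps_nth A n) (J lam) = scale_sf (fps_nth (A_eigenvalue lam) n) (J lam)"
    and "fps_nth I 0 = 0"
    and "1 - fps_X * I = A * fps_right_inverse (shift_u A) 1"
  shows "I = row_matrix_col p_op (resolvent lax) p_star \<and>
    (\<forall>k\<ge>1. has_iter_opsum k lax_term (fps_nth I k))"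
proof -
  have I: "fps_nth I (Suc k) = hamiltonian k" for k
  proof (rule symop_eqI_jack[OF assms(1)])
    fix lam assume lam: "is_partition lam"
    let ?E = "\<Sum>b\<in>#mset lam. weight_series (mset lam) b"
    have "eigen (J lam) A (A_eigenvalue lam)"
      using assms(2)[OF lam] by (simp add: eigen_def)
    then have "eigen (J lam) (1 - fps_X * I) (1 - fps_X * ?E)"
      unfolding assms(4) eigenvalue_identity[OF lam, symmetric]
      by (intro eigen_mult eigen_right_inverse eigen_shift_u)
    \<comment> \<open>The factor \<open>fps_X\<close> shifts the index by one, so coefficient
      \<open>Suc k\<close> of \<open>I\<close> is read off here. Neither series has a contribution
      from the constant 1 at this index.\<close>
    then have "app (fps_nth (1 - fps_X * I) (Suc (Suc k))) (J lam) =
        scale_sf (fps_nth (1 - fps_X * ?E) (Suc (Suc k))) (J lam)"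
      by (rule eigenD)
    then have "app (fps_nth I (Suc k)) (J lam) = scale_sf (fps_nth ?E (Suc k)) (J lam)"
      by simp
    also have "fps_nth ?E (Suc k) = (\<Sum>b\<in>#mset lam. lax_weight (mset lam) k b)"
      by (simp add: fps_nth_sum_mset weight_series_def)
    finally show "app (fps_nth I (Suc k)) (J lam) = app (hamiltonian k) (J lam)"
      by (simp only: hamiltonian_jack[OF assms(1) lam])
  qed
  have "I = row_matrix_col p_op (resolvent lax) p_star"
  proof (rule fps_ext)
    fix n
    show "fps_nth I n = fps_nth (row_matrix_col p_op (resolvent lax) p_star) n"
      unfolding row_matrix_col_hamiltonian by (cases n) (simp_all add: I assms(3))
  qed
  moreover have "has_iter_opsum k lax_term (fps_nth I k)" if "k \<ge> 1" for k
    using that has_iter_opsum_hamiltonian[of "k - 1"] I[of "k - 1"] by simp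
  ultimately show ?thesis by blast
qed

end
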